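(* Let $\Omega\subset Y$ be open and bounded, and let $A:\overline{\Omega}\to X^*$ be bounded, demi-continuous and of class $(S)_+$, satisfying condition $(H)$ and $A[u]\neq 0$ in $X^*$ for all $u\in\partial\Omega$. Then the index $\mathrm{ind}(A,\Omega)=\lim_{n\to\infty}\deg_B(A_n,\Omega_n,0)$ has the following properties. (1) If $\mathrm{ind}(A,\Omega)\neq 0$, then there is $u\in\Omega$ with $A[u]=0$ in $X^*$. (2) If $\Omega=\Omega_1\cup\Omega_2$ with $\Omega_1,\Omega_2$ disjoint open sets, then $\mathrm{ind}(A,\Omega)=\mathrm{ind}(A,\Omega_1)+\mathrm{ind}(A,\Omega_2)$. (3) If $h:[0,1]\times\overline{\Omega}\to X^*$ is an admissible homotopy, then $\mathrm{ind}(h(t),\Omega)$ is independent of $t\in[0,1]$.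
   Context: Setting: $X$ is a real Banach space, $Y$ is a separable reflexive real Banach space, $i:Y\to X$ is a continuous (injective, linear) embedding, and $\langle\cdot,\cdot\rangle$ is the pairing between $X^*$ and $X$. $H$ is a Hilbert space with a dense, compact (injective, linear) embedding $j:H\to Y$; $\{h_1,h_2,\dots\}$ is a fixed basis of $H$, $y_k=j(h_k)$, and $Y_n=\mathrm{span}\{y_1,\dots,y_n\}\subset Y$, with the inner product on $Y_n$ for which $(y_i,y_j)=\delta_{ij}$. For a map $A:\overline{\Omega}\subset Y\to X^*$: - $A$ is bounded if its image is a bounded subset of $X^*$. - $A$ is demi-continuous if $u_n\to u$ in $Y$ implies $\langle A[u_n],i(y)\rangle\to\langle A[u],i(y)\rangle$ for all $y\in Y$. - $A$ is $(S)_+$ if for every sequence $(u_n)$ in the domain of $A$ with $u_n\rightharpoonup u$ weakly in $Y$, the inequality $\limsup_{n}\langle A[u_n],i(u_n-u)\rangle\le 0$ implies $u_n\to u$ in $Y$. - Condition $(H)$: for $u$ in the domain of $A$, if $\langle A[u],i(y)\rangle=0$ for all $y\in Y$ then $\langle A[u],x\rangle=0$ for all $x\in X$. The finite rank approximation is $A_n(u)=\sum_{k=1}^n\langle A[u],i(y_k)\rangle y_k\in Y_n$, and $\Omega_n=\Omega\cap Y_n$ (an open bounded subset of $Y_n$). $\deg_B$ is the Brouwer degree; for $A$ as in the claim, $\deg_B(A_n,\Omega_n,0)$ is well defined and constant for all large $n$, so the limit defining $\mathrm{ind}(A,\Omega)$ exists. Admissible homotopy: a family $h:[0,1]\times\overline{\Omega}\to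 X^*$, written $h(t)(u)$, such that (i) $h$ is bounded (its image is bounded in $X^*$) and demi-continuous (if $t_n\to t$ and $u_n\to u$ in $Y$, then $\langle h(t_n)(u_n),i(y)\rangle\to\langle h(t)(u),i(y)\rangle$ for all $y\in Y$); (ii) $h(t)(u)\neq 0$ for all $t\in[0,1]$, $u\in\partial\Omega$; (iii) for all $t_n\to t$ in $[0,1]$ and $u_n\in\overline{\Omega}$ with $u_n\rightharpoonup u$ in $Y$, $\limsup_n\langle h(t_n)(u_n),i(u_n-u)\rangle\le 0$ implies $u_n\to u$ in $Y$; (iv) for every $t\in[0,1]$ the map $h(t)$ satisfies condition $(H)$. *)

theory Defs
  imports "HOL-Analysis.Analysis" "HOL-Homology.Homology"
begin

section \<open>Brouwer degree\<close>

definition euclidean_cball :: "nat \<Rightarrow> real \<Rightarrow> (nat \<Rightarrow> real) set" where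
  "euclidean_cball n r = {x \<in> topspace (Euclidean_space n). (\<Sum>k<n. (x k)\<^sup>2) \<le> r\<^sup>2}"

text \<open>
  The Brouwer degree \<open>deg(f, U, 0)\<close> of a map on an open subset \<open>U\<close> of \<open>\<real>\<^sup>n\<close>, following Dold,
  Lectures on Algebraic Topology, VIII.4. The space \<open>\<real>\<^sup>n\<close> is \<^term>\<open>Euclidean_space n\<close>, that is,
  the sequences vanishing from index \<open>n\<close> on, so that \<open>n\<close> may vary within a formula.

  Let \<open>K\<close> be the set of zeros of \<open>f\<close> in \<open>U\<close> and \<open>B\<close> a closed ball around \<open>0\<close> that contains \<open>K\<close>.
  The maps involved are
  \<open>H\<^sub>n(\<real>\<^sup>n, \<real>\<^sup>n - B) \<rightarrow> H\<^sub>n(\<real>\<^sup>n, \<real>\<^sup>n - K) \<leftarrow> H\<^sub>n(U, U - K) \<rightarrow> H\<^sub>n(\<real>\<^sup>n, \<real>\<^sup>n - {0})\<close>,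
  where the first is a restriction, the second is an excision isomorphism and the third is induced
  by \<open>f\<close>. The first group is infinite cyclic; an orientation class \<open>a\<close> in it restricts to the
  fundamental class along \<open>K\<close>, and \<open>b\<close> below is the corresponding class in \<open>H\<^sub>n(U, U - K)\<close>. The degree
  is the integer \<open>d\<close> for which \<open>f\<close> maps \<open>b\<close> to \<open>d\<close> times the restriction of \<open>a\<close> to
  \<open>H\<^sub>n(\<real>\<^sup>n, \<real>\<^sup>n - {0})\<close>. As in \<^const>\<open>Brouwer_degree2\<close>, letting \<open>a\<close> range over the whole group
  avoids the choice of a generator. The homology groups are written multiplicatively, so the
  multiple is a power.

  The value is meaningful when \<open>f\<close> is continuous on the closure of the bounded open set \<open>U\<close>, with
  values in \<open>\<real>\<^sup>n\<close>, and has no zero on the boundary of \<open>U\<close>.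
\<close>

definition brouwer_degree ::
  "nat \<Rightarrow> ((nat \<Rightarrow> real) \<Rightarrow> nat \<Rightarrow> real) \<Rightarrow> (nat \<Rightarrow> real) set \<Rightarrow> int" where
  "brouwer_degree n f U =
    (let E = Euclidean_space n; S = topspace E; o0 = (\<lambda>_. 0); K = {x \<in> U. f x = o0} in
     THE d::int. \<forall>r. K \<subseteq> euclidean_cball n r \<longrightarrow>
       (\<forall>a \<in> carrier (relative_homology_group (int n) E (S - euclidean_cball n r)).
        \<forall>b \<in> carrier (relative_homology_group (int n) (subtopology E U) (U - K)).
          hom_induced (int n) (subtopology E U) (U - K) E (S - K) id b =
          hom_induced (int n) E (S - euclidean_cball n r) E (S - K) id a \<longrightarrow>
          hom_induced (int n) (subtopology E U) (U - K) E (S - {o0}) f b =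
          hom_induced (int n) E (S - euclidean_cball n r) E (S - {o0}) id a
            [^]\<^bsub>relative_homology_group (int n) E (S - {o0})\<^esub> d))"

text \<open>
  The degree on the span of linearly independent vectors \<open>y 0, \<dots>, y (n-1)\<close>, transported along the
  isomorphism with \<open>\<real>\<^sup>n\<close> that carries the \<open>y k\<close> to the standard basis. This isomorphism is an
  isometry for the inner product in which the \<open>y k\<close> are orthonormal.
\<close>

definition lincomb :: "(nat \<Rightarrow> 'y::real_vector) \<Rightarrow> nat \<Rightarrow> (nat \<Rightarrow> real) \<Rightarrow> 'y" where
  "lincomb y n c = (\<Sum>k<n. c k *\<^sub>R y k)"

definition coords :: "(nat \<Rightarrow> 'y::real_vector) \<Rightarrow> nat \<Rightarrow> 'y \<Rightarrow> nat \<Rightarrow> real" where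
  "coords y n = the_inv_into (topspace (Euclidean_space n)) (lincomb y n)"

definition span_degree ::
  "(nat \<Rightarrow> 'y::real_vector) \<Rightarrow> nat \<Rightarrow> ('y \<Rightarrow> 'y) \<Rightarrow> 'y set \<Rightarrow> int" where
  "span_degree y n F U =
    brouwer_degree n (\<lambda>c. coords y n (F (lincomb y n c))) (coords y n ` U)"

section \<open>Spaces and bases\<close>

definition reflexive_space :: "'a::real_normed_vector itself \<Rightarrow> bool" where
  "reflexive_space _ \<longleftrightarrow>
    (\<forall>\<phi> :: ('a \<Rightarrow>\<^sub>L real) \<Rightarrow>\<^sub>L real. \<exists>y. \<forall>f. blinfun_apply \<phi> f = blinfun_apply f y)"

definition weakly_converges :: "(nat \<Rightarrow> 'a::real_normed_vector) \<Rightarrow> 'a \<Rightarrow> bool" where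
  "weakly_converges u v \<longleftrightarrow>
    (\<forall>f :: 'a \<Rightarrow>\<^sub>L real. (\<lambda>n. blinfun_apply f (u n)) \<longlonglongrightarrow> blinfun_apply f v)"

definition schauder_basis :: "(nat \<Rightarrow> 'a::real_normed_vector) \<Rightarrow> bool" where
  "schauder_basis h \<longleftrightarrow> (\<forall>x. \<exists>!c :: nat \<Rightarrow> real. (\<lambda>k. c k *\<^sub>R h k) sums x)"

definition embedding :: "('a::real_normed_vector \<Rightarrow> 'b::real_normed_vector) \<Rightarrow> bool" where
  "embedding i \<longleftrightarrow> bounded_linear i \<and> inj i"

definition dense_compact_embedding ::
  "('a::real_normed_vector \<Rightarrow> 'b::real_normed_vector) \<Rightarrow> bool" where
  "dense_compact_embedding j \<longleftrightarrow> embedding j \<and> closure (range j) = UNIV \<and>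
    (\<forall>S. bounded S \<longrightarrow> compact (closure (j ` S)))"

section \<open>Maps from a subset of \<open>Y\<close> to the dual of \<open>X\<close>\<close>

text \<open>Below, \<open>D\<close> is the domain of the map \<open>A\<close>, and the dual of \<open>X\<close> is the type \<^typ>\<open>'x \<Rightarrow>\<^sub>L real\<close>.\<close>

definition demicontinuous_on ::
  "'y set \<Rightarrow> ('y \<Rightarrow> 'x) \<Rightarrow> ('y::real_normed_vector \<Rightarrow> 'x::real_normed_vector \<Rightarrow>\<^sub>L real) \<Rightarrow> bool"
  where
  "demicontinuous_on D i A \<longleftrightarrow>
    (\<forall>u v. (\<forall>n. u n \<in> D) \<and> v \<in> D \<and> u \<longlonglongrightarrow> v \<longrightarrow>
      (\<forall>y. (\<lambda>n. blinfun_apply (A (u n)) (i y)) \<longlonglongrightarrow> blinfun_apply (A v) (i y)))"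

definition S_plus_on ::
  "'y set \<Rightarrow> ('y \<Rightarrow> 'x) \<Rightarrow> ('y::real_normed_vector \<Rightarrow> 'x::real_normed_vector \<Rightarrow>\<^sub>L real) \<Rightarrow> bool"
  where
  "S_plus_on D i A \<longleftrightarrow>
    (\<forall>u v. (\<forall>n. u n \<in> D) \<and> weakly_converges u v \<and>
      limsup (\<lambda>n. ereal (blinfun_apply (A (u n)) (i (u n - v)))) \<le> 0 \<longrightarrow> u \<longlonglongrightarrow> v)"

definition condition_H_on ::
  "'y set \<Rightarrow> ('y \<Rightarrow> 'x) \<Rightarrow> ('y::real_normed_vector \<Rightarrow> 'x::real_normed_vector \<Rightarrow>\<^sub>L real) \<Rightarrow> bool"
  where
  "condition_H_on D i A \<longleftrightarrow>
    (\<forall>u\<in>D. (\<forall>y. blinfun_apply (A u) (i y) = 0) \<longrightarrow> (\<forall>x. blinfun_apply (A u) x = 0))"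

definition admissible_homotopy ::
  "'y set \<Rightarrow> ('y \<Rightarrow> 'x) \<Rightarrow>
    (real \<Rightarrow> 'y::real_normed_vector \<Rightarrow> 'x::real_normed_vector \<Rightarrow>\<^sub>L real) \<Rightarrow> bool"
  where
  "admissible_homotopy \<Omega> i h \<longleftrightarrow>
    bounded {h t u | t u. t \<in> {0..1} \<and> u \<in> closure \<Omega>} \<and>
    (\<forall>s t u v. (\<forall>n. s n \<in> {0..1}) \<and> t \<in> {0..1} \<and> s \<longlonglongrightarrow> t \<and>
        (\<forall>n. u n \<in> closure \<Omega>) \<and> v \<in> closure \<Omega> \<and> u \<longlonglongrightarrow> v \<longrightarrow>
      (\<forall>y. (\<lambda>n. blinfun_apply (h (s n) (u n)) (i y)) \<longlonglongrightarrow> blinfun_apply (h t v) (i y))) \<and>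
    (\<forall>t\<in>{0..1}. \<forall>u\<in>frontier \<Omega>. h t u \<noteq> 0) \<and>
    (\<forall>s t u v. (\<forall>n. s n \<in> {0..1}) \<and> t \<in> {0..1} \<and> s \<longlonglongrightarrow> t \<and>
        (\<forall>n. u n \<in> closure \<Omega>) \<and> weakly_converges u v \<and>
        limsup (\<lambda>n. ereal (blinfun_apply (h (s n) (u n)) (i (u n - v)))) \<le> 0 \<longrightarrow> u \<longlonglongrightarrow> v) \<and>
    (\<forall>t\<in>{0..1}. condition_H_on (closure \<Omega>) i (h t))"

section \<open>Finite rank approximations and the index\<close>

text \<open>The vectors \<open>y\<^sub>1, y\<^sub>2, \<dots>\<close> are indexed from \<open>0\<close>: \<open>y k\<close> stands for \<open>y\<^sub>k\<^sub>+\<^sub>1\<close>.\<close>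

definition fin_span :: "(nat \<Rightarrow> 'y::real_vector) \<Rightarrow> nat \<Rightarrow> 'y set" where
  "fin_span y n = span (y ` {..<n})"

definition finite_rank_approx ::
  "('y \<Rightarrow> 'x) \<Rightarrow> (nat \<Rightarrow> 'y) \<Rightarrow> ('y::real_normed_vector \<Rightarrow> 'x::real_normed_vector \<Rightarrow>\<^sub>L real) \<Rightarrow>
    nat \<Rightarrow> 'y \<Rightarrow> 'y" where
  "finite_rank_approx i y A n u = (\<Sum>k<n. blinfun_apply (A u) (i (y k)) *\<^sub>R y k)"

definition approx_degree ::
  "('y \<Rightarrow> 'x) \<Rightarrow> (nat \<Rightarrow> 'y) \<Rightarrow> ('y::real_normed_vector \<Rightarrow> 'x::real_normed_vector \<Rightarrow>\<^sub>L real) \<Rightarrow>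
    'y set \<Rightarrow> nat \<Rightarrow> int" where
  "approx_degree i y A \<Omega> n =
    span_degree y n (finite_rank_approx i y A n) (\<Omega> \<inter> fin_span y n)"

definition ind ::
  "('y \<Rightarrow> 'x) \<Rightarrow> (nat \<Rightarrow> 'y) \<Rightarrow> ('y::real_normed_vector \<Rightarrow> 'x::real_normed_vector \<Rightarrow>\<^sub>L real) \<Rightarrow>
    'y set \<Rightarrow> int" where
  "ind i y A \<Omega> = lim (approx_degree i y A \<Omega>)"

end

theory Submission
  imports Defs
begin

text \<open>
  Everything rests on one compactness argument. Let \<open>u\<^sub>n\<close> be zeros of finite rank approximations, at
  possibly varying stages of an admissible homotopy, such that the pairing of the value at \<open>u\<^sub>n\<close> with
  \<open>u\<^sub>n\<close> is nonpositive. A subsequence converges weakly by reflexivity, the density of the span of the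
  \<open>y\<^sub>k\<close> gives the limsup inequality, so the \<open>(S)\<^sub>+\<close> property makes the convergence strong, and condition
  \<open>(H)\<close> shows that the limit is a zero. Hence, for large \<open>n\<close>, neither the approximations nor the
  convex combinations of \<open>A\<^sub>n\<^sub>+\<^sub>1\<close> with \<open>A\<^sub>n\<close> plus the last coordinate vanish on the boundary, and the
  properties of the Brouwer degree carry over to the index.

  The required properties of the homologically defined Brouwer degree follow from the
  Eilenberg-Steenrod axioms. The independence of \<open>n\<close> uses the suspension isomorphism
  \<open>H\<^sub>n\<^sub>+\<^sub>1(V \<times> \<real>, V \<times> \<real> - K) \<cong> H\<^sub>n(V, V - K)\<close> and its naturality.
\<close>

section \<open>Relative homology of subsets\<close>

text \<open>Two consecutive approximations live in different dimensions, and their degrees can only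
  be compared after the last coordinate of the higher one has been replaced by the identity. The
  straight line between the two last coordinates is harmless for a reason of sign: at a zero, the
  last pairing and the last coefficient cannot have the same strict sign, so the pairing with the
  zero itself is nonpositive, which is what \<open>(S)_+\<close> asks for. Suspension applies to
  cylinders only, whereas the coordinate image of \<open>\<Omega>\<close> is arbitrary. Excision to
  a neighbourhood of the zeros bridges this gap, and for that the degree must be known to depend
  only on the map near its zeros. The orientations of different dimensions never have to be matched:
  the suspension isomorphism is applied both to the orientation class and to the image class, so a
  sign in it would cancel. All Euclidean spaces are sets of sequences in one type with the subspace
  topology, which makes each of them literally a subset of the next.\<close>

abbreviation rel_hom :: "int \<Rightarrow> 'a::topological_space set \<Rightarrow> 'a set \<Rightarrow> 'a chain set monoid" where
  "rel_hom p X S \<equiv> relative_homology_group p (top_of_set X) S"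

abbreviation hom_ind :: "int \<Rightarrow> 'a::topological_space set \<Rightarrow> 'a set \<Rightarrow>
    'b::topological_space set \<Rightarrow> 'b set \<Rightarrow> ('a \<Rightarrow> 'b) \<Rightarrow> 'a chain set \<Rightarrow> 'b chain set" where
  "hom_ind p X S Y T f \<equiv> hom_induced p (top_of_set X) S (top_of_set Y) T f"

lemma hom_ind_comp:
  assumes "continuous_on X f" "f \<in> X \<rightarrow> Y" "f \<in> S \<rightarrow> T"
    and "continuous_on Y g" "g \<in> Y \<rightarrow> Z" "g \<in> T \<rightarrow> U"
  shows "hom_ind p Y T Z U g (hom_ind p X S Y T f x) = hom_ind p X S Z U (g \<circ> f) x"
  using assms by (intro hom_induced_compose') auto

lemma hom_ind_cong:
  assumes "\<And>x. x \<in> X \<Longrightarrow> f x = g x"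
  shows "hom_ind p X S Y T f = hom_ind p X S Y T g"
  by (rule hom_induced_eq) (use assms in auto)

lemma hom_ind_incl_comp:
  assumes "X \<subseteq> Y" "S \<subseteq> T" "continuous_on Y g" "g \<in> Y \<rightarrow> Z" "g \<in> T \<rightarrow> U"
  shows "hom_ind p Y T Z U g (hom_ind p X S Y T id x) = hom_ind p X S Z U g x"
proof -
  have "id \<in> X \<rightarrow> Y" "id \<in> S \<rightarrow> T" using assms by auto
  then show ?thesis
    using hom_ind_comp[of X id Y S T g Z U p x] assms(3-) by (simp del: id_apply)
qed

lemma hom_ind_comp_incl:
  assumes "Y \<subseteq> Z" "T \<subseteq> U" "continuous_on X f" "f \<in> X \<rightarrow> Y" "f \<in> S \<rightarrow> T"
  shows "hom_ind p Y T Z U id (hom_ind p X S Y T f x) = hom_ind p X S Z U f x"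
proof -
  have "id \<in> Y \<rightarrow> Z" "id \<in> T \<rightarrow> U" using assms by auto
  then show ?thesis
    using hom_ind_comp[of X f Y S T id Z U p x] assms(3-) by (simp del: id_apply)
qed

lemma hom_ind_homotopic:
  fixes k :: "real \<Rightarrow> 'a::topological_space \<Rightarrow> 'b::topological_space"
  assumes "S \<subseteq> X" "continuous_on ({0..1} \<times> X) (\<lambda>z. k (fst z) (snd z))"
    and "\<And>t x. t \<in> {0..1} \<Longrightarrow> x \<in> X \<Longrightarrow> k t x \<in> Y"
    and "\<And>t x. t \<in> {0..1} \<Longrightarrow> x \<in> S \<Longrightarrow> k t x \<in> T"
  shows "hom_ind p X S Y T (k 0) = hom_ind p X S Y T (k 1)"
proof (rule homology_homotopy_axiom)
  \<comment> \<open>The rule \<open>homotopic_with\<close> asks for a predicate that depends only on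
    values on \<open>X\<close>; this is where \<open>S \<subseteq> X\<close> enters.\<close>
  have "homotopic_with (\<lambda>h::'a \<Rightarrow> 'b. h \<in> S \<rightarrow> T) (top_of_set X) (top_of_set Y) (k 0) (k 1) \<longleftrightarrow>
    (\<exists>h. continuous_map (prod_topology (top_of_set {0..1::real}) (top_of_set X)) (top_of_set Y) h \<and>
      (\<forall>x\<in>topspace (top_of_set X). h (0, x) = k 0 x) \<and>
      (\<forall>x\<in>topspace (top_of_set X). h (1, x) = k 1 x) \<and> (\<forall>t\<in>{0..1}. (\<lambda>x. h (t, x)) \<in> S \<rightarrow> T))"
    by (rule homotopic_with) (use \<open>S \<subseteq> X\<close> in \<open>auto simp: Pi_iff subset_iff\<close>)
  moreover have "continuous_map (prod_topology (top_of_set {0..1}) (top_of_set X)) (top_of_set Y)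
      (\<lambda>z. k (fst z) (snd z))"
    unfolding prod_topology_subtopology_eu using assms by auto
  ultimately show "homotopic_with (\<lambda>h::'a \<Rightarrow> 'b. h \<in> S \<rightarrow> T) (top_of_set X) (top_of_set Y) (k 0) (k 1)"
    using assms(4) by (auto intro!: exI[of _ "\<lambda>z. k (fst z) (snd z)"])
qed

lemma hom_ind_one [simp]:
  "hom_ind p X S Y T f \<one>\<^bsub>rel_hom p X S\<^esub> = \<one>\<^bsub>rel_hom p Y T\<^esub>"
  by (rule hom_one[OF hom_induced_hom]) auto

lemma hom_ind_mult:
  "x \<in> carrier (rel_hom p X S) \<Longrightarrow> y \<in> carrier (rel_hom p X S) \<Longrightarrow>
    hom_ind p X S Y T f (x \<otimes>\<^bsub>rel_hom p X S\<^esub> y) =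
    hom_ind p X S Y T f x \<otimes>\<^bsub>rel_hom p Y T\<^esub> hom_ind p X S Y T f y"
  by (rule hom_mult[OF hom_induced_hom])

lemma hom_ind_int_pow:
  "x \<in> carrier (rel_hom p X S) \<Longrightarrow>
    hom_ind p X S Y T f (x [^]\<^bsub>rel_hom p X S\<^esub> (k::int)) =
    hom_ind p X S Y T f x [^]\<^bsub>rel_hom p Y T\<^esub> k"
  by (rule hom_int_pow[OF hom_induced_hom]) auto

text \<open>The identity of the pair is homotopic, through maps of pairs, to a map that factors
  through \<open>(S, S)\<close>, whose relative homology is trivial.\<close>

lemma trivial_rel_hom_push:
  fixes k :: "real \<Rightarrow> 'a::topological_space \<Rightarrow> 'a"
  assumes "S \<subseteq> X" "continuous_on ({0..1} \<times> X) (\<lambda>z. k (fst z) (snd z))"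
    and "\<And>t x. t \<in> {0..1} \<Longrightarrow> x \<in> X \<Longrightarrow> k t x \<in> X"
    and "\<And>t x. t \<in> {0..1} \<Longrightarrow> x \<in> S \<Longrightarrow> k t x \<in> S"
    and "\<And>x. x \<in> X \<Longrightarrow> k 0 x = x" "\<And>x. x \<in> X \<Longrightarrow> k 1 x \<in> S"
  shows "trivial_group (rel_hom p X S)"
proof -
  have cont1: "continuous_on X (k 1)"
  proof -
    have "continuous_on X ((\<lambda>z. k (fst z) (snd z)) \<circ> (\<lambda>x. (1, x)))"
      by (intro continuous_on_compose continuous_on_subset[OF assms(2)] continuous_intros) auto
    then show ?thesis by (simp add: o_def)
  qed
  have "c = \<one>\<^bsub>rel_hom p X S\<^esub>" if c: "c \<in> carrier (rel_hom p X S)" for c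
  proof -
    have "c = hom_ind p X S X S (k 0) c"
      using hom_induced_id[OF c] hom_ind_cong[of X id "k 0"] assms(5) by fastforce
    also have "\<dots> = hom_ind p X S X S (k 1) c"
      using hom_ind_homotopic[OF assms(1-4)] by metis
    also have "\<dots> = hom_ind p S S X S id (hom_ind p X S S S (k 1) c)"
      using assms cont1 by (subst hom_ind_comp_incl) auto
    also have "hom_ind p X S S S (k 1) c = \<one>\<^bsub>rel_hom p S S\<^esub>"
      using trivial_relative_homology_group_topspace[of p "top_of_set S"]
        hom_induced_carrier[of p "top_of_set X" S "top_of_set S" S "k 1" c]
      by (auto simp: trivial_group_def)
    finally show ?thesis by simp
  qed
  then have "carrier (rel_hom p X S) = {\<one>\<^bsub>rel_hom p X S\<^esub>}"
    using group.is_monoid[OF group_relative_homology_group] monoid.one_closed by blast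
  then show ?thesis
    by (simp add: trivial_group_def)
qed

text \<open>\<open>exact_seq\<close> lists groups from the target back to the source, so the
  sequence is \<open>F\<close>, \<open>G\<close>, \<open>H\<close>, \<open>J\<close> in the
  direction of the maps. A trivial \<open>J\<close> gives surjectivity of \<open>h\<close>, a
  trivial \<open>F\<close> injectivity.\<close>

lemma iso_if_exact_trivial:
  assumes "exact_seq ([J, H, G], [k, h])" "exact_seq ([H, G, F], [h, f])"
    and "trivial_group F" "trivial_group J"
  shows "h \<in> iso G H"
proof -
  interpret h: group_hom G H h using assms(1) by simp
  interpret f: group_hom F G f using assms(2) by simp
  have "kernel H J k = carrier H"
    using assms(1,4) by (auto simp: kernel_def trivial_group_def hom_def)
  moreover have "kernel H J k = h ` carrier G" "kernel G H h = f ` carrier F"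
    using assms(1,2) by simp_all
  ultimately show ?thesis
    using assms(3) h.trivial_ker_imp_inj by (simp add: iso_iff trivial_group_def h.homh)
qed

text \<open>In the long exact sequence of the triple, the neighbours of this map are the homology of
  \<open>(S, T)\<close> in degrees \<open>p\<close> and \<open>p - 1\<close>, hence the assumption
  in all degrees.\<close>

lemma iso_rel_hom_triple:
  assumes "T \<subseteq> S" "S \<subseteq> X" "\<And>p. trivial_group (rel_hom p S T)"
  shows "hom_ind p X T X S id \<in> iso (rel_hom p X T) (rel_hom p X S)"
proof -
  have SX: "subtopology (top_of_set X) S = top_of_set S"
    using assms by (simp add: subtopology_subtopology Int_absorb1)
  have "exact_seq ([rel_hom p X S, rel_hom p X T, rel_hom p S T],
      [hom_ind p X T X S id, hom_induced p (top_of_set S) T (top_of_set X) T id])"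
    using homology_exactness_triple_3[OF assms(1), of p "top_of_set X"] by (simp only: SX)
  moreover have "exact_seq ([rel_hom (p-1) S T, rel_hom p X S, rel_hom p X T],
      [hom_relboundary p (top_of_set X) S T, hom_ind p X T X S id])"
    using homology_exactness_triple_1[OF assms(1), of p "top_of_set X"] by (simp only: SX)
  ultimately show ?thesis
    using assms(3) by (rule_tac iso_if_exact_trivial)
qed

text \<open>The same exact sequence read one place further on: now the neighbours are the homology
  of \<open>(X, T)\<close> in degrees \<open>p\<close> and \<open>p - 1\<close>.\<close>

lemma iso_relboundary_triple:
  assumes "T \<subseteq> S" "S \<subseteq> X" "\<And>p. trivial_group (rel_hom p X T)"
  shows "hom_relboundary p (top_of_set X) S T \<in> iso (rel_hom p X S) (rel_hom (p - 1) S T)"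
proof -
  have SX: "subtopology (top_of_set X) S = top_of_set S"
    using assms by (simp add: subtopology_subtopology Int_absorb1)
  have "exact_seq ([rel_hom (p-1) S T, rel_hom p X S, rel_hom p X T],
      [hom_relboundary p (top_of_set X) S T, hom_ind p X T X S id])"
    using homology_exactness_triple_1[OF assms(1), of p "top_of_set X"] by (simp only: SX)
  moreover have "exact_seq ([rel_hom (p-1) X T, rel_hom (p-1) S T, rel_hom p X S],
      [hom_induced (p-1) (top_of_set S) T (top_of_set X) T id, hom_relboundary p (top_of_set X) S T])"
    using homology_exactness_triple_2[OF assms(1), of p "top_of_set X"] by (simp only: SX)
  ultimately show ?thesis
    using assms(3) by (rule_tac iso_if_exact_trivial)
qed

text \<open>The set cut out is \<open>X - V\<close>, which is closed and contained in the open set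
  \<open>X - K\<close>, so the closure and interior condition of the axiom is met.\<close>

lemma iso_rel_hom_excision:
  fixes X V K :: "'a::topological_space set"
  assumes "openin (top_of_set X) V" "closedin (top_of_set X) K" "K \<subseteq> V"
  shows "hom_ind p V (V - K) X (X - K) id \<in> iso (rel_hom p V (V - K)) (rel_hom p X (X - K))"
proof -
  have VX: "V \<subseteq> X" using assms(1) by (rule openin_imp_subset)
  have cl: "top_of_set X closure_of (X - V) = X - V"
    using assms(1) by (intro closure_of_closedin) (auto intro: closedin_diff)
  have op: "top_of_set X interior_of (X - K) = X - K"
    using assms(2) by (intro interior_of_openin) (auto intro: openin_diff)
  have "hom_induced p (subtopology (top_of_set X) (X - (X - V))) (X - K - (X - V)) (subtopology (top_of_set X) X) (X - K) id
    \<in> iso (relative_homology_group p (subtopology (top_of_set X) (X - (X - V))) (X - K - (X - V)))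
          (relative_homology_group p (subtopology (top_of_set X) X) (X - K))"
    by (rule homology_excision_axiom) (use assms(3) in \<open>auto simp: cl op\<close>)
  moreover have "X - (X - V) = V" "X - K - (X - V) = V - K"
    using VX by auto
  ultimately show ?thesis
    using VX by (simp add: subtopology_subtopology Int_absorb1)
qed

section \<open>Suspension\<close>

abbreviation Rn :: "nat \<Rightarrow> (nat \<Rightarrow> real) set" where
  "Rn n \<equiv> topspace (Euclidean_space n)"

lemma Euclidean_space_eq: "Euclidean_space n = top_of_set (Rn n)"
  by (simp add: topspace_Euclidean_space Euclidean_space_def euclidean_product_topology)

lemma continuous_on_fun_upd:
  fixes f :: "'a::topological_space \<Rightarrow> 'i \<Rightarrow> 'b::topological_space"
  assumes "continuous_on X f" "continuous_on X g"
  shows "continuous_on X (\<lambda>x. (f x)(n := g x))"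
proof (rule continuous_on_coordinatewise_then_product)
  show "continuous_on X (\<lambda>x. ((f x)(n := g x)) i)" for i
    using assms(2) continuous_on_product_then_coordinatewise[OF assms(1), of i]
    by (cases "i = n") auto
qed

lemma continuous_on_coordinate: "continuous_on X (\<lambda>c. c i)"
  by (rule continuous_on_product_then_coordinatewise) (rule continuous_on_id)

lemma continuous_on_snd_coordinate: "continuous_on X (\<lambda>z. snd z i)"
  by (rule continuous_on_product_then_coordinatewise) (intro continuous_intros)

text \<open>The product of \<open>V\<close> with a line. Coordinate \<open>n\<close> is the first
  one that vanishes on \<open>Rn n\<close>, so it serves as the height and \<open>c(n := 0)\<close>
  as the projection; \<open>V\<close> itself lies in the cylinder at height zero.\<close>

definition cyl :: "nat \<Rightarrow> (nat \<Rightarrow> real) set \<Rightarrow> (nat \<Rightarrow> real) set" where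
  "cyl n V = {c \<in> Rn (Suc n). c(n := 0) \<in> V}"

text \<open>The cylinder without the closed half-lines that hang down from the points of
  \<open>K\<close>. Over points outside \<open>K\<close> every height is kept, so that the upper and
  the lower part overlap in the cylinder over \<open>V - K\<close>.\<close>

definition upper_cyl :: "nat \<Rightarrow> (nat \<Rightarrow> real) set \<Rightarrow> (nat \<Rightarrow> real) set \<Rightarrow> (nat \<Rightarrow> real) set" where
  "upper_cyl n V K = {c \<in> cyl n V. c n > 0 \<or> c(n := 0) \<notin> K}"

definition lower_cyl :: "nat \<Rightarrow> (nat \<Rightarrow> real) set \<Rightarrow> (nat \<Rightarrow> real) set \<Rightarrow> (nat \<Rightarrow> real) set" where
  "lower_cyl n V K = {c \<in> cyl n V. c n < 0 \<or> c(n := 0) \<notin> K}"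

definition cyl_map :: "nat \<Rightarrow> ((nat \<Rightarrow> real) \<Rightarrow> nat \<Rightarrow> real) \<Rightarrow> (nat \<Rightarrow> real) \<Rightarrow> nat \<Rightarrow> real" where
  "cyl_map n f c = (f (c(n := 0)))(n := c n)"

lemma Rn_upd_0: "c \<in> Rn (Suc n) \<Longrightarrow> c(n := 0) \<in> Rn n"
  by (auto simp: topspace_Euclidean_space Suc_le_eq)

lemma Rn_upd: "c \<in> Rn n \<Longrightarrow> c(n := t) \<in> Rn (Suc n)"
  by (auto simp: topspace_Euclidean_space)

lemma Rn_upd_Suc: "c \<in> Rn (Suc n) \<Longrightarrow> c(n := t) \<in> Rn (Suc n)"
  by (auto simp: topspace_Euclidean_space)

lemma Rn_upd_idem: "c \<in> Rn n \<Longrightarrow> c(n := 0) = c"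
  by (auto simp: topspace_Euclidean_space)

lemma Rn_mono_Suc: "Rn n \<subseteq> Rn (Suc n)"
  by simp

lemma cyl_Rn: "cyl n (Rn n) = Rn (Suc n)"
  by (auto simp: cyl_def Rn_upd_0)

lemma subset_cyl: "V \<subseteq> Rn n \<Longrightarrow> V \<subseteq> cyl n V"
proof
  fix c assume "V \<subseteq> Rn n" "c \<in> V"
  then have c: "c \<in> Rn n" by (rule subsetD)
  then have "c \<in> Rn (Suc n)" by (rule subsetD[OF Rn_mono_Suc])
  moreover have "c(n := 0) = c" using c by (rule Rn_upd_idem)
  ultimately show "c \<in> cyl n V" using \<open>c \<in> V\<close> by (simp only: cyl_def mem_Collect_eq)
qed

lemma continuous_on_cyl_map:
  assumes "continuous_on V f"
  shows "continuous_on (cyl n V) (cyl_map n f)"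
proof -
  have "continuous_on (cyl n V) (f \<circ> (\<lambda>c. c(n := 0)))"
    by (rule continuous_on_compose, intro continuous_on_fun_upd continuous_intros)
      (auto simp: cyl_def intro: continuous_on_subset[OF assms])
  then show ?thesis
    unfolding cyl_map_def o_def
    by (intro continuous_on_fun_upd continuous_on_coordinate)
qed

section \<open>Homology of the punctured cylinder\<close>

context
  fixes n :: nat and V K :: "(nat \<Rightarrow> real) set"
  assumes V: "V \<subseteq> Rn n" and K: "closedin (top_of_set V) K"
begin

lemma cyl_closedin_subset: "K \<subseteq> V"
  using K closedin_imp_subset by blast

lemma cyl_Diff_eq: "cyl n V - K = upper_cyl n V K \<union> lower_cyl n V K"
proof -
  \<comment> \<open>Points of \<open>K\<close> have height zero, since \<open>K\<close> lies in
    \<open>Rn n\<close>. Hence a point outside \<open>K\<close> has nonzero height or its projection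
    is outside \<open>K\<close>.\<close>
  have mem: "c \<in> K \<longleftrightarrow> c n = 0 \<and> c(n := 0) \<in> K" for c
  proof
    assume c: "c \<in> K"
    then have "c \<in> Rn n" using V cyl_closedin_subset by blast
    then show "c n = 0 \<and> c(n := 0) \<in> K"
      using c Rn_upd_idem[of c n] by (simp add: topspace_Euclidean_space)
  qed (metis fun_upd_triv)
  show ?thesis
  proof (rule Set.set_eqI)
    show "c \<in> cyl n V - K \<longleftrightarrow> c \<in> upper_cyl n V K \<union> lower_cyl n V K" for c
      using mem[of c] by (auto simp: upper_cyl_def lower_cyl_def)
  qed
qed

lemma upper_Int_lower_cyl: "upper_cyl n V K \<inter> lower_cyl n V K = cyl n (V - K)"
  by (auto simp: upper_cyl_def lower_cyl_def cyl_def)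

lemma openin_half_cyl:
  "openin (top_of_set (cyl n V)) (upper_cyl n V K)" "openin (top_of_set (cyl n V)) (lower_cyl n V K)"
proof -
  obtain C where C: "closed C" "K = V \<inter> C" using K by (auto simp: closedin_closed)
  have cont: "continuous_on UNIV (\<lambda>c::nat\<Rightarrow>real. c(n := 0))"
    by (intro continuous_on_fun_upd continuous_intros)
  have "open ((\<lambda>c::nat\<Rightarrow>real. c(n := 0)) -` (- C))"
    using C(1) cont by (intro open_vimage) auto
  moreover have "open {c::nat\<Rightarrow>real. 0 < c n}" "open {c::nat\<Rightarrow>real. c n < 0}"
    by (intro open_Collect_less continuous_intros continuous_on_coordinate)+
  moreover have "upper_cyl n V K = cyl n V \<inter> ({c. 0 < c n} \<union> (\<lambda>c. c(n := 0)) -` (- C))"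
    "lower_cyl n V K = cyl n V \<inter> ({c. c n < 0} \<union> (\<lambda>c. c(n := 0)) -` (- C))"
    using C by (auto simp: upper_cyl_def lower_cyl_def cyl_def)
  ultimately show "openin (top_of_set (cyl n V)) (upper_cyl n V K)"
    "openin (top_of_set (cyl n V)) (lower_cyl n V K)"
    by (metis open_Un openin_open_Int)+
qed

text \<open>All heights move linearly to \<open>1\<close>, a height that belongs to the upper part
  over every base point; positive heights stay positive on the way.\<close>

lemma trivial_rel_hom_upper_cyl: "trivial_group (rel_hom p (cyl n V) (upper_cyl n V K))"
proof (rule trivial_rel_hom_push[where k = "\<lambda>t c. c(n := (1 - t) * c n + t)"])
  show "continuous_on ({0..1} \<times> cyl n V) (\<lambda>z. (snd z)(n := (1 - fst z) * snd z n + fst z))"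
    by (intro continuous_on_fun_upd continuous_intros continuous_on_snd_coordinate)
  show "c(n := (1 - t) * c n + t) \<in> upper_cyl n V K" if "t \<in> {0..1}" "c \<in> upper_cyl n V K" for t c
  proof -
    have "(1 - t) * c n + t > 0" if "c n > 0"
    proof (cases "t = 0")
      case False
      then have "t > 0" using \<open>t \<in> {0..1}\<close> by auto
      moreover have "(1 - t) * c n \<ge> 0" using \<open>t \<in> {0..1}\<close> that by auto
      ultimately show ?thesis by linarith
    qed (use that in auto)
    with that(2) show ?thesis
      by (auto simp: upper_cyl_def cyl_def Rn_upd_Suc)
  qed
qed (auto simp: upper_cyl_def cyl_def Rn_upd_Suc)

lemma iso_relboundary_cyl:
  "hom_relboundary (p + 1) (top_of_set (cyl n V)) (cyl n V - K) (upper_cyl n V K)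
    \<in> iso (rel_hom (p + 1) (cyl n V) (cyl n V - K)) (rel_hom p (cyl n V - K) (upper_cyl n V K))"
  using iso_relboundary_triple[of "upper_cyl n V K" "cyl n V - K" "cyl n V" "p + 1"]
    trivial_rel_hom_upper_cyl cyl_Diff_eq by auto

lemma iso_excision_cyl:
  "hom_ind p (lower_cyl n V K) (cyl n (V - K)) (cyl n V - K) (upper_cyl n V K) id
    \<in> iso (rel_hom p (lower_cyl n V K) (cyl n (V - K))) (rel_hom p (cyl n V - K) (upper_cyl n V K))"
proof -
  let ?X = "cyl n V - K"
  have "openin (top_of_set ?X) (lower_cyl n V K)" "openin (top_of_set ?X) (upper_cyl n V K)"
    using openin_half_cyl cyl_Diff_eq by (auto intro: openin_subset_trans)
  \<comment> \<open>Here the open set \<open>V\<close> of the excision lemma is the lower part, and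
    its closed set \<open>K\<close> is the complement of the upper part in the punctured
    cylinder.\<close>
  then have "hom_ind p (lower_cyl n V K) (lower_cyl n V K - (?X - upper_cyl n V K)) ?X (?X - (?X - upper_cyl n V K)) id
    \<in> iso (rel_hom p (lower_cyl n V K) (lower_cyl n V K - (?X - upper_cyl n V K)))
        (rel_hom p ?X (?X - (?X - upper_cyl n V K)))"
    using cyl_Diff_eq by (intro iso_rel_hom_excision) auto
  moreover have "lower_cyl n V K - (?X - upper_cyl n V K) = cyl n (V - K)"
    "?X - (?X - upper_cyl n V K) = upper_cyl n V K"
    using cyl_Diff_eq upper_Int_lower_cyl by blast+
  ultimately show ?thesis by simp
qed

text \<open>The section at height \<open>-1\<close> is a homotopy inverse of the projection, as maps
  of pairs: that height belongs to the lower part over every base point, and linear interpolation of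
  heights towards \<open>-1\<close> does not leave the lower part.\<close>

lemma iso_projection_cyl:
  "hom_ind p (lower_cyl n V K) (cyl n (V - K)) V (V - K) (\<lambda>c. c(n := 0))
    \<in> iso (rel_hom p (lower_cyl n V K) (cyl n (V - K))) (rel_hom p V (V - K))"
proof -
  let ?N = "lower_cyl n V K" and ?A = "cyl n (V - K)" and ?q = "\<lambda>c::nat\<Rightarrow>real. c(n := 0)"
    and ?s = "\<lambda>c::nat\<Rightarrow>real. c(n := -1)"
  have cont: "continuous_on X ?q" "continuous_on X ?s" for X
    by (intro continuous_on_fun_upd continuous_intros)+
  have q: "?q \<in> ?N \<rightarrow> V" "?q \<in> ?A \<rightarrow> V - K"
    by (auto simp: lower_cyl_def cyl_def)
  have s: "?s \<in> V \<rightarrow> ?N" "?s \<in> V - K \<rightarrow> ?A"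
    using V by (auto simp: lower_cyl_def cyl_def Rn_upd Rn_upd_idem subset_iff)
  have AN: "?A \<subseteq> ?N" by (auto simp: lower_cyl_def cyl_def)
  have "group_isomorphisms (rel_hom p ?N ?A) (rel_hom p V (V - K))
    (hom_ind p ?N ?A V (V - K) ?q) (hom_ind p V (V - K) ?N ?A ?s)"
    unfolding group_isomorphisms_def
  proof (intro conjI ballI hom_induced_hom)
    fix x assume x: "x \<in> carrier (rel_hom p V (V - K))"
    have "hom_ind p ?N ?A V (V - K) ?q (hom_ind p V (V - K) ?N ?A ?s x)
      = hom_ind p V (V - K) V (V - K) (?q \<circ> ?s) x"
      by (rule hom_ind_comp) (use cont q s in auto)
    also have "\<dots> = hom_ind p V (V - K) V (V - K) id x"
      using V by (subst hom_ind_cong[of _ _ id]) (auto simp: Rn_upd_idem subset_iff)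
    finally show "hom_ind p ?N ?A V (V - K) ?q (hom_ind p V (V - K) ?N ?A ?s x) = x"
      using hom_induced_id[OF x] by simp
  next
    fix x assume x: "x \<in> carrier (rel_hom p ?N ?A)"
    let ?k = "\<lambda>t c. c(n := t * c n - (1 - t))"
    have "hom_ind p V (V - K) ?N ?A ?s (hom_ind p ?N ?A V (V - K) ?q x)
      = hom_ind p ?N ?A ?N ?A (?s \<circ> ?q) x"
      by (rule hom_ind_comp) (use cont q s in auto)
    also have "\<dots> = hom_ind p ?N ?A ?N ?A (?k 0) x"
      by (simp add: o_def)
    also have "\<dots> = hom_ind p ?N ?A ?N ?A (?k 1) x"
    proof (subst hom_ind_homotopic[of _ _ ?k])
      show "continuous_on ({0..1} \<times> ?N) (\<lambda>z. (snd z)(n := fst z * snd z n - (1 - fst z)))"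
        by (intro continuous_on_fun_upd continuous_intros continuous_on_snd_coordinate)
      show "c(n := t * c n - (1 - t)) \<in> ?N" if "t \<in> {0..1}" "c \<in> ?N" for t c
      proof -
        have "t * c n - (1 - t) < 0" if "c n < 0"
        proof (cases "t = 0")
          case False
          then have "t * c n < 0" using \<open>t \<in> {0..1}\<close> that by (auto simp: mult_less_0_iff)
          then show ?thesis using \<open>t \<in> {0..1}\<close> by auto
        qed auto
        with that(2) show ?thesis by (auto simp: lower_cyl_def cyl_def Rn_upd_Suc)
      qed
    qed (use AN in \<open>auto simp: cyl_def Rn_upd_Suc\<close>)
    also have "\<dots> = x"
      using hom_induced_id[OF x] by (simp add: id_def)
    finally show "hom_ind p V (V - K) ?N ?A ?s (hom_ind p ?N ?A V (V - K) ?q x) = x" .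
  qed
  then show ?thesis by (rule group_isomorphisms_imp_iso)
qed

end

text \<open>The complement of \<open>K\<close> in the cylinder is the union of its upper and lower part. The cylinder is
  pushed up into the upper part, so the boundary map of the triple is an isomorphism; the upper part
  is then excised, and the lower part is projected onto the base.\<close>

definition suspension :: "int \<Rightarrow> nat \<Rightarrow> (nat \<Rightarrow> real) set \<Rightarrow> (nat \<Rightarrow> real) set \<Rightarrow>
    (nat \<Rightarrow> real) chain set \<Rightarrow> (nat \<Rightarrow> real) chain set" where
  "suspension p n V K =
    hom_ind p (lower_cyl n V K) (cyl n (V - K)) V (V - K) (\<lambda>c. c(n := 0)) \<circ>
    (inv_into (carrier (rel_hom p (lower_cyl n V K) (cyl n (V - K))))
      (hom_ind p (lower_cyl n V K) (cyl n (V - K)) (cyl n V - K) (upper_cyl n V K) id) \<circ>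
    hom_relboundary (p + 1) (top_of_set (cyl n V)) (cyl n V - K) (upper_cyl n V K))"

lemma iso_suspension:
  assumes "V \<subseteq> Rn n" "closedin (top_of_set V) K"
  shows "suspension p n V K \<in> iso (rel_hom (p + 1) (cyl n V) (cyl n V - K)) (rel_hom p V (V - K))"
  unfolding suspension_def
  by (rule iso_set_trans[OF iso_set_trans[OF iso_relboundary_cyl[OF assms]
        group.iso_set_sym[OF group_relative_homology_group iso_excision_cyl[OF assms]]]
      iso_projection_cyl[OF assms]])

text \<open>\<open>cyl_map n f\<close> keeps the height, so it respects the upper and lower parts
  and commutes with each of the three maps that make up the suspension.\<close>

lemma suspension_natural:
  assumes V: "V \<subseteq> Rn n" "closedin (top_of_set V) K"
    and W: "W \<subseteq> Rn n" "closedin (top_of_set W) L"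
    and f: "continuous_on V f" "f \<in> V \<rightarrow> W" "f \<in> V - K \<rightarrow> W - L"
    and x: "x \<in> carrier (rel_hom (p + 1) (cyl n V) (cyl n V - K))"
  shows "suspension p n W L
      (hom_ind (p + 1) (cyl n V) (cyl n V - K) (cyl n W) (cyl n W - L) (cyl_map n f) x)
    = hom_ind p V (V - K) W (W - L) f (suspension p n V K x)"
proof -
  let ?F = "cyl_map n f"
  have contF: "continuous_on (cyl n V) ?F" by (rule continuous_on_cyl_map[OF f(1)])
  have Fq: "(?F c)(n := 0) = f (c(n := 0))" if "c \<in> cyl n V" for c
  proof -
    have "f (c(n := 0)) \<in> Rn n" using that f(2) W(1) by (auto simp: cyl_def)
    then show ?thesis by (simp add: cyl_map_def Rn_upd_idem)
  qed
  have F: "?F \<in> cyl n V \<rightarrow> cyl n W" "?F \<in> cyl n (V - K) \<rightarrow> cyl n (W - L)"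
    "?F \<in> upper_cyl n V K \<rightarrow> upper_cyl n W L" "?F \<in> lower_cyl n V K \<rightarrow> lower_cyl n W L"
  proof -
    have R: "?F c \<in> Rn (Suc n)" if "c \<in> cyl n V" for c
      using Fq[OF that] that f(2) W(1) by (auto simp: cyl_map_def cyl_def intro!: Rn_upd)
    have *: "f x \<in> W" "x \<notin> K \<Longrightarrow> f x \<notin> L" if "x \<in> V" for x using f that by auto
    have Fn: "?F c n = c n" for c by (simp add: cyl_map_def)
    show F1: "?F \<in> cyl n V \<rightarrow> cyl n W"
      using R Fq * by (auto simp: cyl_def)
    show "?F \<in> cyl n (V - K) \<rightarrow> cyl n (W - L)"
      using R Fq * by (auto simp: cyl_def)
    show "?F \<in> upper_cyl n V K \<rightarrow> upper_cyl n W L" "?F \<in> lower_cyl n V K \<rightarrow> lower_cyl n W L"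
      using F1 Fq * unfolding upper_cyl_def lower_cyl_def by (auto simp: Fn cyl_def)
  qed
  have FK: "?F \<in> cyl n V - K \<rightarrow> cyl n W - L"
    using F(3,4) unfolding cyl_Diff_eq[OF V] cyl_Diff_eq[OF W] by auto
  let ?\<alpha> = "hom_relboundary (p + 1) (top_of_set (cyl n V)) (cyl n V - K) (upper_cyl n V K)"
  let ?\<alpha>' = "hom_relboundary (p + 1) (top_of_set (cyl n W)) (cyl n W - L) (upper_cyl n W L)"
  let ?\<beta> = "hom_ind p (lower_cyl n V K) (cyl n (V - K)) (cyl n V - K) (upper_cyl n V K) id"
  let ?\<beta>' = "hom_ind p (lower_cyl n W L) (cyl n (W - L)) (cyl n W - L) (upper_cyl n W L) id"
  let ?C = "rel_hom p (lower_cyl n V K) (cyl n (V - K))"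
  let ?C' = "rel_hom p (lower_cyl n W L) (cyl n (W - L))"
  have lo: "lower_cyl n V K \<subseteq> cyl n V - K" "lower_cyl n W L \<subseteq> cyl n W - L"
    "cyl n (V - K) \<subseteq> upper_cyl n V K" "cyl n (W - L) \<subseteq> upper_cyl n W L"
    using cyl_Diff_eq[OF V] cyl_Diff_eq[OF W] upper_Int_lower_cyl[OF V] upper_Int_lower_cyl[OF W] by auto
  have contF': "continuous_on (cyl n V - K) ?F" "continuous_on (lower_cyl n V K) ?F"
    using lo by (auto intro!: continuous_on_subset[OF contF])
  have contq: "continuous_on X (\<lambda>c::nat\<Rightarrow>real. c(n := 0))" for X
    by (intro continuous_on_fun_upd continuous_intros)
  have q: "(\<lambda>c. c(n := 0)) \<in> lower_cyl n V K \<rightarrow> V" "(\<lambda>c. c(n := 0)) \<in> cyl n (V - K) \<rightarrow> V - K"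
    "(\<lambda>c. c(n := 0)) \<in> lower_cyl n W L \<rightarrow> W" "(\<lambda>c. c(n := 0)) \<in> cyl n (W - L) \<rightarrow> W - L"
    by (auto simp: lower_cyl_def cyl_def)
  \<comment> \<open>The excision map occurs inverted, so the class is followed through its preimage
    \<open>c\<close>. On the side of \<open>W\<close> the preimage is the image \<open>c'\<close> of
    \<open>c\<close>, by injectivity of the excision map there.\<close>
  define c where "c = inv_into (carrier ?C) ?\<beta> (?\<alpha> x)"
  have "?\<alpha> x \<in> carrier (rel_hom p (cyl n V - K) (upper_cyl n V K))"
    using iso_relboundary_cyl[OF V, of p] x by (auto simp: iso_iff)
  then have c: "c \<in> carrier ?C" "?\<beta> c = ?\<alpha> x"
    using iso_excision_cyl[OF V, of p] unfolding c_def
    by (auto simp: iso_iff f_inv_into_f inv_into_into)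
  define c' where "c' = hom_ind p (lower_cyl n V K) (cyl n (V - K)) (lower_cyl n W L) (cyl n (W - L)) ?F c"
  have c': "c' \<in> carrier ?C'" unfolding c'_def by (rule hom_induced_carrier)
  have sub: "subtopology (top_of_set (cyl n V)) (cyl n V - K) = top_of_set (cyl n V - K)"
    "subtopology (top_of_set (cyl n W)) (cyl n W - L) = top_of_set (cyl n W - L)"
    by (simp_all add: subtopology_subtopology Int_absorb1)
  have "?\<alpha>' (hom_ind (p + 1) (cyl n V) (cyl n V - K) (cyl n W) (cyl n W - L) ?F x)
      = hom_ind p (cyl n V - K) (upper_cyl n V K) (cyl n W - L) (upper_cyl n W L) ?F (?\<alpha> x)"
    using naturality_hom_induced_relboundary[of "top_of_set (cyl n V)" "top_of_set (cyl n W)" ?F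
        "cyl n V - K" "cyl n W - L" "upper_cyl n V K" "upper_cyl n W L" "p + 1"] contF F FK
    by (auto simp: sub fun_eq_iff)
  also have "\<dots> = hom_ind p (lower_cyl n V K) (cyl n (V - K)) (cyl n W - L) (upper_cyl n W L) ?F c"
    unfolding c(2)[symmetric]
    by (rule hom_ind_incl_comp) (use lo contF' FK F in auto)
  also have "\<dots> = ?\<beta>' c'"
    unfolding c'_def
    by (rule hom_ind_comp_incl[symmetric]) (use lo F contF' in auto)
  finally have *: "?\<alpha>' (hom_ind (p + 1) (cyl n V) (cyl n V - K) (cyl n W) (cyl n W - L) ?F x) = ?\<beta>' c'" .
  have "inv_into (carrier ?C') ?\<beta>' (?\<beta>' c') = c'"
    using iso_excision_cyl[OF W, of p] c' by (simp add: iso_iff)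
  then have "suspension p n W L
      (hom_ind (p + 1) (cyl n V) (cyl n V - K) (cyl n W) (cyl n W - L) ?F x)
    = hom_ind p (lower_cyl n W L) (cyl n (W - L)) W (W - L) (\<lambda>c. c(n := 0)) c'"
    unfolding suspension_def o_def * by simp
  also have "\<dots> = hom_ind p (lower_cyl n V K) (cyl n (V - K)) W (W - L) ((\<lambda>c. c(n := 0)) \<circ> ?F) c"
    unfolding c'_def
    by (rule hom_ind_comp) (use F contF' contq q in auto)
  also have "\<dots> = hom_ind p (lower_cyl n V K) (cyl n (V - K)) W (W - L) (f \<circ> (\<lambda>c. c(n := 0))) c"
    by (subst hom_ind_cong[of _ _ "f \<circ> (\<lambda>c. c(n := 0))"]) (auto simp: Fq lower_cyl_def)
  also have "\<dots> = hom_ind p V (V - K) W (W - L) f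
      (hom_ind p (lower_cyl n V K) (cyl n (V - K)) V (V - K) (\<lambda>c. c(n := 0)) c)"
    by (rule hom_ind_comp[symmetric]) (use f contq q in auto)
  also have "\<dots> = hom_ind p V (V - K) W (W - L) f (suspension p n V K x)"
    unfolding suspension_def c_def by simp
  finally show ?thesis .
qed

section \<open>Orientation classes\<close>

abbreviation pRn :: "nat \<Rightarrow> (nat \<Rightarrow> real) set" where
  "pRn n \<equiv> Rn n - {\<lambda>_. 0}"

lemma cball_subset_Rn: "euclidean_cball n r \<subseteq> Rn n"
  by (auto simp: euclidean_cball_def)

lemma zero_in_cball: "(\<lambda>_. 0) \<in> euclidean_cball n r"
  by (auto simp: euclidean_cball_def topspace_Euclidean_space)

text \<open>The ball depends on its radius only through the square, so radii of either sign occur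
  and absolute values are compared.\<close>

lemma cball_mono: "\<bar>r\<bar> \<le> \<bar>s\<bar> \<Longrightarrow> euclidean_cball n r \<subseteq> euclidean_cball n s"
  unfolding euclidean_cball_def using abs_le_square_iff[of r s] by auto

lemma cball_Suc: "euclidean_cball n r \<subseteq> euclidean_cball (Suc n) r"
proof
  fix x assume x: "x \<in> euclidean_cball n r"
  then have "x \<in> Rn n" "x n = 0" by (auto simp: euclidean_cball_def topspace_Euclidean_space)
  then have "x \<in> Rn (Suc n)" using subsetD[OF Rn_mono_Suc] by blast
  then show "x \<in> euclidean_cball (Suc n) r"
    using x \<open>x n = 0\<close> by (auto simp: euclidean_cball_def)
qed

lemma sum_squares_pos_Rn:
  assumes "x \<in> pRn n" shows "(\<Sum>k<n. (x k)\<^sup>2) > 0"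
proof (rule ccontr)
  assume "\<not> ?thesis"
  then have "(\<Sum>k<n. (x k)\<^sup>2) = 0"
    by (meson not_less order_antisym sum_nonneg zero_le_power2)
  then have "\<forall>k<n. x k = 0" by (simp add: sum_nonneg_eq_0_iff)
  then have "x = (\<lambda>_. 0)"
    using assms by (intro ext) (auto simp: topspace_Euclidean_space not_less[symmetric])
  then show False using assms by simp
qed

lemma compact_subset_cball:
  assumes "compact L" "L \<subseteq> Rn n"
  obtains r where "L \<subseteq> euclidean_cball n r"
proof -
  have "compact ((\<lambda>x. \<Sum>k<n. (x k)\<^sup>2) ` L)"
    by (intro compact_continuous_image assms continuous_intros continuous_on_coordinate)
  then have "bdd_above ((\<lambda>x. \<Sum>k<n. (x k)\<^sup>2) ` L)"
    by (intro bounded_imp_bdd_above compact_imp_bounded)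
  then obtain B where B: "\<And>x. x \<in> L \<Longrightarrow> (\<Sum>k<n. (x k)\<^sup>2) \<le> B"
    by (elim bdd_above.E) blast
  have "(\<Sum>k<n. (x k)\<^sup>2) \<le> (sqrt \<bar>B\<bar>)\<^sup>2" if "x \<in> L" for x
    using B[OF that] by simp
  then have "L \<subseteq> euclidean_cball n (sqrt \<bar>B\<bar>)"
    using assms(2) by (auto simp: euclidean_cball_def)
  then show ?thesis by (rule that)
qed

text \<open>Points move outward along their rays so that the Euclidean norm grows by
  \<open>t * \<bar>r\<bar>\<close>. Growth by addition never re-enters the ball, and at
  \<open>t = 1\<close> every nonzero point has left it, even if it started arbitrarily close to the
  origin.\<close>

lemma trivial_rel_hom_annulus: "trivial_group (rel_hom p (pRn n) (Rn n - euclidean_cball n r))"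
proof (rule trivial_rel_hom_push[where k = "\<lambda>t x i. (1 + t * (\<bar>r\<bar> / sqrt (\<Sum>k<n. (x k)\<^sup>2))) * x i"])
  let ?N = "\<lambda>x. \<Sum>k<n. (x k)\<^sup>2" and ?k = "\<lambda>t x i. (1 + t * (\<bar>r\<bar> / sqrt (\<Sum>k<n. (x k)\<^sup>2))) * x i"
  show "Rn n - euclidean_cball n r \<subseteq> pRn n" using zero_in_cball by auto
  show "continuous_on ({0..1} \<times> pRn n)
     (\<lambda>z i. (1 + fst z * (\<bar>r\<bar> / sqrt (\<Sum>k<n. (snd z k)\<^sup>2))) * snd z i)"
  proof (intro continuous_on_coordinatewise_then_product continuous_intros continuous_on_snd_coordinate ballI)
    show "sqrt (\<Sum>k<n. (snd z k)\<^sup>2) \<noteq> 0" if "z \<in> {0..1} \<times> pRn n" for z :: "real \<times> (nat \<Rightarrow> real)"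
      using sum_squares_pos_Rn[of "snd z" n] that by auto
  qed
  have Nk: "?N (?k t x) = (sqrt (?N x) + t * \<bar>r\<bar>)\<^sup>2" and Npos: "sqrt (?N x) > 0" if "x \<in> pRn n" for t x
  proof -
    show "sqrt (?N x) > 0" using sum_squares_pos_Rn[OF that] by simp
    then have *: "(1 + t * (\<bar>r\<bar> / sqrt (?N x))) * sqrt (?N x) = sqrt (?N x) + t * \<bar>r\<bar>"
      by (simp add: field_simps)
    have "?N (?k t x) = (1 + t * (\<bar>r\<bar> / sqrt (?N x)))\<^sup>2 * ?N x"
      by (simp add: power_mult_distrib sum_distrib_left)
    also have "\<dots> = (1 + t * (\<bar>r\<bar> / sqrt (?N x)))\<^sup>2 * (sqrt (?N x))\<^sup>2"
      using sum_nonneg[of "{..<n}" "\<lambda>k. (x k)\<^sup>2"] by simp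
    also have "\<dots> = (sqrt (?N x) + t * \<bar>r\<bar>)\<^sup>2"
      by (simp only: * flip: power_mult_distrib)
    finally show "?N (?k t x) = (sqrt (?N x) + t * \<bar>r\<bar>)\<^sup>2" .
  qed
  have kR: "?k t x \<in> Rn n" if "x \<in> Rn n" for t x
    using that by (auto simp: topspace_Euclidean_space)
  show "?k t x \<in> pRn n" if t: "t \<in> {0..1}" and x: "x \<in> pRn n" for t x
  proof -
    have "sqrt (?N x) + t * \<bar>r\<bar> > 0" using Npos[OF x] t by (simp add: add_pos_nonneg)
    then have "?N (?k t x) > 0" using Nk[OF x] by simp
    then have "?k t x \<noteq> (\<lambda>_. 0)" by (metis (no_types, lifting) less_irrefl sum.neutral zero_power2)
    then show ?thesis using kR x by blast
  qed
  have cbD: "x \<in> Rn n - euclidean_cball n r \<longleftrightarrow> x \<in> Rn n \<and> \<bar>r\<bar> < sqrt (?N x)" for x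
    using real_less_rsqrt[of r "?N x"] real_sqrt_less_iff[of "r\<^sup>2" "?N x"]
    by (auto simp: euclidean_cball_def not_le)
  show "?k t x \<in> Rn n - euclidean_cball n r" if t: "t \<in> {0..1}" and x: "x \<in> Rn n - euclidean_cball n r" for t x
  proof -
    have x': "x \<in> pRn n" "\<bar>r\<bar> < sqrt (?N x)" using x zero_in_cball cbD by blast+
    have "sqrt (?N (?k t x)) = sqrt (?N x) + t * \<bar>r\<bar>"
      unfolding Nk[OF x'(1)] using Npos[OF x'(1)] t by simp
    moreover have "0 \<le> t * \<bar>r\<bar>" using t by simp
    ultimately show ?thesis unfolding cbD using x' kR[of x t] by auto
  qed
  show "?k 1 x \<in> Rn n - euclidean_cball n r" if x: "x \<in> pRn n" for x
  proof -
    have "sqrt (?N (?k 1 x)) = sqrt (?N x) + 1 * \<bar>r\<bar>"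
      unfolding Nk[OF x] using Npos[OF x] by simp
    then show ?thesis unfolding cbD using x kR[of x 1] Npos[OF x] by simp
  qed
qed simp

section \<open>Comparison of orientation classes for balls of different radii\<close>

abbreviation orient :: "nat \<Rightarrow> real \<Rightarrow> (nat \<Rightarrow> real) chain set monoid" where
  "orient n r \<equiv> rel_hom (int n) (Rn n) (Rn n - euclidean_cball n r)"

abbreviation restr :: "nat \<Rightarrow> real \<Rightarrow> (nat \<Rightarrow> real) set \<Rightarrow> (nat \<Rightarrow> real) chain set \<Rightarrow> (nat \<Rightarrow> real) chain set" where
  "restr n r L \<equiv> hom_ind (int n) (Rn n) (Rn n - euclidean_cball n r) (Rn n) (Rn n - L) id"

abbreviation local_hom :: "nat \<Rightarrow> (nat \<Rightarrow> real) chain set monoid" where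
  "local_hom n \<equiv> rel_hom (int n) (Rn n) (pRn n)"

lemma iso_surj: "h \<in> iso G H \<Longrightarrow> y \<in> carrier H \<Longrightarrow> \<exists>x\<in>carrier G. h x = y"
  by (force simp: iso_iff)

lemma iso_inj: "h \<in> iso G H \<Longrightarrow> x \<in> carrier G \<Longrightarrow> y \<in> carrier G \<Longrightarrow> h x = h y \<Longrightarrow> x = y"
  by (auto simp: iso_iff dest: inj_onD)

lemma int_pow_closed_rel_hom:
  "x \<in> carrier (rel_hom p X S) \<Longrightarrow> x [^]\<^bsub>rel_hom p X S\<^esub> (k::int) \<in> carrier (rel_hom p X S)"
  by (rule group.int_pow_closed) auto

text \<open>The triple consists of the complement of the ball, the complement of the origin, and the
  whole space. An orientation class is thus determined by its restriction at the origin, whatever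
  the radius.\<close>

lemma iso_restr_zero: "restr n r {\<lambda>_. 0} \<in> iso (orient n r) (local_hom n)"
  by (rule iso_rel_hom_triple) (use zero_in_cball trivial_rel_hom_annulus in auto)

lemma restr_restr:
  assumes "L \<subseteq> euclidean_cball n r" "euclidean_cball n r \<subseteq> euclidean_cball n s"
  shows "restr n r L (hom_ind (int n) (Rn n) (Rn n - euclidean_cball n s) (Rn n) (Rn n - euclidean_cball n r) id a)
    = restr n s L a"
  by (rule hom_ind_incl_comp) (use assms in auto)

text \<open>Classes for two radii are not in the same group. Both are lifted to a larger ball, where
  restriction to the origin is injective; the relation assumed at the origin therefore holds between
  the lifts and restricts to \<open>L\<close>.\<close>

lemma restr_eq_pow:
  assumes L: "L \<subseteq> euclidean_cball n r" "L \<subseteq> euclidean_cball n s"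
    and a: "a \<in> carrier (orient n r)" and b: "b \<in> carrier (orient n s)"
    and eq: "restr n r {\<lambda>_. 0} a = restr n s {\<lambda>_. 0} b [^]\<^bsub>local_hom n\<^esub> (m::int)"
  shows "restr n r L a = restr n s L b [^]\<^bsub>rel_hom (int n) (Rn n) (Rn n - L)\<^esub> m"
proof -
  define t where "t = max \<bar>r\<bar> \<bar>s\<bar>"
  have sub: "euclidean_cball n r \<subseteq> euclidean_cball n t" "euclidean_cball n s \<subseteq> euclidean_cball n t"
    by (auto intro!: cball_mono simp: t_def)
  have lift: "\<exists>c\<in>carrier (orient n t). restr n t L' c = restr n q L' d \<and>
      restr n t {\<lambda>_. 0} c = restr n q {\<lambda>_. 0} d"
    if d: "d \<in> carrier (orient n q)" and q: "euclidean_cball n q \<subseteq> euclidean_cball n t"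
      "L' \<subseteq> euclidean_cball n q" for d q L'
  proof -
    have "restr n q {\<lambda>_. 0} d \<in> carrier (local_hom n)" by (rule hom_induced_carrier)
    then obtain c where c: "c \<in> carrier (orient n t)" "restr n t {\<lambda>_. 0} c = restr n q {\<lambda>_. 0} d"
      using iso_surj[OF iso_restr_zero] by blast
    let ?c = "hom_ind (int n) (Rn n) (Rn n - euclidean_cball n t) (Rn n) (Rn n - euclidean_cball n q) id c"
    have "restr n q {\<lambda>_. 0} ?c = restr n q {\<lambda>_. 0} d"
      using c(2) q(1) zero_in_cball by (subst restr_restr) auto
    moreover have "?c \<in> carrier (orient n q)" by (rule hom_induced_carrier)
    ultimately have "?c = d"
      using iso_inj[OF iso_restr_zero _ d] by blast
    then have "restr n t L' c = restr n q L' d" using restr_restr[OF q(2,1), of c] by simp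
    with c show ?thesis by blast
  qed
  obtain \<alpha> where \<alpha>: "\<alpha> \<in> carrier (orient n t)" "restr n t L \<alpha> = restr n r L a"
    "restr n t {\<lambda>_. 0} \<alpha> = restr n r {\<lambda>_. 0} a" using lift[OF a sub(1) L(1)] by blast
  obtain \<beta> where \<beta>: "\<beta> \<in> carrier (orient n t)" "restr n t L \<beta> = restr n s L b"
    "restr n t {\<lambda>_. 0} \<beta> = restr n s {\<lambda>_. 0} b" using lift[OF b sub(2) L(2)] by blast
  have "restr n t {\<lambda>_. 0} \<alpha> = restr n t {\<lambda>_. 0} (\<beta> [^]\<^bsub>orient n t\<^esub> m)"
    using \<alpha>(3) \<beta> eq by (simp add: hom_ind_int_pow)
  then have "\<alpha> = \<beta> [^]\<^bsub>orient n t\<^esub> m"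
    by (rule iso_inj[OF iso_restr_zero \<alpha>(1) int_pow_closed_rel_hom[OF \<beta>(1)]])
  then show ?thesis using \<alpha>(2) \<beta> by (simp add: hom_ind_int_pow)
qed

text \<open>Induction on the dimension: a point has the coefficient group in degree zero, and
  suspension over \<open>Rn n\<close> with \<open>K\<close> the origin raises degree and dimension
  together.\<close>

lemma local_hom_integer_group: "local_hom n \<cong> integer_group"
proof (induction n)
  case 0
  have "Rn 0 = {\<lambda>_. 0}" by (auto simp: topspace_Euclidean_space)
  then show ?case using homology_coefficients[of "top_of_set {\<lambda>_::nat. 0::real}"] by simp
next
  case (Suc n)
  have "(\<lambda>_. 0) \<in> Rn n" by (simp add: topspace_Euclidean_space)
  then have "closedin (top_of_set (Rn n)) {\<lambda>_. 0}" by (intro closed_subset) auto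
  from iso_suspension[OF order_refl this, of "int n"] have "local_hom (Suc n) \<cong> local_hom n"
    by (auto simp: is_iso_def cyl_Rn add.commute)
  then show ?case using Suc iso_trans by blast
qed

lemma integer_group_generator:
  assumes "group G" "G \<cong> integer_group"
  obtains g where "g \<in> carrier G" "\<And>z. z \<in> carrier G \<Longrightarrow> \<exists>k::int. z = g [^]\<^bsub>G\<^esub> k"
    "\<And>k l::int. g [^]\<^bsub>G\<^esub> k = g [^]\<^bsub>G\<^esub> l \<Longrightarrow> k = l"
proof -
  obtain \<phi> where \<phi>: "\<phi> \<in> iso integer_group G"
    using group.iso_sym[OF assms] by (auto simp: is_iso_def)
  have pow: "\<phi> 1 [^]\<^bsub>G\<^esub> k = \<phi> k" for k :: int
    using hom_int_pow[of \<phi> integer_group G 1 k] \<phi> assms(1) by (simp add: iso_iff)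
  show ?thesis
  proof (rule that[of "\<phi> 1"])
    show "\<phi> 1 \<in> carrier G" using \<phi> by (auto simp: iso_iff)
    show "\<exists>k::int. z = \<phi> 1 [^]\<^bsub>G\<^esub> k" if "z \<in> carrier G" for z
      using \<phi> that unfolding pow iso_iff by auto
    show "k = l" if "\<phi> 1 [^]\<^bsub>G\<^esub> k = \<phi> 1 [^]\<^bsub>G\<^esub> l" for k l :: int
      using \<phi> that unfolding pow iso_iff by (auto dest: injD)
  qed
qed

section \<open>The degree relative to a compact set of possible zeros\<close>

text \<open>Replacing the zero set by a larger compact set \<open>L\<close> does not change the degree. Homotopy invariance
  follows because \<open>L\<close> can contain the zeros of all stages of a homotopy.\<close>

definition has_degree ::
  "nat \<Rightarrow> ((nat \<Rightarrow> real) \<Rightarrow> nat \<Rightarrow> real) \<Rightarrow> (nat \<Rightarrow> real) set \<Rightarrow> (nat \<Rightarrow> real) set \<Rightarrow> int \<Rightarrow> bool" where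
  "has_degree n f U L d \<longleftrightarrow> (\<forall>r. L \<subseteq> euclidean_cball n r \<longrightarrow>
    (\<forall>a \<in> carrier (orient n r). \<forall>b \<in> carrier (rel_hom (int n) U (U - L)).
      hom_ind (int n) U (U - L) (Rn n) (Rn n - L) id b = restr n r L a \<longrightarrow>
      hom_ind (int n) U (U - L) (Rn n) (pRn n) f b = restr n r {\<lambda>_. 0} a [^]\<^bsub>local_hom n\<^esub> d))"

text \<open>The absence of zeros on the boundary is expressed from inside: all zeros lie in a
  compact \<open>L \<subseteq> U\<close>. Thus continuity is asked for on \<open>U\<close> alone,
  and \<open>L\<close> may be chosen larger than the zero set.\<close>

definition degree_admissible ::
  "nat \<Rightarrow> ((nat \<Rightarrow> real) \<Rightarrow> nat \<Rightarrow> real) \<Rightarrow> (nat \<Rightarrow> real) set \<Rightarrow> (nat \<Rightarrow> real) set \<Rightarrow> bool" where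
  "degree_admissible n f U L \<longleftrightarrow> openin (top_of_set (Rn n)) U \<and> compact L \<and> L \<subseteq> U \<and>
    continuous_on U f \<and> f \<in> U \<rightarrow> Rn n \<and> (\<forall>x\<in>U - L. f x \<noteq> (\<lambda>_. 0))"

text \<open>Translates iterated subtopologies of \<open>Euclidean_space n\<close> into subspace
  topologies of the type of sequences, in which all later arguments take place.\<close>

lemma brouwer_degree_eq_The:
  assumes "U \<subseteq> Rn n"
  shows "brouwer_degree n f U = (THE d. has_degree n f U {x \<in> U. f x = (\<lambda>_. 0)} d)"
proof -
  have E: "top_of_set (Rn n) = Euclidean_space n"
    by (rule Euclidean_space_eq[symmetric])
  have "top_of_set U = subtopology (top_of_set (Rn n)) U"
    using assms by (simp add: subtopology_subtopology Int_absorb1)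
  then show ?thesis
    unfolding brouwer_degree_def has_degree_def Let_def by (simp only: E)
qed

lemma degree_admissible_subset:
  assumes "degree_admissible n f U L"
  shows "U \<subseteq> Rn n" "L \<subseteq> U"
  using assms openin_imp_subset unfolding degree_admissible_def by blast+

lemma iso_excision_Rn:
  assumes "openin (top_of_set (Rn n)) U" "compact L" "L \<subseteq> U"
  shows "hom_ind p U (U - L) (Rn n) (Rn n - L) id \<in> iso (rel_hom p U (U - L)) (rel_hom p (Rn n) (Rn n - L))"
proof (rule iso_rel_hom_excision)
  show "closedin (top_of_set (Rn n)) L"
    using assms openin_imp_subset by (intro closed_subset compact_imp_closed) blast+
qed (use assms in auto)

text \<open>Let \<open>a\<close> restrict to a generator \<open>g\<close> at the origin, let
  \<open>b\<close> be the class that excision assigns to it, and let \<open>d\<close> be the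
  exponent of the image of \<open>b\<close> under \<open>f\<close>. Any other pair of classes is the
  \<open>m\<close>-th power of \<open>(a, b)\<close> for one common \<open>m\<close>, so it yields
  the same \<open>d\<close>; uniqueness holds because the powers of \<open>g\<close> are
  distinct.\<close>

lemma has_degree_exists:
  assumes "degree_admissible n f U L"
  shows "\<exists>!d. has_degree n f U L d"
proof -
  have U: "openin (top_of_set (Rn n)) U" "compact L" "L \<subseteq> U"
    using assms by (auto simp: degree_admissible_def)
  then have "L \<subseteq> Rn n" using openin_imp_subset by blast
  then obtain r where r: "L \<subseteq> euclidean_cball n r"
    using compact_subset_cball[OF U(2)] by blast
  obtain g where g: "g \<in> carrier (local_hom n)" "\<And>z. z \<in> carrier (local_hom n) \<Longrightarrow> \<exists>k::int. z = g [^]\<^bsub>local_hom n\<^esub> k"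
    "\<And>k l::int. g [^]\<^bsub>local_hom n\<^esub> k = g [^]\<^bsub>local_hom n\<^esub> l \<Longrightarrow> k = l"
    using integer_group_generator[OF group_relative_homology_group local_hom_integer_group] by blast
  note exc = iso_excision_Rn[OF U, of "int n"]
  obtain a where a: "a \<in> carrier (orient n r)" "restr n r {\<lambda>_. 0} a = g"
    using iso_surj[OF iso_restr_zero g(1)] by blast
  have "restr n r L a \<in> carrier (rel_hom (int n) (Rn n) (Rn n - L))" by (rule hom_induced_carrier)
  then obtain b where b: "b \<in> carrier (rel_hom (int n) U (U - L))"
    "hom_ind (int n) U (U - L) (Rn n) (Rn n - L) id b = restr n r L a"
    using iso_surj[OF exc] by blast
  obtain d where d: "hom_ind (int n) U (U - L) (Rn n) (pRn n) f b = g [^]\<^bsub>local_hom n\<^esub> (d::int)"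
    using g(2)[OF hom_induced_carrier] by blast
  interpret G: group "local_hom n" by simp
  show ?thesis
  proof
    show "has_degree n f U L d"
      unfolding has_degree_def
    proof (intro allI ballI impI)
      fix s a' b' assume s: "L \<subseteq> euclidean_cball n s" and a': "a' \<in> carrier (orient n s)"
        and b': "b' \<in> carrier (rel_hom (int n) U (U - L))"
        and eq: "hom_ind (int n) U (U - L) (Rn n) (Rn n - L) id b' = restr n s L a'"
      obtain m :: int where m: "restr n s {\<lambda>_. 0} a' = g [^]\<^bsub>local_hom n\<^esub> m"
        using g(2)[OF hom_induced_carrier] by blast
      have "restr n s L a' = restr n r L a [^]\<^bsub>rel_hom (int n) (Rn n) (Rn n - L)\<^esub> m"
        by (rule restr_eq_pow) (use s r a' a m in auto)
      then have "hom_ind (int n) U (U - L) (Rn n) (Rn n - L) id b'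
        = hom_ind (int n) U (U - L) (Rn n) (Rn n - L) id (b [^]\<^bsub>rel_hom (int n) U (U - L)\<^esub> m)"
        using b eq by (simp add: hom_ind_int_pow)
      then have "b' = b [^]\<^bsub>rel_hom (int n) U (U - L)\<^esub> m"
        by (rule iso_inj[OF exc b' int_pow_closed_rel_hom[OF b(1)]])
      then show "hom_ind (int n) U (U - L) (Rn n) (pRn n) f b' = restr n s {\<lambda>_. 0} a' [^]\<^bsub>local_hom n\<^esub> d"
        using b(1) d m g(1) by (simp add: hom_ind_int_pow G.int_pow_pow mult.commute)
    qed
  next
    fix d' assume "has_degree n f U L d'"
    then have "hom_ind (int n) U (U - L) (Rn n) (pRn n) f b = g [^]\<^bsub>local_hom n\<^esub> d'"
      using r a b unfolding has_degree_def by blast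
    then show "d' = d" using d g(3) by simp
  qed
qed

lemma has_degree_unique:
  "degree_admissible n f U L \<Longrightarrow> has_degree n f U L d \<Longrightarrow> has_degree n f U L d' \<Longrightarrow> d = d'"
  using has_degree_exists by blast

lemma hom_ind_f_restrict:
  assumes "degree_admissible n f U L" "V \<subseteq> U" "L \<subseteq> M" "V - M \<subseteq> U - L"
  shows "hom_ind p U (U - L) (Rn n) (pRn n) f (hom_ind p V (V - M) U (U - L) id b)
    = hom_ind p V (V - M) (Rn n) (pRn n) f b"
  by (rule hom_ind_incl_comp) (use assms in \<open>auto simp: degree_admissible_def\<close>)

text \<open>Shrinking the open set and enlarging the compact set both give an inclusion of
  \<open>(V, V - M)\<close> into \<open>(U, U - L)\<close>, which carries a class that represents
  the orientation along \<open>M\<close> to one that represents it along \<open>L\<close>. This is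
  excision and independence of \<open>L\<close> at once.\<close>

lemma has_degree_restrict:
  assumes adm: "degree_admissible n f U L" and VM: "V \<subseteq> U" "L \<subseteq> M" "M \<subseteq> V"
    and d: "has_degree n f U L d"
  shows "has_degree n f V M d"
  unfolding has_degree_def
proof (intro allI ballI impI)
  fix r a b assume r: "M \<subseteq> euclidean_cball n r" and a: "a \<in> carrier (orient n r)"
    and b: "b \<in> carrier (rel_hom (int n) V (V - M))"
    and eq: "hom_ind (int n) V (V - M) (Rn n) (Rn n - M) id b = restr n r M a"
  have UR: "U \<subseteq> Rn n" by (rule degree_admissible_subset[OF adm])
  let ?b = "hom_ind (int n) V (V - M) U (U - L) id b"
  have "hom_ind (int n) U (U - L) (Rn n) (Rn n - L) id ?b
    = hom_ind (int n) V (V - M) (Rn n) (Rn n - L) id b"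
    by (rule hom_ind_incl_comp) (use VM UR in auto)
  also have "\<dots> = hom_ind (int n) (Rn n) (Rn n - M) (Rn n) (Rn n - L) id
      (hom_ind (int n) V (V - M) (Rn n) (Rn n - M) id b)"
    by (rule hom_ind_incl_comp[symmetric]) (use VM UR in auto)
  also have "\<dots> = restr n r L a"
    unfolding eq by (rule hom_ind_incl_comp) (use VM r in auto)
  finally have "hom_ind (int n) U (U - L) (Rn n) (pRn n) f ?b = restr n r {\<lambda>_. 0} a [^]\<^bsub>local_hom n\<^esub> d"
    using d a r VM hom_induced_carrier unfolding has_degree_def by blast
  then show "hom_ind (int n) V (V - M) (Rn n) (pRn n) f b = restr n r {\<lambda>_. 0} a [^]\<^bsub>local_hom n\<^esub> d"
    using hom_ind_f_restrict[OF adm VM(1,2), of "int n" b] Diff_mono[OF VM(1,2)] by simp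
qed

lemma degree_admissible_zeros:
  assumes adm: "degree_admissible n f U L"
  shows "degree_admissible n f U {x \<in> U. f x = (\<lambda>_. 0)}" "{x \<in> U. f x = (\<lambda>_. 0)} \<subseteq> L"
proof -
  show sub: "{x \<in> U. f x = (\<lambda>_. 0)} \<subseteq> L" using adm by (auto simp: degree_admissible_def)
  have "continuous_on L f" "closed L"
    using adm continuous_on_subset[of U f L] by (auto simp: degree_admissible_def compact_imp_closed)
  then have "closed (L \<inter> f -` {\<lambda>_. 0})" by (intro continuous_closed_preimage) auto
  moreover have "L \<inter> f -` {\<lambda>_. 0} = {x \<in> U. f x = (\<lambda>_. 0)}"
    using sub adm by (auto simp: degree_admissible_def)
  ultimately have "compact {x \<in> U. f x = (\<lambda>_. 0)}"
    using sub adm by (metis compact_Int_closed inf.absorb2 degree_admissible_def)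
  then show "degree_admissible n f U {x \<in> U. f x = (\<lambda>_. 0)}"
    using adm by (auto simp: degree_admissible_def)
qed

lemma has_degree_brouwer_degree:
  assumes adm: "degree_admissible n f U L"
  shows "has_degree n f U L (brouwer_degree n f U)"
proof -
  note Z = degree_admissible_zeros[OF adm]
  have U: "U \<subseteq> Rn n" "L \<subseteq> U" by (rule degree_admissible_subset[OF adm])+
  have "has_degree n f U {x \<in> U. f x = (\<lambda>_. 0)} (brouwer_degree n f U)"
    unfolding brouwer_degree_eq_The[OF U(1)] by (rule theI'[OF has_degree_exists[OF Z(1)]])
  then show ?thesis
    using has_degree_restrict[OF Z(1) order_refl Z(2) U(2)] by blast
qed

lemma brouwer_degree_eqI:
  "degree_admissible n f U L \<Longrightarrow> has_degree n f U L d \<Longrightarrow> brouwer_degree n f U = d"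
  using has_degree_brouwer_degree has_degree_unique by blast

section \<open>Properties of the Brouwer degree\<close>

lemma brouwer_degree_excision:
  assumes "degree_admissible n f U L" "openin (top_of_set (Rn n)) V" "V \<subseteq> U" "L \<subseteq> V"
  shows "brouwer_degree n f V = brouwer_degree n f U"
proof (rule brouwer_degree_eqI)
  show "degree_admissible n f V L"
    using assms continuous_on_subset[of U f V] by (auto simp: degree_admissible_def)
  show "has_degree n f V L (brouwer_degree n f U)"
    by (rule has_degree_restrict[OF assms(1,3) order_refl assms(4) has_degree_brouwer_degree[OF assms(1)]])
qed

lemma brouwer_degree_cong:
  assumes "degree_admissible n f U L" "\<And>x. x \<in> U \<Longrightarrow> f x = g x"
  shows "brouwer_degree n f U = brouwer_degree n g U"
proof -
  have "degree_admissible n g U L"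
    using assms continuous_on_cong[of U U f g] by (auto simp: degree_admissible_def Pi_iff)
  moreover have "has_degree n g U L (brouwer_degree n f U)"
    using has_degree_brouwer_degree[OF assms(1)]
    unfolding has_degree_def by (simp only: hom_ind_cong[of U f g, OF assms(2)])
  ultimately show ?thesis by (rule brouwer_degree_eqI[symmetric])
qed

lemma brouwer_degree_homotopy:
  fixes k :: "real \<Rightarrow> (nat \<Rightarrow> real) \<Rightarrow> nat \<Rightarrow> real"
  assumes U: "openin (top_of_set (Rn n)) U" and L: "compact L" "L \<subseteq> U"
    and cont: "continuous_on ({0..1} \<times> U) (\<lambda>z. k (fst z) (snd z))"
    and Rn: "\<And>t x. t \<in> {0..1} \<Longrightarrow> x \<in> U \<Longrightarrow> k t x \<in> Rn n"
    and nz: "\<And>t x. t \<in> {0..1} \<Longrightarrow> x \<in> U - L \<Longrightarrow> k t x \<noteq> (\<lambda>_. 0)"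
  shows "brouwer_degree n (k 0) U = brouwer_degree n (k 1) U"
proof -
  have "continuous_on U (k t)" if "t \<in> {0..1}" for t
  proof -
    have "continuous_on U ((\<lambda>z. k (fst z) (snd z)) \<circ> (\<lambda>x. (t, x)))"
      by (rule continuous_on_compose, intro continuous_intros)
        (use that in \<open>auto intro!: continuous_on_subset[OF cont]\<close>)
    then show ?thesis by (simp add: o_def)
  qed
  then have adm: "degree_admissible n (k t) U L" if "t \<in> {0..1}" for t
    using U L Rn nz that by (auto simp: degree_admissible_def)
  have eq: "hom_ind (int n) U (U - L) (Rn n) (pRn n) (k 0) = hom_ind (int n) U (U - L) (Rn n) (pRn n) (k 1)"
    by (rule hom_ind_homotopic[OF _ cont]) (use Rn nz in auto)
  have "has_degree n (k 0) U L (brouwer_degree n (k 1) U)"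
    using has_degree_brouwer_degree[OF adm[of 1]] unfolding has_degree_def eq by simp
  then show ?thesis using brouwer_degree_eqI adm[of 0] by simp
qed

text \<open>With \<open>L\<close> empty the class \<open>b\<close> lives in the trivial homology of
  \<open>(U, U)\<close>, so its image is the power with exponent zero.\<close>

lemma brouwer_degree_no_zeros:
  assumes "openin (top_of_set (Rn n)) U" "continuous_on U f" "f \<in> U \<rightarrow> Rn n"
    "\<And>x. x \<in> U \<Longrightarrow> f x \<noteq> (\<lambda>_. 0)"
  shows "brouwer_degree n f U = 0"
proof (rule brouwer_degree_eqI)
  show "degree_admissible n f U {}"
    using assms by (auto simp: degree_admissible_def)
  show "has_degree n f U {} 0"
    unfolding has_degree_def
  proof (intro allI ballI impI)
    fix r a b assume b: "b \<in> carrier (rel_hom (int n) U (U - {}))"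
    have "b = \<one>\<^bsub>rel_hom (int n) U (U - {})\<^esub>"
      using b trivial_relative_homology_group_topspace[of "int n" "top_of_set U"]
      by (auto simp: trivial_group_def simp del: one_relative_homology_group)
    then show "hom_ind (int n) U (U - {}) (Rn n) (pRn n) f b
      = restr n r {\<lambda>_. 0} a [^]\<^bsub>local_hom n\<^esub> (0::int)"
      using hom_ind_one[of "int n" U "U - {}" "Rn n" "pRn n" f] by (simp del: one_relative_homology_group)
  qed
qed

text \<open>The inclusion factors through the pair \<open>(Rn n - L, Rn n - L)\<close>.\<close>

lemma hom_ind_trivial_target:
  assumes "V \<subseteq> Rn n" "V \<inter> L = {}" "M \<subseteq> V"
  shows "hom_ind p V (V - M) (Rn n) (Rn n - L) id b = \<one>\<^bsub>rel_hom p (Rn n) (Rn n - L)\<^esub>"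
proof -
  have "hom_ind p V (V - M) (Rn n) (Rn n - L) id b
    = hom_ind p (Rn n - L) (Rn n - L) (Rn n) (Rn n - L) id (hom_ind p V (V - M) (Rn n - L) (Rn n - L) id b)"
    by (rule hom_ind_incl_comp[symmetric]) (use assms in auto)
  also have "hom_ind p V (V - M) (Rn n - L) (Rn n - L) id b = \<one>\<^bsub>rel_hom p (Rn n - L) (Rn n - L)\<^esub>"
    using trivial_relative_homology_group_topspace[of p "top_of_set (Rn n - L)"]
      hom_induced_carrier[of p "top_of_set V" "V - M" "top_of_set (Rn n - L)" "Rn n - L" id b]
    by (auto simp: trivial_group_def)
  finally show ?thesis by (simp only: hom_ind_one)
qed

text \<open>The part of \<open>b\<close> along \<open>L2\<close> is lifted by excision to
  \<open>b2\<close> and divided off. The remainder dies in the homology of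
  \<open>(U, U - L2)\<close>, where \<open>U\<close> is the union, so by the triple it comes from
  \<open>(U - L2, U - L)\<close>, and excision moves it to \<open>U1\<close>.\<close>

lemma rel_hom_disjoint_union:
  fixes U1 U2 L1 L2 :: "'a::topological_space set"
  assumes op: "openin (top_of_set (U1 \<union> U2)) U1" "openin (top_of_set (U1 \<union> U2)) U2"
    and cl: "closedin (top_of_set (U1 \<union> U2)) L1" "closedin (top_of_set (U1 \<union> U2)) L2"
    and disj: "U1 \<inter> U2 = {}" "L1 \<subseteq> U1" "L2 \<subseteq> U2"
    and b: "b \<in> carrier (rel_hom p (U1 \<union> U2) (U1 \<union> U2 - (L1 \<union> L2)))"
  obtains b1 b2 where "b1 \<in> carrier (rel_hom p U1 (U1 - L1))" "b2 \<in> carrier (rel_hom p U2 (U2 - L2))"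
    "b = hom_ind p U1 (U1 - L1) (U1 \<union> U2) (U1 \<union> U2 - (L1 \<union> L2)) id b1
      \<otimes>\<^bsub>rel_hom p (U1 \<union> U2) (U1 \<union> U2 - (L1 \<union> L2))\<^esub>
      hom_ind p U2 (U2 - L2) (U1 \<union> U2) (U1 \<union> U2 - (L1 \<union> L2)) id b2"
proof -
  let ?U = "U1 \<union> U2" let ?L = "L1 \<union> L2"
  let ?G = "rel_hom p ?U (?U - ?L)"
  interpret G: comm_group ?G by simp
  let ?\<rho> = "hom_ind p ?U (?U - ?L) ?U (?U - L2) id"
  let ?i1 = "hom_ind p U1 (U1 - L1) ?U (?U - ?L) id"
  let ?i2 = "hom_ind p U2 (U2 - L2) ?U (?U - ?L) id"
  have "?\<rho> b \<in> carrier (rel_hom p ?U (?U - L2))" by (rule hom_induced_carrier)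
  then obtain b2 where b2: "b2 \<in> carrier (rel_hom p U2 (U2 - L2))"
    "hom_ind p U2 (U2 - L2) ?U (?U - L2) id b2 = ?\<rho> b"
    using iso_surj[OF iso_rel_hom_excision[OF op(2) cl(2) disj(3)]] by blast
  have \<rho>i2: "?\<rho> (?i2 b2) = ?\<rho> b"
    unfolding b2(2)[symmetric] by (rule hom_ind_incl_comp) (use disj in auto)
  have i2: "?i2 b2 \<in> carrier ?G" by (rule hom_induced_carrier)
  define e where "e = b \<otimes>\<^bsub>?G\<^esub> inv\<^bsub>?G\<^esub> (?i2 b2)"
  have e: "e \<in> carrier ?G" using b i2 by (simp add: e_def)
  interpret \<rho>: group_hom ?G "rel_hom p ?U (?U - L2)" ?\<rho>
    by (simp add: group_hom_def group_hom_axioms_def hom_induced_hom)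
  have "?\<rho> e = \<one>\<^bsub>rel_hom p ?U (?U - L2)\<^esub>"
    unfolding e_def using b i2 by (simp add: \<rho>i2)
  then have "e \<in> kernel ?G (rel_hom p ?U (?U - L2)) ?\<rho>" using e by (simp add: kernel_def)
  moreover have "subtopology (top_of_set ?U) (?U - L2) = top_of_set (?U - L2)"
    by (simp add: subtopology_subtopology Int_absorb1)
  then have "kernel ?G (rel_hom p ?U (?U - L2)) ?\<rho>
      = hom_ind p (?U - L2) (?U - ?L) ?U (?U - ?L) id ` carrier (rel_hom p (?U - L2) (?U - ?L))"
    using homology_exactness_triple_3[of "?U - ?L" "?U - L2" p "top_of_set ?U"] by auto
  ultimately obtain e' where e': "e' \<in> carrier (rel_hom p (?U - L2) (?U - ?L))"
    "e = hom_ind p (?U - L2) (?U - ?L) ?U (?U - ?L) id e'" by blast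
  have "U1 \<subseteq> ?U - L2" "L1 \<subseteq> ?U - L2" using disj by auto
  then have "openin (top_of_set (?U - L2)) U1" "closedin (top_of_set (?U - L2)) L1"
    using op(1) cl(1) by (auto intro: openin_subset_trans closedin_subset_trans)
  from iso_rel_hom_excision[OF this disj(2), of p]
  have exc1: "hom_ind p U1 (U1 - L1) (?U - L2) (?U - ?L) id
    \<in> iso (rel_hom p U1 (U1 - L1)) (rel_hom p (?U - L2) (?U - ?L))"
    by (simp add: Diff_Diff_Int Un_commute set_diff_eq Collect_conj_eq conj_commute conj_left_commute)
  then obtain b1 where b1: "b1 \<in> carrier (rel_hom p U1 (U1 - L1))"
    "hom_ind p U1 (U1 - L1) (?U - L2) (?U - ?L) id b1 = e'"
    using iso_surj[OF exc1 e'(1)] by blast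
  have "?i1 b1 = e"
    unfolding e'(2) b1(2)[symmetric] by (rule hom_ind_incl_comp[symmetric]) (use disj in auto)
  then have "b = ?i1 b1 \<otimes>\<^bsub>?G\<^esub> ?i2 b2"
    using b i2 by (simp add: e_def G.m_assoc)
  with b1(1) b2(1) show ?thesis by (rule that)
qed

text \<open>Restricted along \<open>L1\<close>, the summand from \<open>U2\<close> vanishes, so
  \<open>b1\<close> represents the orientation along \<open>L1\<close>, and symmetrically for
  \<open>b2\<close>. Applying \<open>f\<close> to the product of the two classes adds the
  exponents.\<close>

lemma brouwer_degree_additive:
  assumes adm: "degree_admissible n f (U1 \<union> U2) L"
    and op: "openin (top_of_set (Rn n)) U1" "openin (top_of_set (Rn n)) U2" and disj: "U1 \<inter> U2 = {}"
  shows "brouwer_degree n f (U1 \<union> U2) = brouwer_degree n f U1 + brouwer_degree n f U2"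
proof (rule brouwer_degree_eqI[OF adm])
  let ?U = "U1 \<union> U2"
  define L1 L2 where "L1 = L \<inter> U1" and "L2 = L \<inter> U2"
  have UR: "U1 \<subseteq> Rn n" "U2 \<subseteq> Rn n" "L \<subseteq> ?U"
    using degree_admissible_subset[OF adm] by auto
  have opU: "openin (top_of_set ?U) U1" "openin (top_of_set ?U) U2"
    using op UR by (auto intro: openin_subset_trans)
  have LL: "L = L1 \<union> L2" "L1 = L - U2" "L2 = L - U1" using UR disj by (auto simp: L1_def L2_def)
  have "compact L" using adm by (simp add: degree_admissible_def)
  obtain O1 O2 where O: "open O1" "open O2" "U1 = Rn n \<inter> O1" "U2 = Rn n \<inter> O2"
    using op by (auto simp: openin_open)
  \<comment> \<open>Removing an open set from the compact \<open>L\<close> leaves a compact set,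
    which would not be visible from the intersection with the open \<open>U1\<close>.\<close>
  have "L1 = L - O2" "L2 = L - O1" using LL UR O by auto
  then have cpt: "compact L1" "compact L2"
    using \<open>compact L\<close> O by (auto intro: compact_diff)
  have sub: "L1 \<subseteq> U1" "L2 \<subseteq> U2" by (auto simp: L1_def L2_def)
  have incl: "U1 - L1 \<subseteq> ?U - L" "U2 - L2 \<subseteq> ?U - L" by (auto simp: L1_def L2_def)
  have adm1: "degree_admissible n f U1 L1" "degree_admissible n f U2 L2"
    using adm op cpt continuous_on_subset[of ?U f] unfolding degree_admissible_def L1_def L2_def by auto
  note d = has_degree_brouwer_degree[OF adm1(1)] has_degree_brouwer_degree[OF adm1(2)]
  interpret G: group "local_hom n" by simp
  show "has_degree n f ?U L (brouwer_degree n f U1 + brouwer_degree n f U2)"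
    unfolding has_degree_def
  proof (intro allI ballI impI)
    fix r a b assume r: "L \<subseteq> euclidean_cball n r" and a: "a \<in> carrier (orient n r)"
      and b: "b \<in> carrier (rel_hom (int n) ?U (?U - L))"
      and eq: "hom_ind (int n) ?U (?U - L) (Rn n) (Rn n - L) id b = restr n r L a"
    have cl: "closedin (top_of_set ?U) L1" "closedin (top_of_set ?U) L2"
      using cpt sub by (auto intro!: closed_subset compact_imp_closed)
    let ?i1 = "hom_ind (int n) U1 (U1 - L1) ?U (?U - L) id"
    let ?i2 = "hom_ind (int n) U2 (U2 - L2) ?U (?U - L) id"
    obtain b1 b2 where b12: "b1 \<in> carrier (rel_hom (int n) U1 (U1 - L1))"
      "b2 \<in> carrier (rel_hom (int n) U2 (U2 - L2))"
      "b = ?i1 b1 \<otimes>\<^bsub>rel_hom (int n) ?U (?U - L)\<^esub> ?i2 b2"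
      using rel_hom_disjoint_union[OF opU cl disj sub, of b "int n"] b unfolding LL(1)[symmetric] by blast
    have i: "?i1 b1 \<in> carrier (rel_hom (int n) ?U (?U - L))" "?i2 b2 \<in> carrier (rel_hom (int n) ?U (?U - L))"
      by (rule hom_induced_carrier)+
    have restrict: "hom_ind (int n) ?U (?U - L) (Rn n) (Rn n - M) id b = restr n r M a" if "M \<subseteq> L" for M
    proof -
      have "hom_ind (int n) ?U (?U - L) (Rn n) (Rn n - M) id b
        = hom_ind (int n) (Rn n) (Rn n - L) (Rn n) (Rn n - M) id (hom_ind (int n) ?U (?U - L) (Rn n) (Rn n - L) id b)"
        by (rule hom_ind_incl_comp[symmetric]) (use that UR in auto)
      also have "\<dots> = restr n r M a"
        unfolding eq by (rule hom_ind_incl_comp) (use that r in auto)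
      finally show ?thesis .
    qed
    have comp1: "hom_ind (int n) ?U (?U - L) (Rn n) (Rn n - M) id (?i1 b1)
        = hom_ind (int n) U1 (U1 - L1) (Rn n) (Rn n - M) id b1" if "M \<subseteq> L" for M
      by (rule hom_ind_incl_comp) (use that UR incl in auto)
    have comp2: "hom_ind (int n) ?U (?U - L) (Rn n) (Rn n - M) id (?i2 b2)
        = hom_ind (int n) U2 (U2 - L2) (Rn n) (Rn n - M) id b2" if "M \<subseteq> L" for M
      by (rule hom_ind_incl_comp) (use that UR incl in auto)
    have "restr n r L1 a = hom_ind (int n) U1 (U1 - L1) (Rn n) (Rn n - L1) id b1
        \<otimes>\<^bsub>rel_hom (int n) (Rn n) (Rn n - L1)\<^esub> hom_ind (int n) U2 (U2 - L2) (Rn n) (Rn n - L1) id b2"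
      using restrict[of L1] comp1[of L1] comp2[of L1] b12(3) i by (simp only: hom_ind_mult LL(1) Un_upper1)
    also have "hom_ind (int n) U2 (U2 - L2) (Rn n) (Rn n - L1) id b2 = \<one>\<^bsub>rel_hom (int n) (Rn n) (Rn n - L1)\<^esub>"
      by (rule hom_ind_trivial_target) (use UR sub disj in auto)
    finally have r1: "hom_ind (int n) U1 (U1 - L1) (Rn n) (Rn n - L1) id b1 = restr n r L1 a"
      by (simp only: monoid.r_one[OF group.is_monoid[OF group_relative_homology_group] hom_induced_carrier])
    have "restr n r L2 a = hom_ind (int n) U1 (U1 - L1) (Rn n) (Rn n - L2) id b1
        \<otimes>\<^bsub>rel_hom (int n) (Rn n) (Rn n - L2)\<^esub> hom_ind (int n) U2 (U2 - L2) (Rn n) (Rn n - L2) id b2"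
      using restrict[of L2] comp1[of L2] comp2[of L2] b12(3) i by (simp only: hom_ind_mult LL(1) Un_upper2)
    also have "hom_ind (int n) U1 (U1 - L1) (Rn n) (Rn n - L2) id b1 = \<one>\<^bsub>rel_hom (int n) (Rn n) (Rn n - L2)\<^esub>"
      by (rule hom_ind_trivial_target) (use UR sub disj in auto)
    finally have r2: "hom_ind (int n) U2 (U2 - L2) (Rn n) (Rn n - L2) id b2 = restr n r L2 a"
      by (simp only: monoid.l_one[OF group.is_monoid[OF group_relative_homology_group] hom_induced_carrier])
    have f1: "hom_ind (int n) U1 (U1 - L1) (Rn n) (pRn n) f b1
        = restr n r {\<lambda>_. 0} a [^]\<^bsub>local_hom n\<^esub> brouwer_degree n f U1"
      using d(1) r a b12(1) r1 unfolding has_degree_def L1_def by blast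
    have f2: "hom_ind (int n) U2 (U2 - L2) (Rn n) (pRn n) f b2
        = restr n r {\<lambda>_. 0} a [^]\<^bsub>local_hom n\<^esub> brouwer_degree n f U2"
      using d(2) r a b12(2) r2 unfolding has_degree_def L2_def by blast
    have fU: "continuous_on ?U f" "f \<in> ?U \<rightarrow> Rn n" "f \<in> ?U - L \<rightarrow> pRn n"
      using adm by (auto simp: degree_admissible_def)
    have "hom_ind (int n) ?U (?U - L) (Rn n) (pRn n) f (?i1 b1) = hom_ind (int n) U1 (U1 - L1) (Rn n) (pRn n) f b1"
      "hom_ind (int n) ?U (?U - L) (Rn n) (pRn n) f (?i2 b2) = hom_ind (int n) U2 (U2 - L2) (Rn n) (pRn n) f b2"
      by (rule hom_ind_incl_comp[OF _ incl(1) fU] hom_ind_incl_comp[OF _ incl(2) fU], blast)+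
    then show "hom_ind (int n) ?U (?U - L) (Rn n) (pRn n) f b
      = restr n r {\<lambda>_. 0} a [^]\<^bsub>local_hom n\<^esub> (brouwer_degree n f U1 + brouwer_degree n f U2)"
      unfolding b12(3) using i f1 f2 by (simp add: hom_ind_mult G.int_pow_mult hom_induced_carrier)
  qed
qed

section \<open>Reduction of the dimension\<close>

lemma closedin_cball: "closedin (top_of_set (Rn n)) (euclidean_cball n r)"
proof -
  have "closed {x::nat\<Rightarrow>real. (\<Sum>k<n. (x k)\<^sup>2) \<le> r\<^sup>2}"
    by (intro closed_Collect_le continuous_intros continuous_on_coordinate)
  moreover have "euclidean_cball n r = Rn n \<inter> {x. (\<Sum>k<n. (x k)\<^sup>2) \<le> r\<^sup>2}"
    by (auto simp: euclidean_cball_def)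
  ultimately show ?thesis by (simp add: closedin_closed_Int)
qed

lemma cyl_map_id [simp]: "cyl_map n id = id"
  by (simp add: cyl_map_def fun_eq_iff)

lemma suspension_natural_incl:
  assumes "V \<subseteq> Rn n" "closedin (top_of_set V) K" "W \<subseteq> Rn n" "closedin (top_of_set W) L"
    and "V \<subseteq> W" "V - K \<subseteq> W - L" "x \<in> carrier (rel_hom (p + 1) (cyl n V) (cyl n V - K))"
  shows "suspension p n W L
      (hom_ind (p + 1) (cyl n V) (cyl n V - K) (cyl n W) (cyl n W - L) id x)
    = hom_ind p V (V - K) W (W - L) id (suspension p n V K x)"
proof -
  have "id \<in> V \<rightarrow> W" "id \<in> V - K \<rightarrow> W - L" using assms by auto
  then show ?thesis
    using suspension_natural[OF assms(1-4) continuous_on_id' _ _ assms(7)] by (simp only: cyl_map_id)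
qed

lemma openin_cyl:
  assumes "openin (top_of_set (Rn n)) V"
  shows "openin (top_of_set (Rn (Suc n))) (cyl n V)"
proof -
  obtain O' where O': "open O'" "V = Rn n \<inter> O'" using assms by (auto simp: openin_open)
  have "continuous_on UNIV (\<lambda>c::nat\<Rightarrow>real. c(n := 0))"
    by (intro continuous_on_fun_upd continuous_intros)
  then have "open ((\<lambda>c::nat\<Rightarrow>real. c(n := 0)) -` O')" using O'(1) by (rule open_vimage[rotated])
  moreover have "cyl n V = Rn (Suc n) \<inter> (\<lambda>c. c(n := 0)) -` O'"
    using O'(2) Rn_upd_0 by (auto simp: cyl_def)
  ultimately show ?thesis by (simp add: openin_open_Int)
qed

text \<open>A zero of \<open>cyl_map n f\<close> has height zero and is then a zero of
  \<open>f\<close>, so the same compact set serves in both dimensions.\<close>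

lemma degree_admissible_suspension:
  assumes adm: "degree_admissible n f V L"
  shows "degree_admissible (Suc n) (cyl_map n f) (cyl n V) L"
proof -
  note V = degree_admissible_subset[OF adm]
  have "L \<subseteq> cyl n V" using V subset_cyl by blast
  moreover have "cyl_map n f \<in> cyl n V \<rightarrow> Rn (Suc n)"
    using adm by (auto simp: degree_admissible_def cyl_def cyl_map_def intro!: Rn_upd)
  moreover have "cyl_map n f c \<noteq> (\<lambda>_. 0)" if c: "c \<in> cyl n V - L" for c
  proof
    assume 0: "cyl_map n f c = (\<lambda>_. 0)"
    then have "c n = 0" by (metis cyl_map_def fun_upd_same)
    then have "c(n := 0) = c" by (simp add: fun_upd_idem)
    then have "c \<in> V - L" "f c \<in> Rn n" "cyl_map n f c = (f c)(n := 0)"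
      using c adm \<open>c n = 0\<close> by (auto simp: cyl_def cyl_map_def degree_admissible_def)
    then show False using adm 0 Rn_upd_idem[of "f c" n] by (auto simp: degree_admissible_def)
  qed
  ultimately show ?thesis
    using adm openin_cyl continuous_on_cyl_map by (auto simp: degree_admissible_def)
qed

text \<open>Suspension carries \<open>a'\<close> and \<open>b'\<close> to classes \<open>a\<close>
  and \<open>b\<close> one dimension lower. Naturality for inclusions shows that they are related as
  \<open>has_degree\<close> requires, naturality for \<open>f\<close> compares the images, and
  injectivity of the suspension at the origin lifts the equation back.\<close>

lemma has_degree_suspension:
  assumes adm: "degree_admissible n f V L" and d: "has_degree n f V L d"
  shows "has_degree (Suc n) (cyl_map n f) (cyl n V) L d"
  unfolding has_degree_def
proof (intro allI ballI impI)
  let ?p = "int n + 1" and ?R = "Rn (Suc n)"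
  have p: "int (Suc n) = ?p" by simp
  note VR = degree_admissible_subset[OF adm]
  have "compact L" using adm by (simp add: degree_admissible_def)
  have clV: "closedin (top_of_set V) L" "closedin (top_of_set (Rn n)) L"
    using \<open>compact L\<close> VR by (auto intro!: closed_subset compact_imp_closed)
  have cl0: "closedin (top_of_set (Rn n)) {\<lambda>_. 0}"
    by (intro closed_subset) (auto simp: topspace_Euclidean_space)
  fix r a' b' assume r: "L \<subseteq> euclidean_cball (Suc n) r"
    and a': "a' \<in> carrier (orient (Suc n) r)"
    and b': "b' \<in> carrier (rel_hom (int (Suc n)) (cyl n V) (cyl n V - L))"
    and eq: "hom_ind (int (Suc n)) (cyl n V) (cyl n V - L) ?R (?R - L) id b' = restr (Suc n) r L a'"
  have r': "L \<subseteq> euclidean_cball n r"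
  proof
    fix x assume "x \<in> L"
    then have "x \<in> Rn n" "x \<in> euclidean_cball (Suc n) r" using VR r by auto
    then show "x \<in> euclidean_cball n r" by (auto simp: euclidean_cball_def topspace_Euclidean_space)
  qed
  let ?B = "euclidean_cball n r"
  \<comment> \<open>The suspension needs the removed set to lie in \<open>Rn n\<close>, so the class
    is first restricted from the ball of dimension \<open>n + 1\<close> to the ball of dimension
    \<open>n\<close> inside it.\<close>
  define a'' where "a'' = hom_ind ?p ?R (?R - euclidean_cball (Suc n) r) ?R (?R - ?B) id a'"
  have a'': "a'' \<in> carrier (rel_hom ?p (cyl n (Rn n)) (cyl n (Rn n) - ?B))"
    unfolding a''_def cyl_Rn by (rule hom_induced_carrier)
  have a''_restr: "hom_ind ?p ?R (?R - ?B) ?R (?R - M) id a'' = restr (Suc n) r M a'" if "M \<subseteq> ?B" for M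
    unfolding a''_def p by (rule hom_ind_incl_comp) (use that cball_Suc[of n r] in auto)
  define a where "a = suspension (int n) n (Rn n) ?B a''"
  define b where "b = suspension (int n) n V L b'"
  have b'2: "b' \<in> carrier (rel_hom ?p (cyl n V) (cyl n V - L))" using b' unfolding p .
  have a: "a \<in> carrier (orient n r)"
    using iso_suspension[OF order_refl closedin_cball, of "int n" n r] a''
    unfolding a_def iso_iff by blast
  have b: "b \<in> carrier (rel_hom (int n) V (V - L))"
    using iso_suspension[OF VR(1) clV(1), of "int n"] b'2 unfolding b_def iso_iff by blast
  have nat_a: "suspension (int n) n (Rn n) M (restr (Suc n) r M a') = restr n r M a"
    if "M \<subseteq> ?B" "closedin (top_of_set (Rn n)) M" for M
    using suspension_natural_incl[OF order_refl closedin_cball order_refl that(2) order_refl _ a''] that(1)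
    unfolding a_def a''_restr[OF that(1), symmetric] cyl_Rn by blast
  have "hom_ind (int n) V (V - L) (Rn n) (Rn n - L) id b
    = suspension (int n) n (Rn n) L (hom_ind ?p (cyl n V) (cyl n V - L) ?R (?R - L) id b')"
    using suspension_natural_incl[OF VR(1) clV(1) order_refl clV(2) VR(1) _ b'2] VR(1)
    unfolding b_def cyl_Rn by blast
  also have "\<dots> = restr n r L a"
    unfolding eq[unfolded p] using nat_a[OF r' clV(2)] unfolding p .
  finally have fb: "hom_ind (int n) V (V - L) (Rn n) (pRn n) f b
      = restr n r {\<lambda>_. 0} a [^]\<^bsub>local_hom n\<^esub> d"
    using d r' a b unfolding has_degree_def by blast
  let ?\<sigma> = "suspension (int n) n (Rn n) {\<lambda>_. 0}"
  have iso\<sigma>: "?\<sigma> \<in> iso (local_hom (Suc n)) (local_hom n)"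
    using iso_suspension[OF order_refl cl0, of "int n"] unfolding cyl_Rn p .
  let ?F = "hom_ind (int (Suc n)) (cyl n V) (cyl n V - L) ?R (pRn (Suc n)) (cyl_map n f) b'"
  let ?z = "restr (Suc n) r {\<lambda>_. 0} a'"
  have "?\<sigma> ?F = hom_ind (int n) V (V - L) (Rn n) (pRn n) f b"
    using suspension_natural[OF VR(1) clV(1) order_refl cl0 _ _ _ b'2, of f] adm
    unfolding b_def cyl_Rn p by (auto simp: degree_admissible_def)
  also have "\<dots> = ?\<sigma> ?z [^]\<^bsub>local_hom n\<^esub> d"
    unfolding fb using nat_a[OF _ cl0] zero_in_cball by simp
  also have "\<dots> = ?\<sigma> (?z [^]\<^bsub>local_hom (Suc n)\<^esub> d)"
    by (rule hom_int_pow[symmetric]) (use iso\<sigma> in \<open>auto simp: iso_iff hom_induced_carrier\<close>)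
  finally show "?F = ?z [^]\<^bsub>local_hom (Suc n)\<^esub> d"
    by (rule iso_inj[OF iso\<sigma> hom_induced_carrier int_pow_closed_rel_hom[OF hom_induced_carrier]])
qed

text \<open>A form of the tube lemma: the complement is the projection of a closed set along the
  compact parameter interval, hence closed.\<close>

lemma openin_segment:
  assumes "openin (top_of_set (Rn (Suc n))) U"
  shows "openin (top_of_set (Rn (Suc n))) {c \<in> Rn (Suc n). \<forall>s\<in>{0..1}. c(n := s * c n) \<in> U}"
proof -
  let ?R = "Rn (Suc n)" let ?I = "{0..1::real}" let ?g = "\<lambda>z::real\<times>(nat\<Rightarrow>real). (snd z)(n := fst z * snd z n)"
  obtain O' where O': "open O'" "U = ?R \<inter> O'" using assms by (auto simp: openin_open)
  have "continuous_on UNIV ?g"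
    by (intro continuous_on_fun_upd continuous_intros continuous_on_snd_coordinate)
  then have "closed (?g -` (- O'))" using O'(1) by (intro closed_vimage) auto
  then have "closedin (top_of_set (?I \<times> ?R)) (?I \<times> ?R \<inter> ?g -` (- O'))"
    by (rule closedin_closed_Int)
  moreover have "closed_map (prod_topology (top_of_set ?I) (top_of_set ?R)) (top_of_set ?R) snd"
    by (rule closed_map_snd) (simp add: compact_space_subtopology)
  ultimately have "closedin (top_of_set ?R) (snd ` (?I \<times> ?R \<inter> ?g -` (- O')))"
    unfolding prod_topology_subtopology_eu closed_map_def by blast
  then have "openin (top_of_set ?R) (?R - snd ` (?I \<times> ?R \<inter> ?g -` (- O')))"
    by (intro openin_diff) auto
  moreover have "?R - snd ` (?I \<times> ?R \<inter> ?g -` (- O')) = {c \<in> ?R. \<forall>s\<in>?I. c(n := s * c n) \<in> U}"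
  proof (rule Set.set_eqI)
    fix c
    have "c \<in> snd ` (?I \<times> ?R \<inter> ?g -` (- O')) \<longleftrightarrow> c \<in> ?R \<and> (\<exists>s\<in>?I. c(n := s * c n) \<notin> O')"
      by force
    moreover have "c(n := s * c n) \<in> U \<longleftrightarrow> c(n := s * c n) \<in> O'" if "c \<in> ?R" for s
      using Rn_upd_Suc[OF that] O'(2) by simp
    ultimately show "c \<in> ?R - snd ` (?I \<times> ?R \<inter> ?g -` (- O')) \<longleftrightarrow>
        c \<in> {c \<in> ?R. \<forall>s\<in>?I. c(n := s * c n) \<in> U}" by auto
  qed
  ultimately show ?thesis by simp
qed

text \<open>On the open set \<open>W\<close> of points whose segment to the hyperplane stays in \<open>U\<close>, shrinking the last
  coordinate in the argument deforms \<open>G\<close> into the suspension of its restriction, without changing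
  the zeros.\<close>

lemma brouwer_degree_reduction:
  assumes adm: "degree_admissible (Suc n) G U L" and Gn: "\<And>c. c \<in> U \<Longrightarrow> G c n = c n"
  shows "brouwer_degree (Suc n) G U = brouwer_degree n G (U \<inter> Rn n)"
proof -
  let ?R = "Rn (Suc n)"
  define K where "K = {c \<in> U. G c = (\<lambda>_. 0)}"
  define V where "V = U \<inter> Rn n"
  define T where "T = cyl n V"
  define F where "F = cyl_map n G"
  define W where "W = {c \<in> ?R. \<forall>s\<in>{0..1}. c(n := s * c n) \<in> U}"
  have admK: "degree_admissible (Suc n) G U K"
    unfolding K_def by (rule degree_admissible_zeros[OF adm])
  have U: "U \<subseteq> ?R" "openin (top_of_set ?R) U" "continuous_on U G" "G \<in> U \<rightarrow> ?R" "compact K"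
    using degree_admissible_subset[OF adm] admK by (auto simp: degree_admissible_def)
  have inRn: "c \<in> Rn n" if "c \<in> ?R" "c n = 0" for c
    using Rn_upd_0[OF that(1)] that(2) by (metis fun_upd_triv)
  have RnD: "c n = 0" if "c \<in> Rn n" for c using that by (simp add: topspace_Euclidean_space)
  have KV: "K \<subseteq> V"
  proof
    fix c assume c: "c \<in> K"
    then have "c n = 0" using Gn[of c] by (simp add: K_def)
    then show "c \<in> V" using c U(1) inRn by (auto simp: K_def V_def)
  qed
  have opV: "openin (top_of_set (Rn n)) V"
    using U(2) Rn_mono_Suc[of n] unfolding V_def openin_open by blast
  have admV: "degree_admissible n G V K"
    unfolding degree_admissible_def
  proof (intro conjI)
    show "continuous_on V G" using continuous_on_subset[OF U(3)] by (auto simp: V_def)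
    show "G \<in> V \<rightarrow> Rn n"
    proof
      fix c assume "c \<in> V"
      then have "c \<in> U" "c n = 0" using RnD by (auto simp: V_def)
      then show "G c \<in> Rn n" using U(4) Gn by (intro inRn) auto
    qed
  qed (use opV U(5) KV in \<open>auto simp: K_def V_def\<close>)
  have admT: "degree_admissible (Suc n) F T K"
    unfolding F_def T_def by (rule degree_admissible_suspension[OF admV])
  have degT: "brouwer_degree (Suc n) F T = brouwer_degree n G V"
    using brouwer_degree_eqI[OF admT] has_degree_suspension[OF admV has_degree_brouwer_degree[OF admV]]
    unfolding F_def T_def by simp
  have WU: "W \<subseteq> U"
  proof
    fix c assume "c \<in> W"
    then have "\<forall>s\<in>{0..1}. c(n := s * c n) \<in> U" by (simp add: W_def)
    from bspec[OF this, of 1] show "c \<in> U" by simp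
  qed
  have W0: "c(n := 0) \<in> V" if "c \<in> W" for c
  proof -
    have *: "\<forall>s\<in>{0..1}. c(n := s * c n) \<in> U" "c \<in> ?R" using that by (simp_all add: W_def)
    from bspec[OF *(1), of 0] Rn_upd_0[OF *(2)] show ?thesis by (simp add: V_def)
  qed
  then have WT: "W \<subseteq> T" by (auto simp: T_def cyl_def W_def)
  have opW: "openin (top_of_set ?R) W" unfolding W_def by (rule openin_segment[OF U(2)])
  have KW: "K \<subseteq> W"
  proof
    fix c assume "c \<in> K"
    then have "c \<in> V" "c n = 0" using KV RnD by (auto simp: V_def)
    then have "c(n := s * c n) = c" "c \<in> U" "c \<in> ?R" for s using U(1) by (auto simp: V_def fun_upd_idem)
    then show "c \<in> W" by (simp add: W_def)
  qed
  \<comment> \<open>Stage \<open>0\<close> is the suspension of \<open>G\<close> restricted to the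
    hyperplane. Stage \<open>1\<close> is \<open>G\<close> itself, because its coordinate
    \<open>n\<close> is already \<open>c n\<close> by the assumption on \<open>G\<close>.\<close>
  define k where "k = (\<lambda>s c. (G (c(n := s * c n)))(n := c n))"
  have "brouwer_degree (Suc n) (k 0) W = brouwer_degree (Suc n) (k 1) W"
  proof (rule brouwer_degree_homotopy[OF opW U(5) KW])
    have WUs: "c(n := s * c n) \<in> U" if "s \<in> {0..1}" "c \<in> W" for s c using that unfolding W_def by blast
    have "continuous_on ({0..1} \<times> W) (G \<circ> (\<lambda>z. (snd z)(n := fst z * snd z n)))"
      by (rule continuous_on_compose, intro continuous_on_fun_upd continuous_intros continuous_on_snd_coordinate)
        (use WUs in \<open>auto intro!: continuous_on_subset[OF U(3)]\<close>)
    then show "continuous_on ({0..1} \<times> W) (\<lambda>z. k (fst z) (snd z))"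
      unfolding k_def o_def by (intro continuous_on_fun_upd continuous_on_snd_coordinate)
    show "k s c \<in> ?R" if "s \<in> {0..1}" "c \<in> W" for s c
      using WUs[OF that] U(4) unfolding k_def by (intro Rn_upd_Suc) auto
    show "k s c \<noteq> (\<lambda>_. 0)" if s: "s \<in> {0..1}" and c: "c \<in> W - K" for s c
    proof
      assume 0: "k s c = (\<lambda>_. 0)"
      \<comment> \<open>A zero of any stage has height zero, and there rescaling the height changes
        nothing, so it is a zero of \<open>G\<close>.\<close>
      then have cn: "c n = 0" unfolding k_def by (metis fun_upd_same)
      then have "c(n := s * c n) = c" by (simp add: fun_upd_idem)
      moreover have "c \<in> U" using c WU by blast
      ultimately have "k s c = G c" using Gn[of c] by (simp add: k_def fun_upd_idem)
      then show False using 0 c \<open>c \<in> U\<close> by (simp add: K_def)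
    qed
  qed
  moreover have "brouwer_degree (Suc n) F W = brouwer_degree (Suc n) (k 0) W"
  proof (rule brouwer_degree_cong)
    show "degree_admissible (Suc n) F W K"
      using admT opW WT KW continuous_on_subset[of T F W] by (auto simp: degree_admissible_def)
  qed (simp add: F_def cyl_map_def k_def)
  moreover have "brouwer_degree (Suc n) G W = brouwer_degree (Suc n) (k 1) W"
  proof (rule brouwer_degree_cong)
    show "degree_admissible (Suc n) G W K"
      using admK opW WU KW continuous_on_subset[of U G W] by (auto simp: degree_admissible_def)
    show "G c = k 1 c" if "c \<in> W" for c
      using WU that Gn[of c] by (auto simp: k_def fun_upd_idem)
  qed
  moreover have "brouwer_degree (Suc n) G W = brouwer_degree (Suc n) G U"
    by (rule brouwer_degree_excision[OF admK opW WU KW])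
  moreover have "brouwer_degree (Suc n) F W = brouwer_degree (Suc n) F T"
    by (rule brouwer_degree_excision[OF admT opW WT KW])
  ultimately show ?thesis using degT by (simp add: V_def)
qed

section \<open>Degrees on spans\<close>

text \<open>Tychonoff's theorem. The index type is arbitrary because the box is needed over the
  natural numbers and also over the whole dual of a normed space.\<close>

lemma compact_box:
  fixes a b :: "'i \<Rightarrow> real"
  shows "compact {x. \<forall>i. x i \<in> {a i..b i}}"
proof -
  have "{x. \<forall>i. x i \<in> {a i..b i}} = (\<Pi>\<^sub>E i\<in>UNIV. {a i..b i})"
    by (auto simp: PiE_def Pi_def)
  moreover have "compactin (product_topology (\<lambda>_. euclidean) UNIV) (\<Pi>\<^sub>E i\<in>UNIV. {a i..b i})"
    by (simp add: compactin_PiE)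
  ultimately show ?thesis
    by (simp add: euclidean_product_topology)
qed

lemma compact_cball: "compact (euclidean_cball n r)"
proof -
  have "closed (euclidean_cball n r)"
    using closedin_cball closedin_Euclidean_space_iff unfolding Euclidean_space_eq[symmetric] by blast
  moreover have "euclidean_cball n r \<subseteq> {x. \<forall>i. x i \<in> {- \<bar>r\<bar>..\<bar>r\<bar>}}"
  proof (intro subsetI CollectI allI)
    fix x i assume x: "x \<in> euclidean_cball n r"
    show "x i \<in> {- \<bar>r\<bar>..\<bar>r\<bar>}"
    proof (cases "i < n")
      case True
      then have "(x i)\<^sup>2 \<le> (\<Sum>k<n. (x k)\<^sup>2)" by (intro member_le_sum) auto
      then have "(x i)\<^sup>2 \<le> r\<^sup>2" using x by (simp add: euclidean_cball_def)
      then show ?thesis using abs_le_square_iff[of "x i" r] by auto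
    qed (use x in \<open>auto simp: euclidean_cball_def topspace_Euclidean_space\<close>)
  qed
  ultimately show ?thesis
    using compact_Int_closed[OF compact_box, of "euclidean_cball n r" "\<lambda>_. - \<bar>r\<bar>" "\<lambda>_. \<bar>r\<bar>"]
    by (simp only: Int_absorb1)
qed

section \<open>Linear combinations and coordinates on the spans\<close>

lemma lincomb_Suc: "lincomb y (Suc n) c = lincomb y n c + c n *\<^sub>R y n"
  by (simp add: lincomb_def)

lemma lincomb_Suc_Rn: "c \<in> Rn n \<Longrightarrow> lincomb y (Suc n) c = lincomb y n c"
  by (simp add: lincomb_Suc topspace_Euclidean_space)

lemma lincomb_diff: "lincomb y n (\<lambda>k. c k - d k) = lincomb y n c - lincomb y n d"
  by (simp add: lincomb_def scaleR_diff_left sum_subtractf)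

lemma lincomb_scale: "lincomb y n (\<lambda>k. a * c k) = a *\<^sub>R lincomb y n c"
  by (simp add: lincomb_def scaleR_sum_right)

lemma continuous_on_lincomb: "continuous_on X (lincomb y n)"
  for y :: "nat \<Rightarrow> 'y::real_normed_vector"
  unfolding lincomb_def by (intro continuous_intros continuous_on_coordinate)

lemma lincomb_image_Rn: "lincomb y n ` Rn n = fin_span y n"
proof
  show "lincomb y n ` Rn n \<subseteq> fin_span y n"
    unfolding lincomb_def fin_span_def by (intro image_subsetI span_sum span_scale span_base imageI) simp
  have "subspace (lincomb y n ` Rn n)"
  proof (rule subspaceI)
    have "lincomb y n (\<lambda>_. 0) = 0" by (simp add: lincomb_def)
    moreover have "(\<lambda>_. 0) \<in> Rn n" by (simp add: topspace_Euclidean_space)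
    ultimately show "0 \<in> lincomb y n ` Rn n" by (metis imageI)
  next
    fix u v assume "u \<in> lincomb y n ` Rn n" "v \<in> lincomb y n ` Rn n"
    then obtain c d where "c \<in> Rn n" "d \<in> Rn n" "u = lincomb y n c" "v = lincomb y n d" by auto
    then have "u + v = lincomb y n (\<lambda>k. c k + d k)" "(\<lambda>k. c k + d k) \<in> Rn n"
      by (auto simp: lincomb_def scaleR_add_left sum.distrib topspace_Euclidean_space)
    then show "u + v \<in> lincomb y n ` Rn n" by (metis imageI)
  next
    fix a u assume "u \<in> lincomb y n ` Rn n"
    then obtain c where "c \<in> Rn n" "u = lincomb y n c" by auto
    then have "a *\<^sub>R u = lincomb y n (\<lambda>k. a * c k)" "(\<lambda>k. a * c k) \<in> Rn n"
      by (auto simp: lincomb_scale topspace_Euclidean_space)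
    then show "a *\<^sub>R u \<in> lincomb y n ` Rn n" by (metis imageI)
  qed
  moreover have "y ` {..<n} \<subseteq> lincomb y n ` Rn n"
  proof
    fix u assume "u \<in> y ` {..<n}"
    then obtain k where k: "k < n" "u = y k" by auto
    have "lincomb y n (\<lambda>l. if l = k then 1 else 0) = (\<Sum>l<n. if l = k then y l else 0)"
      unfolding lincomb_def by (intro sum.cong) auto
    then have "u = lincomb y n (\<lambda>l. if l = k then 1 else 0)" using k by simp
    moreover have "(\<lambda>l. if l = k then 1 else 0) \<in> Rn n" using k by (auto simp: topspace_Euclidean_space)
    ultimately show "u \<in> lincomb y n ` Rn n" by blast
  qed
  ultimately show "fin_span y n \<subseteq> lincomb y n ` Rn n"
    unfolding fin_span_def by (rule span_minimal[rotated])
qed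

text \<open>Coefficients are sequences that vanish from index \<open>n\<close> on, so they are
  unique as sequences and linear independence becomes injectivity of \<open>lincomb y n\<close> on
  \<open>Rn n\<close>.\<close>

definition lin_indep_seq :: "(nat \<Rightarrow> 'y::real_vector) \<Rightarrow> bool" where
  "lin_indep_seq y \<longleftrightarrow> (\<forall>n. \<forall>c\<in>Rn n. lincomb y n c = 0 \<longrightarrow> c = (\<lambda>_. 0))"

lemma inj_on_lincomb:
  assumes "lin_indep_seq y"
  shows "inj_on (lincomb y n) (Rn n)"
proof (rule inj_onI)
  fix c d assume "c \<in> Rn n" "d \<in> Rn n" "lincomb y n c = lincomb y n d"
  then have "(\<lambda>k. c k - d k) \<in> Rn n" "lincomb y n (\<lambda>k. c k - d k) = 0"
    by (auto simp: lincomb_diff topspace_Euclidean_space)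
  then have "(\<lambda>k. c k - d k) = (\<lambda>_. 0)" using assms unfolding lin_indep_seq_def by blast
  then show "c = d" by (simp add: fun_eq_iff)
qed

lemma coords_lincomb: "lin_indep_seq y \<Longrightarrow> c \<in> Rn n \<Longrightarrow> coords y n (lincomb y n c) = c"
  unfolding coords_def by (rule the_inv_into_f_f[OF inj_on_lincomb])

text \<open>The coordinate image of the part of \<open>S\<close> in the span, written as a preimage
  under \<open>lincomb\<close> so that openness and closedness of \<open>S\<close> carry over by
  continuity.\<close>

definition coord_dom :: "(nat \<Rightarrow> 'y::real_vector) \<Rightarrow> nat \<Rightarrow> 'y set \<Rightarrow> (nat \<Rightarrow> real) set" where
  "coord_dom y n S = {c \<in> Rn n. lincomb y n c \<in> S}"

lemma coords_image:
  assumes "lin_indep_seq y"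
  shows "coords y n ` (S \<inter> fin_span y n) = coord_dom y n S"
proof -
  have "S \<inter> fin_span y n = lincomb y n ` coord_dom y n S"
    unfolding lincomb_image_Rn[symmetric] by (auto simp: coord_dom_def)
  moreover have "coords y n ` lincomb y n ` coord_dom y n S = coord_dom y n S"
    using coords_lincomb[OF assms, of _ n] by (force simp: image_image coord_dom_def)
  ultimately show ?thesis by simp
qed

definition coord_map ::
  "('y \<Rightarrow> 'x) \<Rightarrow> (nat \<Rightarrow> 'y) \<Rightarrow> ('y::real_normed_vector \<Rightarrow> 'x::real_normed_vector \<Rightarrow>\<^sub>L real) \<Rightarrow>
    nat \<Rightarrow> (nat \<Rightarrow> real) \<Rightarrow> nat \<Rightarrow> real" where
  "coord_map i y A n c k = (if k < n then blinfun_apply (A (lincomb y n c)) (i (y k)) else 0)"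

lemma coord_map_Rn: "coord_map i y A n c \<in> Rn n"
  by (simp add: coord_map_def topspace_Euclidean_space)

lemma finite_rank_approx_lincomb:
  "finite_rank_approx i y A n (lincomb y n c) = lincomb y n (coord_map i y A n c)"
  unfolding finite_rank_approx_def lincomb_def coord_map_def by (intro sum.cong) auto

text \<open>\<open>coords y n\<close> and \<open>lincomb y n\<close> are mutually inverse between
  the span and \<open>Rn n\<close>. All later arguments about the degree use this coordinate
  form.\<close>

lemma approx_degree_eq:
  assumes "lin_indep_seq y"
  shows "approx_degree i y A \<Omega> n = brouwer_degree n (coord_map i y A n) (coord_dom y n \<Omega>)"
  unfolding approx_degree_def span_degree_def coords_image[OF assms] finite_rank_approx_lincomb
  by (simp add: coords_lincomb[OF assms] coord_map_Rn)

lemma openin_coord_dom: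
  fixes y :: "nat \<Rightarrow> 'y::real_normed_vector"
  assumes "open S"
  shows "openin (top_of_set (Rn n)) (coord_dom y n S)"
proof -
  have "open (lincomb y n -` S)" using continuous_on_lincomb by (intro open_vimage assms) auto
  moreover have "coord_dom y n S = Rn n \<inter> lincomb y n -` S" by (auto simp: coord_dom_def)
  ultimately show ?thesis by (simp add: openin_open_Int)
qed

text \<open>Equivalence of norms in finite dimension: \<open>m\<close> is the minimum of the norm
  over the coordinate sphere, and homogeneity does the rest.\<close>

lemma norm_lincomb_ge:
  fixes y :: "nat \<Rightarrow> 'y::real_normed_vector"
  assumes "lin_indep_seq y"
  obtains m where "m > 0" "\<And>c. c \<in> Rn n \<Longrightarrow> m * sqrt (\<Sum>k<n. (c k)\<^sup>2) \<le> norm (lincomb y n c)"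
proof -
  let ?S = "{c \<in> Rn n. (\<Sum>k<n. (c k)\<^sup>2) = 1}"
  have scale: "c \<in> pRn n \<Longrightarrow> (\<lambda>k. (1 / sqrt (\<Sum>k<n. (c k)\<^sup>2)) * c k) \<in> ?S" for c
    using sum_squares_pos_Rn[of c n]
    by (auto simp: topspace_Euclidean_space power_mult_distrib power_divide simp flip: sum_distrib_left sum_divide_distrib)
  show ?thesis
  proof (cases "?S = {}")
    \<comment> \<open>The sphere is empty only for \<open>n = 0\<close>; there is no minimum then,
      and any positive constant works.\<close>
    case True
    then have zero: "c = (\<lambda>_. 0)" if "c \<in> Rn n" for c using scale that by blast
    show ?thesis
    proof (rule that[of 1])
      fix c assume "c \<in> Rn n"
      then show "1 * sqrt (\<Sum>k<n. (c k)\<^sup>2) \<le> norm (lincomb y n c)"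
        using zero[of c] by simp
    qed simp
  next
    case False
    have "closed {c::nat\<Rightarrow>real. (\<Sum>k<n. (c k)\<^sup>2) = 1}"
      by (intro closed_Collect_eq continuous_intros continuous_on_coordinate)
    then have "compact (euclidean_cball n 1 \<inter> {c. (\<Sum>k<n. (c k)\<^sup>2) = 1})"
      by (intro compact_Int_closed compact_cball)
    moreover have "euclidean_cball n 1 \<inter> {c. (\<Sum>k<n. (c k)\<^sup>2) = 1} = ?S"
      by (auto simp: euclidean_cball_def)
    ultimately have "compact ?S" by simp
    moreover have "continuous_on ?S (\<lambda>c. norm (lincomb y n c))"
      by (intro continuous_on_norm continuous_on_lincomb)
    ultimately obtain c0 where c0: "c0 \<in> ?S" "\<And>c. c \<in> ?S \<Longrightarrow> norm (lincomb y n c0) \<le> norm (lincomb y n c)"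
      using continuous_attains_inf[OF _ False] by blast
    have "c0 \<noteq> (\<lambda>_. 0)" using c0(1) by auto
    then have "lincomb y n c0 \<noteq> 0" using c0(1) assms unfolding lin_indep_seq_def by blast
    show ?thesis
    proof (rule that[of "norm (lincomb y n c0)"])
      show "norm (lincomb y n c0) > 0" using \<open>lincomb y n c0 \<noteq> 0\<close> by simp
      fix c assume c: "c \<in> Rn n"
      show "norm (lincomb y n c0) * sqrt (\<Sum>k<n. (c k)\<^sup>2) \<le> norm (lincomb y n c)"
      proof (cases "c = (\<lambda>_. 0)")
        case False
        then have "c \<in> pRn n" using c by blast
        then have "norm (lincomb y n c0) \<le> norm (lincomb y n (\<lambda>k. (1 / sqrt (\<Sum>k<n. (c k)\<^sup>2)) * c k))"
          using c0(2) scale by blast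
        then show ?thesis unfolding lincomb_scale
          using sum_squares_pos_Rn[OF \<open>c \<in> pRn n\<close>] by (simp add: field_simps)
      qed simp
    qed
  qed
qed

lemma compact_coord_dom:
  fixes y :: "nat \<Rightarrow> 'y::real_normed_vector"
  assumes "lin_indep_seq y" "closed S" "bounded S"
  shows "compact (coord_dom y n S)"
proof -
  obtain m where m: "m > 0" "\<And>c. c \<in> Rn n \<Longrightarrow> m * sqrt (\<Sum>k<n. (c k)\<^sup>2) \<le> norm (lincomb y n c)"
    using norm_lincomb_ge[OF assms(1)] by blast
  obtain B where B: "B > 0" "\<And>x. x \<in> S \<Longrightarrow> norm x \<le> B" using assms(3) bounded_pos by blast
  have "coord_dom y n S \<subseteq> euclidean_cball n (B / m)"
  proof
    fix c assume "c \<in> coord_dom y n S"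
    then have c: "c \<in> Rn n" "norm (lincomb y n c) \<le> B" using B by (auto simp: coord_dom_def)
    then have "sqrt (\<Sum>k<n. (c k)\<^sup>2) \<le> B / m" using m(1) m(2)[OF c(1)] by (simp add: field_simps)
    then have "(\<Sum>k<n. (c k)\<^sup>2) \<le> (B / m)\<^sup>2" using sqrt_le_D by blast
    then show "c \<in> euclidean_cball n (B / m)" using c(1) by (simp add: euclidean_cball_def)
  qed
  then have "coord_dom y n S = euclidean_cball n (B / m) \<inter> lincomb y n -` S"
    using cball_subset_Rn[of n "B / m"] by (auto simp: coord_dom_def)
  moreover have "closed (lincomb y n -` S)"
    by (intro closed_vimage assms continuous_on_lincomb)
  ultimately show ?thesis by (simp add: compact_Int_closed compact_cball)
qed

text \<open>Turns nonvanishing on the frontier into the compact-set form of admissibility, with one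
  \<open>L\<close> for all stages. The boundary is taken as the part of the span in
  \<open>frontier \<Omega>\<close>, which avoids computing the frontier of the coordinate
  domain.\<close>

lemma coord_homotopy:
  fixes y :: "nat \<Rightarrow> 'y::real_normed_vector" and k :: "real \<Rightarrow> (nat \<Rightarrow> real) \<Rightarrow> nat \<Rightarrow> real"
  assumes y: "lin_indep_seq y" and \<Omega>: "open \<Omega>" "bounded \<Omega>"
    and cont: "continuous_on ({0..1} \<times> coord_dom y n (closure \<Omega>)) (\<lambda>z. k (fst z) (snd z))"
    and kRn: "\<And>t c. k t c \<in> Rn n"
    and nz: "\<And>t c. t \<in> {0..1} \<Longrightarrow> c \<in> coord_dom y n (frontier \<Omega>) \<Longrightarrow> k t c \<noteq> (\<lambda>_. 0)"
  shows "\<exists>L. \<forall>t\<in>{0..1}. degree_admissible n (k t) (coord_dom y n \<Omega>) L"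
    and "brouwer_degree n (k 0) (coord_dom y n \<Omega>) = brouwer_degree n (k 1) (coord_dom y n \<Omega>)"
proof -
  let ?C = "coord_dom y n (closure \<Omega>)" and ?U = "coord_dom y n \<Omega>"
  let ?Z = "({0..1} \<times> ?C) \<inter> (\<lambda>z. k (fst z) (snd z)) -` {\<lambda>_. 0}"
  \<comment> \<open>The zeros of all stages over the closure form a compact set in the product with
    the interval, and \<open>L\<close> is its projection. No stage vanishes on the frontier, so
    \<open>L\<close> lies over \<open>\<Omega>\<close>.\<close>
  define L where "L = snd ` ?Z"
  have cptC: "compact ({0..1::real} \<times> ?C)"
    using compact_coord_dom[OF y] \<Omega>(2) by (intro compact_Times compact_Icc) auto
  have "closed ?Z"
    by (rule continuous_closed_preimage[OF cont compact_imp_closed[OF cptC]]) simp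
  then have "compact (({0..1} \<times> ?C) \<inter> ?Z)" by (rule compact_Int_closed[OF cptC])
  then have "compact ?Z" by (simp only: Int_left_absorb)
  then have L: "compact L" unfolding L_def by (intro compact_continuous_image continuous_intros)
  have UC: "?U \<subseteq> ?C" using closure_subset by (auto simp: coord_dom_def)
  have LU: "L \<subseteq> ?U"
  proof
    fix c assume "c \<in> L"
    then obtain t where t: "t \<in> {0..1}" "c \<in> ?C" "k t c = (\<lambda>_. 0)" by (auto simp: L_def)
    then have "c \<notin> coord_dom y n (frontier \<Omega>)" using nz by blast
    then show "c \<in> ?U" using t(2) \<Omega>(1) by (auto simp: coord_dom_def frontier_def interior_open)
  qed
  have nzU: "k t c \<noteq> (\<lambda>_. 0)" if "t \<in> {0..1}" "c \<in> ?U - L" for t c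
    using that UC by (force simp: L_def)
  have contU: "continuous_on ({0..1} \<times> ?U) (\<lambda>z. k (fst z) (snd z))"
    by (rule continuous_on_subset[OF cont]) (use UC in auto)
  show "brouwer_degree n (k 0) ?U = brouwer_degree n (k 1) ?U"
    by (rule brouwer_degree_homotopy[OF openin_coord_dom[OF \<Omega>(1)] L LU contU kRn nzU])
  have "degree_admissible n (k t) ?U L" if "t \<in> {0..1}" for t
  proof -
    have "continuous_on ?U ((\<lambda>z. k (fst z) (snd z)) \<circ> (\<lambda>x. (t, x)))"
      by (rule continuous_on_compose, intro continuous_intros)
        (use that in \<open>auto intro!: continuous_on_subset[OF contU]\<close>)
    then show ?thesis
      using openin_coord_dom[OF \<Omega>(1)] L LU kRn nzU[OF that] by (simp add: degree_admissible_def o_def)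
  qed
  then show "\<exists>L. \<forall>t\<in>{0..1}. degree_admissible n (k t) ?U L" by blast
qed

section \<open>Weak sequential compactness\<close>

lemma bounded_real_convergent_subsequence:
  fixes x :: "nat \<Rightarrow> real"
  assumes "\<And>n. \<bar>x n\<bar> \<le> B"
  obtains r c where "strict_mono r" "(x \<circ> r) \<longlonglongrightarrow> c"
proof -
  have "\<forall>n. x n \<in> {- B..B}" using assms by (auto simp: abs_le_iff minus_le_iff)
  then show ?thesis using seq_compactE[of "{- B..B}" x] compact_imp_seq_compact[OF compact_Icc] that by metis
qed

lemma not_tendsto_subsequence:
  fixes x :: "nat \<Rightarrow> real"
  assumes "\<not> x \<longlonglongrightarrow> c"
  obtains e and r :: "nat \<Rightarrow> nat"
  where "e > 0" "strict_mono r" "\<And>n. \<bar>x (r n) - c\<bar> \<ge> e"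
proof -
  obtain e where e: "e > 0" "\<forall>N. \<exists>n\<ge>N. \<not> \<bar>x n - c\<bar> < e"
    using assms unfolding lim_sequentially dist_real_def by blast
  then have "infinite {n. \<not> \<bar>x n - c\<bar> < e}"
    by (simp add: infinite_nat_iff_unbounded_le)
  then obtain r :: "nat \<Rightarrow> nat" where "strict_mono r" "\<And>n. r n \<in> {n. \<not> \<bar>x n - c\<bar> < e}"
    using infinite_enumerate by blast
  then show ?thesis using that[of e r] e(1) by (simp add: not_less)
qed

lemma norm_blinfun_apply_le:
  "norm (x::'a::real_normed_vector) \<le> M \<Longrightarrow> \<bar>blinfun_apply (f :: 'a \<Rightarrow>\<^sub>L real) x\<bar> \<le> M * norm f"
  using norm_blinfun[of f x] mult_left_mono[of "norm x" M "norm f"] by (simp add: mult.commute)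

text \<open>The vector represents a cluster point, in a product of compact intervals, of the evaluations at
  the members of the sequence.\<close>

lemma reflexive_cluster_point:
  fixes w :: "nat \<Rightarrow> 'a::real_normed_vector"
  assumes refl: "reflexive_space TYPE('a)" and M: "\<And>n. norm (w n) \<le> M"
  shows "\<exists>v. \<forall>f c. (\<lambda>n. blinfun_apply (f :: 'a \<Rightarrow>\<^sub>L real) (w n)) \<longlonglongrightarrow> c \<longrightarrow> blinfun_apply f v = c"
proof -
  define X :: "nat \<Rightarrow> ('a \<Rightarrow>\<^sub>L real) \<Rightarrow> real" where "X n = (\<lambda>f. blinfun_apply f (w n))" for n
  define B :: "(('a \<Rightarrow>\<^sub>L real) \<Rightarrow> real) set" where "B = {\<psi>. \<forall>f. \<psi> f \<in> {- (M * norm f)..M * norm f}}"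
  have "compact B" unfolding B_def by (rule compact_box)
  moreover have XB: "X n \<in> B" for n
    using norm_blinfun_apply_le[OF M[of n]] by (auto simp: X_def B_def abs_le_iff minus_le_iff)
  then have "eventually (\<lambda>\<psi>. \<psi> \<in> B) (filtermap X sequentially)" by (simp add: eventually_filtermap)
  moreover have "filtermap X sequentially \<noteq> bot" by (simp add: filtermap_bot_iff)
  ultimately obtain \<phi> where \<phi>: "\<phi> \<in> B" "inf (nhds \<phi>) (filtermap X sequentially) \<noteq> bot"
    unfolding compact_filter by blast
  \<comment> \<open>Along the proper filter \<open>G\<close> the evaluations converge to
    \<open>\<phi>\<close> pointwise; therefore every identity that holds for all \<open>X n\<close>,
    in particular linearity, passes to \<open>\<phi>\<close>.\<close>
  define G where "G = inf (nhds \<phi>) (filtermap X sequentially)"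
  have G: "G \<noteq> bot" using \<phi>(2) by (simp add: G_def)
  have ev: "((\<lambda>\<psi>. \<psi> f) \<longlongrightarrow> \<phi> f) G" for f
  proof -
    have "((\<lambda>\<psi>. \<psi> f) \<longlongrightarrow> \<phi> f) (at \<phi>)"
      using continuous_on_coordinate[of "UNIV :: (('a \<Rightarrow>\<^sub>L real) \<Rightarrow> real) set" f]
      by (simp add: continuous_on_def)
    then have "((\<lambda>\<psi>. \<psi> f) \<longlongrightarrow> \<phi> f) (nhds \<phi>)"
      by (rule tendsto_at_iff_tendsto_nhds[THEN iffD1])
    then show ?thesis by (rule tendsto_mono[rotated]) (simp add: G_def)
  qed
  have evG: "eventually P G" if "\<And>n. P (X n)" for P
    using filter_leD[of G "filtermap X sequentially" P] that by (simp add: G_def eventually_filtermap)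
  have lim: "\<phi> f = c" if "(\<lambda>n. blinfun_apply f (w n)) \<longlonglongrightarrow> c" for f c
  proof -
    have "((\<lambda>\<psi>. \<psi> f) \<longlongrightarrow> c) (filtermap X sequentially)"
      using that by (simp add: filterlim_filtermap X_def)
    then have "((\<lambda>\<psi>. \<psi> f) \<longlongrightarrow> c) G" by (rule tendsto_mono[rotated]) (simp add: G_def)
    then show ?thesis using tendsto_unique[OF G ev] by blast
  qed
  have add: "\<phi> (f + g) = \<phi> f + \<phi> g" for f g
  proof -
    have "((\<lambda>\<psi>. \<psi> f + \<psi> g) \<longlongrightarrow> \<phi> f + \<phi> g) G" by (intro tendsto_intros ev)
    moreover have "eventually (\<lambda>\<psi>. \<psi> f + \<psi> g = \<psi> (f + g)) G"
      by (rule evG) (simp add: X_def plus_blinfun.rep_eq)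
    ultimately have "((\<lambda>\<psi>. \<psi> (f + g)) \<longlongrightarrow> \<phi> f + \<phi> g) G" by (rule Lim_transform_eventually)
    then show ?thesis using tendsto_unique[OF G ev] by blast
  qed
  have scale: "\<phi> (a *\<^sub>R f) = a *\<^sub>R \<phi> f" for a f
  proof -
    have "((\<lambda>\<psi>. a *\<^sub>R \<psi> f) \<longlongrightarrow> a *\<^sub>R \<phi> f) G" by (intro tendsto_intros ev)
    moreover have "eventually (\<lambda>\<psi>. a *\<^sub>R \<psi> f = \<psi> (a *\<^sub>R f)) G"
      by (rule evG) (simp add: X_def scaleR_blinfun.rep_eq)
    ultimately have "((\<lambda>\<psi>. \<psi> (a *\<^sub>R f)) \<longlongrightarrow> a *\<^sub>R \<phi> f) G" by (rule Lim_transform_eventually)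
    then show ?thesis using tendsto_unique[OF G ev] by blast
  qed
  have "norm (\<phi> f) \<le> norm f * M" for f
    using \<phi>(1) by (auto simp: B_def abs_le_iff minus_le_iff mult.commute)
  then have bl: "bounded_linear \<phi>" by (intro bounded_linear_intro[of \<phi> M] add scale)
  obtain v where v: "\<And>f. blinfun_apply (Blinfun \<phi>) f = blinfun_apply f v"
    using refl unfolding reflexive_space_def by blast
  then have "blinfun_apply f v = \<phi> f" for f
    using bounded_linear_Blinfun_apply[OF bl] by metis
  then show ?thesis using lim by metis
qed

text \<open>This replaces the separability of the dual space, and with it the Hahn-Banach theorem.\<close>

lemma countable_common_kernel:
  assumes "separable_space (euclidean :: 'a::real_normed_vector topology)"
  shows "\<exists>F :: nat \<Rightarrow> 'a \<Rightarrow>\<^sub>L real. \<forall>x. (\<forall>m. blinfun_apply (F m) x = 0) \<longrightarrow> (\<forall>f :: 'a \<Rightarrow>\<^sub>L real. blinfun_apply f x = 0)"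
proof -
  obtain D :: "'a set" where D: "countable D" "closure D = UNIV"
    using assms by (auto simp: separable_space_def)
  then have "D \<noteq> {}" by auto
  define d where "d = from_nat_into D"
  \<comment> \<open>For each ball of a countable family, \<open>g\<close> picks a functional without
    zeros on it, if there is one. If \<open>f x \<noteq> 0\<close>, then \<open>f\<close> has no
    zeros on some ball of the family that contains \<open>x\<close>, so the functional chosen for
    that ball does not vanish at \<open>x\<close> either.\<close>
  define g :: "nat \<Rightarrow> nat \<Rightarrow> 'a \<Rightarrow>\<^sub>L real" where
    "g k m = (SOME f. \<forall>x\<in>ball (d k) (1 / Suc m). blinfun_apply f x \<noteq> 0)" for k m
  define F where "F n = case_prod g (prod_decode n)" for n
  have "\<exists>m. blinfun_apply (F m) x \<noteq> 0" if f: "blinfun_apply f x \<noteq> 0" for f :: "'a \<Rightarrow>\<^sub>L real" and x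
  proof -
    have "open (blinfun_apply f -` (- {0}))"
      by (intro open_vimage linear_continuous_on blinfun.bounded_linear_right) auto
    then obtain e where e: "e > 0" "ball x e \<subseteq> blinfun_apply f -` (- {0})"
      using f by (auto elim: openE)
    obtain m where m: "1 / Suc m < e / 2" using e(1) nat_approx_posE[of "e / 2"] by auto
    have "x \<in> closure D" using D(2) by simp
    then obtain z where z: "z \<in> D" "dist z x < 1 / Suc m"
      unfolding closure_approachable by (meson of_nat_0_less_iff zero_less_Suc zero_less_divide_1_iff)
    obtain k where k: "d k = z"
      using from_nat_into_surj[OF D(1) z(1)] by (auto simp: d_def)
    have "ball (d k) (1 / Suc m) \<subseteq> ball x e"
    proof
      fix t assume "t \<in> ball (d k) (1 / Suc m)"
      then have "dist z t < 1 / Suc m" using k by simp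
      then show "t \<in> ball x e" using z(2) m dist_triangle[of x t z] by (simp add: dist_commute)
    qed
    then have "\<forall>x\<in>ball (d k) (1 / Suc m). blinfun_apply f x \<noteq> 0" using e(2) by auto
    then have "\<forall>x\<in>ball (d k) (1 / Suc m). blinfun_apply (g k m) x \<noteq> 0"
      unfolding g_def by (rule someI)
    moreover have "x \<in> ball (d k) (1 / Suc m)" using z(2) k by simp
    ultimately have "blinfun_apply (F (prod_encode (k, m))) x \<noteq> 0" by (simp add: F_def)
    then show ?thesis by blast
  qed
  then show ?thesis by blast
qed

text \<open>Convergence is first arranged on countably many functionals that separate the points
  which any functional can separate. Two cluster vectors of the subsequence then agree on all
  functionals, and this forces convergence on each of them.\<close>

lemma weakly_convergent_subsequence:
  fixes u :: "nat \<Rightarrow> 'a::real_normed_vector"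
  assumes refl: "reflexive_space TYPE('a)" and sep: "separable_space (euclidean :: 'a topology)"
    and bdd: "bounded (range u)"
  obtains r v where "strict_mono r" "weakly_converges (u \<circ> r) v"
proof -
  obtain M where M: "\<And>n. norm (u n) \<le> M" using bdd by (auto simp: bounded_iff)
  obtain F :: "nat \<Rightarrow> 'a \<Rightarrow>\<^sub>L real" where F: "\<forall>x. (\<forall>m. blinfun_apply (F m) x = 0) \<longrightarrow> (\<forall>f :: 'a \<Rightarrow>\<^sub>L real. blinfun_apply f x = 0)"
    using countable_common_kernel[OF sep] by blast
  let ?X = "\<lambda>n m. blinfun_apply (F m) (u n)"
  have "\<forall>n. ?X n \<in> {x. \<forall>m. x m \<in> {- (M * norm (F m))..M * norm (F m)}}"
    using norm_blinfun_apply_le[OF M] by (auto simp: abs_le_iff minus_le_iff)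
  \<comment> \<open>Sequential compactness of a countable product of intervals stands in for a
    diagonal argument.\<close>
  then obtain l r where r: "strict_mono r" "(?X \<circ> r) \<longlonglongrightarrow> l"
    using seq_compactE[OF compact_imp_seq_compact[OF compact_box[of "\<lambda>m. - (M * norm (F m))" "\<lambda>m. M * norm (F m)"]], of ?X]
    by blast
  have Fl: "(\<lambda>n. blinfun_apply (F m) (u (r n))) \<longlonglongrightarrow> l m" for m
    using continuous_on_tendsto_compose[OF continuous_on_coordinate[of UNIV m] r(2)] by (simp add: o_def)
  obtain v where "\<forall>(f :: 'a \<Rightarrow>\<^sub>L real) c. (\<lambda>n. blinfun_apply f (u (r n))) \<longlonglongrightarrow> c \<longrightarrow> blinfun_apply f v = c"
    using reflexive_cluster_point[OF refl, of "\<lambda>n. u (r n)" M] M by auto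
  note v = this[rule_format]
  have "(\<lambda>n. blinfun_apply f (u (r n))) \<longlonglongrightarrow> blinfun_apply f v" for f :: "'a \<Rightarrow>\<^sub>L real"
  \<comment> \<open>If the values of \<open>f\<close> stayed away from \<open>f v\<close> along a
    subsequence, a further subsequence would make them converge to some \<open>c\<close>. Its
    cluster vector \<open>v'\<close> agrees with \<open>v\<close> on every \<open>F m\<close>, hence
    on \<open>f\<close>, so \<open>c\<close> would be \<open>f v\<close>.\<close>
  proof (rule ccontr)
    assume "\<not> ?thesis"
    then obtain e and s :: "nat \<Rightarrow> nat" where es: "e > 0" "strict_mono s"
      "\<And>n. \<bar>blinfun_apply f (u (r (s n))) - blinfun_apply f v\<bar> \<ge> e"
      by (rule not_tendsto_subsequence) blast
    obtain q and c :: real where q: "strict_mono q" "((\<lambda>n. blinfun_apply f (u (r (s n)))) \<circ> q) \<longlonglongrightarrow> c"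
      by (rule bounded_real_convergent_subsequence[of "\<lambda>n. blinfun_apply f (u (r (s n)))" "M * norm f",
            OF norm_blinfun_apply_le[OF M]])
    obtain v' where "\<forall>(f :: 'a \<Rightarrow>\<^sub>L real) c. (\<lambda>n. blinfun_apply f (u (r (s (q n))))) \<longlonglongrightarrow> c \<longrightarrow> blinfun_apply f v' = c"
      using reflexive_cluster_point[OF refl, of "\<lambda>n. u (r (s (q n)))" M] M by auto
    note v' = this[rule_format]
    have "blinfun_apply (F m) (v - v') = 0" for m
    proof -
      have "((\<lambda>n. blinfun_apply (F m) (u (r n))) \<circ> (s \<circ> q)) \<longlonglongrightarrow> l m"
        by (intro LIMSEQ_subseq_LIMSEQ Fl strict_mono_o es q)
      then show ?thesis using v[OF Fl] v' by (simp add: blinfun.diff_right o_def)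
    qed
    then have "blinfun_apply f v = blinfun_apply f v'" using F by (metis blinfun.diff_right right_minus_eq)
    also have "\<dots> = c" using v' q(2) by (simp add: o_def)
    finally have fv: "blinfun_apply f v = c" .
    have "(\<lambda>n. \<bar>blinfun_apply f (u (r (s (q n)))) - blinfun_apply f v\<bar>) \<longlonglongrightarrow> \<bar>c - blinfun_apply f v\<bar>"
      using q(2) by (intro tendsto_rabs tendsto_diff tendsto_const) (simp add: o_def)
    then have "e \<le> \<bar>c - blinfun_apply f v\<bar>" by (rule LIMSEQ_le_const) (use es(3) in blast)
    then show False using es(1) fv by simp
  qed
  then have "weakly_converges (u \<circ> r) v" by (simp add: weakly_converges_def)
  with r(1) show ?thesis by (rule that)
qed

section \<open>Limits of approximate zeros\<close>

lemma Limsup_ereal_nonpos: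
  fixes a :: "nat \<Rightarrow> real"
  assumes "\<And>e. e > 0 \<Longrightarrow> \<forall>\<^sub>F n in sequentially. a n \<le> e"
  shows "limsup (\<lambda>n. ereal (a n)) \<le> 0"
proof (rule ereal_le_epsilon2)
  fix e :: real assume "e > 0"
  have "limsup (\<lambda>n. ereal (a n)) \<le> ereal e"
    by (rule Limsup_bounded) (use assms[OF \<open>e > 0\<close>] in simp)
  then show "limsup (\<lambda>n. ereal (a n)) \<le> 0 + ereal e" by simp
qed

text \<open>The pairing with \<open>u n\<close> is only assumed nonpositive, because zeros of
  \<open>stab_map\<close> yield no more than a sign. The pairing with a fixed \<open>y k\<close>
  vanishes only eventually, once the rank exceeds \<open>k\<close>.\<close>

lemma approximate_zeros_converge:
  fixes i :: "'y::real_normed_vector \<Rightarrow> 'x::real_normed_vector" and y :: "nat \<Rightarrow> 'y"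
  assumes refl: "reflexive_space TYPE('y)" and sep: "separable_space (euclidean :: 'y topology)"
    and i: "bounded_linear i"
    and dense: "\<And>x e. e > 0 \<Longrightarrow> \<exists>m c. dist (lincomb y m c) x < e"
    and \<Omega>: "bounded \<Omega>" and hom: "admissible_homotopy \<Omega> i H"
    and s: "\<And>n. s n \<in> {0..1}" and u: "\<And>n. u n \<in> closure \<Omega>"
    and nonpos: "\<And>n. blinfun_apply (H (s n) (u n)) (i (u n)) \<le> 0"
    and zero: "\<And>k. \<forall>\<^sub>F n in sequentially. blinfun_apply (H (s n) (u n)) (i (y k)) = 0"
  obtains r t v where "strict_mono r" "t \<in> {0..1}" "v \<in> closure \<Omega>" "(u \<circ> r) \<longlonglongrightarrow> v" "H t v = 0"
proof -
  interpret i: bounded_linear i by (rule i)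
  obtain K where K: "K > 0" "\<And>x. norm (i x) \<le> norm x * K" using i.pos_bounded by blast
  obtain C where C: "C > 0" "\<And>t u. t \<in> {0..1} \<Longrightarrow> u \<in> closure \<Omega> \<Longrightarrow> norm (H t u) \<le> C"
  proof -
    have "bounded {H t u |t u. t \<in> {0..1} \<and> u \<in> closure \<Omega>}" using hom by (simp add: admissible_homotopy_def)
    then show ?thesis using that unfolding bounded_pos by blast
  qed
  have HiC: "\<bar>blinfun_apply (H t u) (i x)\<bar> \<le> C * K * norm x" if "t \<in> {0..1}" "u \<in> closure \<Omega>" for t u x
  proof -
    have "\<bar>blinfun_apply (H t u) (i x)\<bar> \<le> norm (H t u) * norm (i x)" using norm_blinfun[of "H t u"] by simp
    also have "\<dots> \<le> C * (norm x * K)" by (intro mult_mono C(2) that K(2)) (use C(1) in auto)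
    finally show ?thesis by (simp add: ac_simps)
  qed
  obtain r1 t where r1: "strict_mono r1" "t \<in> {0..1}" "(s \<circ> r1) \<longlonglongrightarrow> t"
    using seq_compactE[of "{0..1::real}" s] compact_imp_seq_compact[OF compact_Icc] s by metis
  have "bounded (range (u \<circ> r1))"
    using bounded_closure[OF \<Omega>] u by (auto intro: bounded_subset)
  then obtain r2 v where r2: "strict_mono r2" "weakly_converges (u \<circ> r1 \<circ> r2) v"
    using weakly_convergent_subsequence[OF refl sep] by blast
  define r where "r = r1 \<circ> r2"
  have r: "strict_mono r" unfolding r_def by (intro strict_mono_o r1 r2)
  have sr: "(s \<circ> r) \<longlonglongrightarrow> t" unfolding r_def using LIMSEQ_subseq_LIMSEQ[OF r1(3) r2(1)] by (simp add: o_assoc)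
  have ur: "weakly_converges (u \<circ> r) v" using r2(2) by (simp add: r_def o_assoc)
  define h where "h = (\<lambda>n. H (s (r n)) (u (r n)))"
  have zero_lin: "\<forall>\<^sub>F n in sequentially. blinfun_apply (h n) (i (lincomb y m c)) = 0" for m c
  proof -
    have "\<forall>\<^sub>F n in sequentially. blinfun_apply (h n) (i (y k)) = 0" for k
      unfolding h_def using eventually_subseq[OF r zero] .
    then have "\<forall>\<^sub>F n in sequentially. \<forall>k\<in>{..<m}. blinfun_apply (h n) (i (y k)) = 0"
      by (intro eventually_ball_finite) auto
    then show ?thesis
      by eventually_elim (simp add: lincomb_def i.sum i.scaleR blinfun.sum_right blinfun.scaleR_right)
  qed
  have bound: "\<bar>blinfun_apply (h n) (i x)\<bar> \<le> C * K * norm x" for n x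
    unfolding h_def by (intro HiC s u)
  have CK: "C * K > 0" using C(1) K(1) by simp
  \<comment> \<open>The uniform bound on the homotopy extends the eventual vanishing from the dense
    span to eventual smallness at every vector.\<close>
  have small: "\<forall>\<^sub>F n in sequentially. \<bar>blinfun_apply (h n) (i x)\<bar> \<le> e" if "e > 0" for x e
  proof -
    have "e / (C * K) > 0" using that CK by simp
    then obtain m c where mc: "dist (lincomb y m c) x < e / (C * K)" using dense by blast
    show ?thesis using zero_lin[of m c]
    proof eventually_elim
      case (elim n)
      have "blinfun_apply (h n) (i x) = blinfun_apply (h n) (i (x - lincomb y m c))"
        using elim by (simp add: i.diff blinfun.diff_right)
      then have "\<bar>blinfun_apply (h n) (i x)\<bar> \<le> C * K * norm (x - lincomb y m c)" using bound by simp
      also have "\<dots> \<le> C * K * (e / (C * K))"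
        using mc CK by (intro mult_left_mono) (auto simp: dist_norm norm_minus_commute)
      finally show ?case using C(1) K(1) by simp
    qed
  qed
  \<comment> \<open>The pairing with the difference splits into the pairing with the sequence, which
    is nonpositive, and the one with the fixed \<open>v\<close>, which becomes small.\<close>
  have "limsup (\<lambda>n. ereal (blinfun_apply (H ((s \<circ> r) n) ((u \<circ> r) n)) (i ((u \<circ> r) n - v)))) \<le> 0"
  proof (rule Limsup_ereal_nonpos)
    fix e :: real assume "e > 0"
    show "\<forall>\<^sub>F n in sequentially. blinfun_apply (H ((s \<circ> r) n) ((u \<circ> r) n)) (i ((u \<circ> r) n - v)) \<le> e"
      using small[OF \<open>e > 0\<close>, of v]
    proof eventually_elim
      case (elim n)
      then show ?case using nonpos[of "r n"] by (simp add: h_def i.diff blinfun.diff_right)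
    qed
  qed
  moreover have "\<forall>n. (s \<circ> r) n \<in> {0..1}" "\<forall>n. (u \<circ> r) n \<in> closure \<Omega>" using s u by auto
  ultimately have lim: "(u \<circ> r) \<longlonglongrightarrow> v"
    using hom r1(2) sr ur unfolding admissible_homotopy_def by blast
  \<comment> \<open>A weak limit may leave \<open>closure \<Omega>\<close>. Strong convergence puts
    \<open>v\<close> there, where demi-continuity and condition \<open>(H)\<close> can be
    applied.\<close>
  have v: "v \<in> closure \<Omega>" using closed_sequentially[OF closed_closure _ lim] u by auto
  have "blinfun_apply (H t v) (i x) = 0" for x
  proof -
    have "(\<lambda>n. blinfun_apply (H ((s \<circ> r) n) ((u \<circ> r) n)) (i x)) \<longlonglongrightarrow> blinfun_apply (H t v) (i x)"
      using hom r1(2) sr lim v \<open>\<forall>n. (s \<circ> r) n \<in> {0..1}\<close> \<open>\<forall>n. (u \<circ> r) n \<in> closure \<Omega>\<close>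
      unfolding admissible_homotopy_def by blast
    moreover have "(\<lambda>n. blinfun_apply (H ((s \<circ> r) n) ((u \<circ> r) n)) (i x)) \<longlonglongrightarrow> 0"
    proof (rule LIMSEQ_I)
      fix e :: real assume "e > 0"
      then have "\<forall>\<^sub>F n in sequentially. \<bar>blinfun_apply (h n) (i x)\<bar> \<le> e / 2" by (intro small) auto
      then show "\<exists>N. \<forall>n\<ge>N. norm (blinfun_apply (H ((s \<circ> r) n) ((u \<circ> r) n)) (i x) - 0) < e"
        using \<open>e > 0\<close> unfolding eventually_sequentially h_def by fastforce
    qed
    ultimately show ?thesis by (rule LIMSEQ_unique)
  qed
  moreover have "condition_H_on (closure \<Omega>) i (H t)" using hom r1(2) by (simp add: admissible_homotopy_def)
  ultimately have "H t v = 0" using v by (intro blinfun_eqI) (simp add: condition_H_on_def)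
  with r r1(2) v lim show ?thesis by (rule that)
qed

section \<open>The index\<close>

text \<open>By injectivity of \<open>j\<close>, a vanishing combination is an expansion of
  \<open>0\<close> in the basis, and the expansion of \<open>0\<close> is unique.\<close>

lemma schauder_lin_indep:
  assumes "schauder_basis h" "embedding j"
  shows "lin_indep_seq (\<lambda>k. j (h k))"
  unfolding lin_indep_seq_def
proof (intro allI ballI impI)
  fix n c assume c: "c \<in> Rn n" and zero: "lincomb (\<lambda>k. j (h k)) n c = 0"
  interpret j: bounded_linear j using assms(2) by (simp add: embedding_def)
  have "j (lincomb h n c) = j 0" using zero by (simp add: lincomb_def j.sum j.scaleR j.zero)
  then have "lincomb h n c = 0" using assms(2) unfolding embedding_def by (blast dest: injD)
  moreover have "(\<lambda>k. c k *\<^sub>R h k) sums (\<Sum>k<n. c k *\<^sub>R h k)"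
    by (rule sums_finite) (use c in \<open>auto simp: topspace_Euclidean_space\<close>)
  ultimately have sums_c: "(\<lambda>k. c k *\<^sub>R h k) sums 0" by (simp add: lincomb_def)
  have sums_0: "(\<lambda>k. (\<lambda>_. 0) k *\<^sub>R h k) sums 0" by simp
  have "\<exists>!c. (\<lambda>k. c k *\<^sub>R h k) sums 0" using assms(1) by (simp add: schauder_basis_def)
  then obtain c0 where c0: "\<forall>c. (\<lambda>k. c k *\<^sub>R h k) sums 0 \<longrightarrow> c = c0" by (elim ex1E) blast
  show "c = (\<lambda>_. 0)"
    by (rule trans[OF c0[rule_format, OF sums_c] c0[rule_format, OF sums_0, symmetric]])
qed

text \<open>The range of \<open>j\<close> is dense, and \<open>j\<close> maps the partial sums of a
  basis expansion to linear combinations that converge in the target space.\<close>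

lemma schauder_span_dense:
  assumes "schauder_basis h" "dense_compact_embedding j" "e > 0"
  shows "\<exists>m c. dist (lincomb (\<lambda>k. j (h k)) m c) x < e"
proof -
  interpret j: bounded_linear j using assms(2) by (simp add: dense_compact_embedding_def embedding_def)
  have "x \<in> closure (range j)" using assms(2) by (simp add: dense_compact_embedding_def)
  then have "\<exists>z\<in>range j. dist z x < e / 2"
    by (rule closure_approachable[THEN iffD1, rule_format]) (use assms(3) in simp)
  then obtain w where w: "dist (j w) x < e / 2" by blast
  obtain c where "(\<lambda>k. c k *\<^sub>R h k) sums w" using assms(1) unfolding schauder_basis_def by blast
  then have "(\<lambda>m. j (\<Sum>k<m. c k *\<^sub>R h k)) \<longlonglongrightarrow> j w"
    unfolding sums_def by (rule j.tendsto)
  then have "(\<lambda>m. lincomb (\<lambda>k. j (h k)) m c) \<longlonglongrightarrow> j w"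
    by (simp add: lincomb_def j.sum j.scaleR)
  then obtain m where "dist (lincomb (\<lambda>k. j (h k)) m c) (j w) < e / 2"
    using assms(3) metric_LIMSEQ_D[of _ "j w" "e / 2"] by (meson half_gt_zero order_refl)
  then have "dist (lincomb (\<lambda>k. j (h k)) m c) x < e"
    using w dist_triangle[of "lincomb (\<lambda>k. j (h k)) m c" x "j w"] by linarith
  then show ?thesis by blast
qed

section \<open>Elementary properties of admissible homotopies\<close>

lemma admissible_homotopy_demicontinuous:
  assumes "admissible_homotopy \<Omega> i H" "\<And>n. s n \<in> {0..1}" "t \<in> {0..1}" "s \<longlonglongrightarrow> t"
    and "\<And>n. u n \<in> closure \<Omega>" "v \<in> closure \<Omega>" "u \<longlonglongrightarrow> v"
  shows "(\<lambda>n. blinfun_apply (H (s n) (u n)) (i x)) \<longlonglongrightarrow> blinfun_apply (H t v) (i x)"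
proof -
  have "(\<forall>n. s n \<in> {0..1}) \<and> t \<in> {0..1} \<and> s \<longlonglongrightarrow> t \<and>
      (\<forall>n. u n \<in> closure \<Omega>) \<and> v \<in> closure \<Omega> \<and> u \<longlonglongrightarrow> v"
    using assms by blast
  then show ?thesis using assms(1) unfolding admissible_homotopy_def by blast
qed

lemma admissible_homotopy_S_plus:
  assumes "admissible_homotopy \<Omega> i H" "\<And>n. s n \<in> {0..1}" "t \<in> {0..1}" "s \<longlonglongrightarrow> t"
    and "\<And>n. u n \<in> closure \<Omega>" "weakly_converges u v"
    and "limsup (\<lambda>n. ereal (blinfun_apply (H (s n) (u n)) (i (u n - v)))) \<le> 0"
  shows "u \<longlonglongrightarrow> v"
proof -
  have "(\<forall>n. s n \<in> {0..1}) \<and> t \<in> {0..1} \<and> s \<longlonglongrightarrow> t \<and>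
      (\<forall>n. u n \<in> closure \<Omega>) \<and> weakly_converges u v \<and>
      limsup (\<lambda>n. ereal (blinfun_apply (H (s n) (u n)) (i (u n - v)))) \<le> 0"
    using assms by blast
  then show ?thesis using assms(1) unfolding admissible_homotopy_def by blast
qed

text \<open>Single maps are treated as constant homotopies, so that each compactness statement is
  proved once.\<close>

lemma admissible_homotopy_const:
  assumes "admissible_homotopy \<Omega> i H" "s \<in> {0..1}"
  shows "admissible_homotopy \<Omega> i (\<lambda>_. H s)"
  unfolding admissible_homotopy_def
proof (intro conjI)
  show "bounded {H s u |t u. t \<in> {0..1::real} \<and> u \<in> closure \<Omega>}"
  proof (rule bounded_subset)
    show "bounded {H t u |t u. t \<in> {0..1} \<and> u \<in> closure \<Omega>}"
      using assms(1) by (simp add: admissible_homotopy_def)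
  qed (use assms(2) in blast)
  show "\<forall>sa t u v. (\<forall>n. sa n \<in> {0..1::real}) \<and> t \<in> {0..1} \<and> sa \<longlonglongrightarrow> t \<and>
      (\<forall>n. u n \<in> closure \<Omega>) \<and> v \<in> closure \<Omega> \<and> u \<longlonglongrightarrow> v \<longrightarrow>
      (\<forall>y. (\<lambda>n. blinfun_apply (H s (u n)) (i y)) \<longlonglongrightarrow> blinfun_apply (H s v) (i y))"
  proof (intro allI impI; elim conjE)
    fix u v y assume u: "\<forall>n. u n \<in> closure \<Omega>" "v \<in> closure \<Omega>" "u \<longlonglongrightarrow> v"
    show "(\<lambda>n. blinfun_apply (H s (u n)) (i y)) \<longlonglongrightarrow> blinfun_apply (H s v) (i y)"
      using admissible_homotopy_demicontinuous[OF assms(1), of "\<lambda>_. s" s u v] u assms(2) by simp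
  qed
  show "\<forall>sa t u v. (\<forall>n. sa n \<in> {0..1::real}) \<and> t \<in> {0..1} \<and> sa \<longlonglongrightarrow> t \<and>
      (\<forall>n. u n \<in> closure \<Omega>) \<and> weakly_converges u v \<and>
      limsup (\<lambda>n. ereal (blinfun_apply (H s (u n)) (i (u n - v)))) \<le> 0 \<longrightarrow> u \<longlonglongrightarrow> v"
  proof (intro allI impI; elim conjE)
    fix u v assume u: "\<forall>n. u n \<in> closure \<Omega>" "weakly_converges u v"
      "limsup (\<lambda>n. ereal (blinfun_apply (H s (u n)) (i (u n - v)))) \<le> 0"
    show "u \<longlonglongrightarrow> v"
      using admissible_homotopy_S_plus[OF assms(1), of "\<lambda>_. s" s u v] u assms(2) by simp
  qed
qed (use assms in \<open>auto simp: admissible_homotopy_def\<close>)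

lemma admissible_homotopy_subset:
  assumes hom: "admissible_homotopy \<Omega> i H" and cl: "closure \<Omega>' \<subseteq> closure \<Omega>" and fr: "frontier \<Omega>' \<subseteq> frontier \<Omega>"
  shows "admissible_homotopy \<Omega>' i H"
proof -
  have mem: "u \<in> closure \<Omega>" if "u \<in> closure \<Omega>'" for u using cl that by blast
  have "bounded {H t u |t u. t \<in> {0..1} \<and> u \<in> closure \<Omega>'}"
    by (rule bounded_subset[of "{H t u |t u. t \<in> {0..1} \<and> u \<in> closure \<Omega>}"])
      (use hom mem in \<open>auto simp: admissible_homotopy_def\<close>)
  moreover have "\<forall>t\<in>{0..1}. condition_H_on (closure \<Omega>') i (H t)"
    using hom mem by (simp add: admissible_homotopy_def condition_H_on_def)
  moreover have "\<forall>t\<in>{0..1}. \<forall>u\<in>frontier \<Omega>'. H t u \<noteq> 0"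
    using hom fr unfolding admissible_homotopy_def by blast
  ultimately show ?thesis
    using hom mem unfolding admissible_homotopy_def by (elim conjE, intro conjI) (assumption | blast)+
qed

lemma admissible_homotopy_map:
  assumes "bounded (A ` closure \<Omega>)" "demicontinuous_on (closure \<Omega>) i A"
    "S_plus_on (closure \<Omega>) i A" "condition_H_on (closure \<Omega>) i A"
    "\<And>u. u \<in> frontier \<Omega> \<Longrightarrow> A u \<noteq> 0"
  shows "admissible_homotopy \<Omega> i (\<lambda>_. A)"
proof -
  have "bounded {A u |t u. t \<in> {0..1::real} \<and> u \<in> closure \<Omega>}"
    by (rule bounded_subset[OF assms(1)]) auto
  then show ?thesis
    using assms unfolding admissible_homotopy_def demicontinuous_on_def S_plus_on_def by simp
qed

text \<open>For \<open>s\<close> from \<open>0\<close> to \<open>1\<close> this connects the approximation of rank \<open>n + 1\<close> with the suspension of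
  the approximation of rank \<open>n\<close>.\<close>

definition stab_map ::
  "('y \<Rightarrow> 'x) \<Rightarrow> (nat \<Rightarrow> 'y) \<Rightarrow> ('y::real_normed_vector \<Rightarrow> 'x::real_normed_vector \<Rightarrow>\<^sub>L real) \<Rightarrow>
    nat \<Rightarrow> real \<Rightarrow> (nat \<Rightarrow> real) \<Rightarrow> nat \<Rightarrow> real" where
  "stab_map i y A n s c k =
    (if k < n then blinfun_apply (A (lincomb y (Suc n) c)) (i (y k))
     else if k = n then (1 - s) * blinfun_apply (A (lincomb y (Suc n) c)) (i (y n)) + s * c n
     else 0)"

lemma stab_map_0: "stab_map i y A n 0 = coord_map i y A (Suc n)"
  by (auto simp: stab_map_def coord_map_def fun_eq_iff less_Suc_eq)

lemma stab_map_Rn: "stab_map i y A n s c \<in> Rn (Suc n)"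
  by (simp add: stab_map_def topspace_Euclidean_space)

text \<open>The basis and the embedding \<open>j\<close> are represented here by two consequences,
  linear independence of the vectors \<open>y k\<close> and density of their span.\<close>

locale galerkin =
  fixes i :: "'y::real_normed_vector \<Rightarrow> 'x::real_normed_vector" and y :: "nat \<Rightarrow> 'y"
  assumes refl: "reflexive_space TYPE('y)" and sep: "separable_space (euclidean :: 'y topology)"
    and lin: "bounded_linear i" and indep: "lin_indep_seq y"
    and dense: "\<And>x e. e > 0 \<Longrightarrow> \<exists>m c. dist (lincomb y m c) x < e"
begin

sublocale i: bounded_linear i by (rule lin)

text \<open>The parameter \<open>t\<close> belongs to the homotopy of maps and \<open>s\<close> to
  the change of rank. Zeros on the frontier for arbitrarily large \<open>n\<close> would have a
  limit that is a zero of some stage and still lies on the frontier.\<close>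

lemma eventually_stab_map_nonzero:
  assumes \<Omega>: "bounded \<Omega>" and hom: "admissible_homotopy \<Omega> i H"
  shows "\<forall>\<^sub>F n in sequentially. \<forall>t\<in>{0..1}. \<forall>s\<in>{0..1}. \<forall>c\<in>coord_dom y (Suc n) (frontier \<Omega>).
    stab_map i y (H t) n s c \<noteq> (\<lambda>_. 0)"
proof (rule ccontr)
  assume "\<not> ?thesis"
  then have "\<forall>N. \<exists>n\<ge>N. \<exists>t\<in>{0..1}. \<exists>s\<in>{0..1}. \<exists>c\<in>coord_dom y (Suc n) (frontier \<Omega>).
    stab_map i y (H t) n s c = (\<lambda>_. 0)"
    unfolding eventually_sequentially by blast
  then obtain n t s c where n: "\<And>N. n N \<ge> N" and ts: "\<And>N. t N \<in> {0..1}" "\<And>N. s N \<in> {0..1}"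
    and c: "\<And>N. c N \<in> coord_dom y (Suc (n N)) (frontier \<Omega>)"
    and 0: "\<And>N. stab_map i y (H (t N)) (n N) (s N) (c N) = (\<lambda>_. 0)"
    by metis
  define u where "u N = lincomb y (Suc (n N)) (c N)" for N
  have uf: "u N \<in> frontier \<Omega>" for N using c[of N] by (simp add: u_def coord_dom_def)
  have eq0: "blinfun_apply (H (t N) (u N)) (i (y k)) = 0" if "k < n N" for N k
    using fun_cong[OF 0[of N], of k] that by (simp add: stab_map_def u_def)
  have eqn: "(1 - s N) * blinfun_apply (H (t N) (u N)) (i (y (n N))) + s N * c N (n N) = 0" for N
    using fun_cong[OF 0[of N], of "n N"] by (simp add: stab_map_def u_def)
  \<comment> \<open>Only the last term survives in the pairing with \<open>u N\<close>, namely
    \<open>?q * ?p\<close>. The last equation gives \<open>(1 - s N) * ?p = - (s N * ?q)\<close>;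
    multiplying by \<open>?q\<close> shows the sign, and for \<open>s N = 1\<close> it says
    \<open>?q = 0\<close>.\<close>
  have nonpos: "blinfun_apply (H (t N) (u N)) (i (u N)) \<le> 0" for N
  proof -
    let ?p = "blinfun_apply (H (t N) (u N)) (i (y (n N)))" and ?q = "c N (n N)"
    have "blinfun_apply (H (t N) (u N)) (i (u N)) = (\<Sum>k<Suc (n N). c N k * blinfun_apply (H (t N) (u N)) (i (y k)))"
      unfolding u_def lincomb_def by (simp only: i.sum i.scaleR blinfun.sum_right blinfun.scaleR_right real_scaleR_def)
    also have "\<dots> = ?q * ?p" using eq0 by simp
    also have "\<dots> \<le> 0"
    proof (cases "s N = 1")
      case True
      then show ?thesis using eqn[of N] by simp
    next
      case False
      then have pos: "1 - s N > 0" "s N \<ge> 0" using ts(2)[of N] by auto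
      have "(1 - s N) * (?q * ?p) = ?q * ((1 - s N) * ?p)" by simp
      also have "(1 - s N) * ?p = - (s N * ?q)" using eqn[of N] by linarith
      also have "?q * - (s N * ?q) = - (s N * (?q * ?q))" by simp
      also have "\<dots> \<le> 0" using pos(2) by simp
      finally show ?thesis using pos(1) by (simp add: mult_le_0_iff)
    qed
    finally show ?thesis .
  qed
  have zero: "\<forall>\<^sub>F N in sequentially. blinfun_apply (H (t N) (u N)) (i (y k)) = 0" for k
    using eventually_gt_at_top[of k] by eventually_elim (use n eq0 less_le_trans in blast)
  have ucl: "u N \<in> closure \<Omega>" for N using uf by (simp add: frontier_def)
  obtain r t' v where r: "t' \<in> {0..1}" "(u \<circ> r) \<longlonglongrightarrow> v" "H t' v = 0"
    using approximate_zeros_converge[OF refl sep lin dense \<Omega> hom ts(1) ucl nonpos zero] by blast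
  have "v \<in> frontier \<Omega>" using closed_sequentially[OF frontier_closed _ r(2)] uf by simp
  then show False using hom r(1,3) by (auto simp: admissible_homotopy_def)
qed

text \<open>Stage \<open>s = 0\<close> of \<open>stab_map\<close> at \<open>n\<close> is the
  approximation of rank \<open>n + 1\<close>; the shift of the index does not matter for large
  \<open>n\<close>.\<close>

lemma eventually_coord_map_nonzero:
  assumes "bounded \<Omega>" "admissible_homotopy \<Omega> i H"
  shows "\<forall>\<^sub>F n in sequentially. \<forall>t\<in>{0..1}. \<forall>c\<in>coord_dom y n (frontier \<Omega>). coord_map i y (H t) n c \<noteq> (\<lambda>_. 0)"
proof (subst eventually_sequentially_Suc[symmetric])
  show "\<forall>\<^sub>F n in sequentially. \<forall>t\<in>{0..1}. \<forall>c\<in>coord_dom y (Suc n) (frontier \<Omega>). coord_map i y (H t) (Suc n) c \<noteq> (\<lambda>_. 0)"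
    using eventually_stab_map_nonzero[OF assms]
  proof eventually_elim
    case (elim n)
    then show ?case using stab_map_0[of i y _ n] by (metis atLeastAtMost_iff order_refl zero_le_one)
  qed
qed

text \<open>Demi-continuity becomes joint continuity in finite rank, since convergence of
  coefficients is convergence of the combinations in norm and every coordinate is a pairing with a
  fixed vector.\<close>

lemma continuous_on_pairing:
  assumes "admissible_homotopy \<Omega> i H"
  shows "continuous_on ({0..1} \<times> coord_dom y m (closure \<Omega>)) (\<lambda>z. blinfun_apply (H (fst z) (lincomb y m (snd z))) (i x))"
  unfolding continuous_on_sequentially
proof (intro allI ballI impI; elim conjE)
  fix z :: "nat \<Rightarrow> real \<times> (nat \<Rightarrow> real)" and a
  assume a: "a \<in> {0..1} \<times> coord_dom y m (closure \<Omega>)"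
    and z: "\<forall>n. z n \<in> {0..1} \<times> coord_dom y m (closure \<Omega>)" "z \<longlonglongrightarrow> a"
  have "(\<lambda>n. fst (z n)) \<longlonglongrightarrow> fst a" using z(2) by (rule tendsto_fst)
  moreover have "(\<lambda>n. lincomb y m (snd (z n))) \<longlonglongrightarrow> lincomb y m (snd a)"
    using continuous_on_tendsto_compose[OF continuous_on_lincomb[of UNIV] tendsto_snd[OF z(2)]] by simp
  moreover have "\<forall>n. fst (z n) \<in> {0..1}" "fst a \<in> {0..1}" "\<forall>n. lincomb y m (snd (z n)) \<in> closure \<Omega>"
    "lincomb y m (snd a) \<in> closure \<Omega>"
    using a z(1) by (auto simp: coord_dom_def mem_Times_iff)
  ultimately have "(\<lambda>n. blinfun_apply (H (fst (z n)) (lincomb y m (snd (z n)))) (i x))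
      \<longlonglongrightarrow> blinfun_apply (H (fst a) (lincomb y m (snd a))) (i x)"
    by (intro admissible_homotopy_demicontinuous[OF assms]) auto
  then show "((\<lambda>z. blinfun_apply (H (fst z) (lincomb y m (snd z))) (i x)) \<circ> z)
      \<longlonglongrightarrow> blinfun_apply (H (fst a) (lincomb y m (snd a))) (i x)"
    by (simp add: o_def)
qed

lemma coord_map_homotopy:
  assumes \<Omega>: "open \<Omega>" "bounded \<Omega>" and hom: "admissible_homotopy \<Omega> i H" and t: "t \<in> {0..1}"
    and nz: "\<And>t c. t \<in> {0..1} \<Longrightarrow> c \<in> coord_dom y n (frontier \<Omega>) \<Longrightarrow> coord_map i y (H t) n c \<noteq> (\<lambda>_. 0)"
  shows "\<exists>L. degree_admissible n (coord_map i y (H 0) n) (coord_dom y n \<Omega>) L"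
    and "approx_degree i y (H 0) \<Omega> n = approx_degree i y (H t) \<Omega> n"
proof -
  let ?C = "coord_dom y n (closure \<Omega>)"
  \<comment> \<open>The interval is rescaled by \<open>t\<close>, so that the general lemma on
    stages \<open>0\<close> and \<open>1\<close> compares the stages \<open>0\<close> and
    \<open>t\<close>.\<close>
  have ts: "s * t \<in> {0..1}" if "s \<in> {0..1}" for s using that t by (auto intro: mult_le_one)
  have cont: "continuous_on ({0..1} \<times> ?C) (\<lambda>z. coord_map i y (H (fst z * t)) n (snd z))"
  proof (rule continuous_on_coordinatewise_then_product)
    fix k
    have "continuous_on ({0..1} \<times> ?C)
      ((\<lambda>z. blinfun_apply (H (fst z) (lincomb y n (snd z))) (i (y k))) \<circ> (\<lambda>z. (fst z * t, snd z)))"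
      by (rule continuous_on_compose, intro continuous_intros)
        (use ts in \<open>auto intro!: continuous_on_subset[OF continuous_on_pairing[OF hom]]\<close>)
    then show "continuous_on ({0..1} \<times> ?C) (\<lambda>z. coord_map i y (H (fst z * t)) n (snd z) k)"
      by (cases "k < n") (simp_all add: coord_map_def o_def)
  qed
  note h = coord_homotopy[where k = "\<lambda>s. coord_map i y (H (s * t)) n", OF indep \<Omega> cont coord_map_Rn nz[OF ts]]
  obtain L where "\<forall>s\<in>{0..1}. degree_admissible n (coord_map i y (H (s * t)) n) (coord_dom y n \<Omega>) L"
    using h(1) by blast
  from bspec[OF this, of 0] show "\<exists>L. degree_admissible n (coord_map i y (H 0) n) (coord_dom y n \<Omega>) L" by auto
  show "approx_degree i y (H 0) \<Omega> n = approx_degree i y (H t) \<Omega> n"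
    unfolding approx_degree_eq[OF indep] using h(2) by simp
qed

text \<open>At \<open>s = 1\<close> the last coordinate of \<open>stab_map\<close> is
  \<open>c n\<close>, which is what \<open>brouwer_degree_reduction\<close> requires; on
  \<open>Rn n\<close> the remaining coordinates are those of the approximation of rank
  \<open>n\<close>.\<close>

lemma approx_degree_Suc:
  assumes \<Omega>: "open \<Omega>" "bounded \<Omega>" and hom: "admissible_homotopy \<Omega> i (\<lambda>_. A)"
    and nz: "\<And>s c. s \<in> {0..1} \<Longrightarrow> c \<in> coord_dom y (Suc n) (frontier \<Omega>) \<Longrightarrow> stab_map i y A n s c \<noteq> (\<lambda>_. 0)"
    and nz': "\<And>c. c \<in> coord_dom y n (frontier \<Omega>) \<Longrightarrow> coord_map i y A n c \<noteq> (\<lambda>_. 0)"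
  shows "approx_degree i y A \<Omega> (Suc n) = approx_degree i y A \<Omega> n"
proof -
  let ?C = "{0..1} \<times> coord_dom y (Suc n) (closure \<Omega>)" and ?U = "coord_dom y (Suc n) \<Omega>"
  note pair = continuous_on_pairing[OF hom, of "Suc n"]
  have cont: "continuous_on ?C (\<lambda>z. stab_map i y A n (fst z) (snd z))"
  proof (rule continuous_on_coordinatewise_then_product)
    fix k
    consider "k < n" | "k = n" | "k > n" by linarith
    then show "continuous_on ?C (\<lambda>z. stab_map i y A n (fst z) (snd z) k)"
    proof cases
      case 2
      have "continuous_on ?C (\<lambda>z. (1 - fst z) * blinfun_apply (A (lincomb y (Suc n) (snd z))) (i (y n)) + fst z * snd z n)"
        by (intro continuous_on_add continuous_on_mult continuous_on_diff continuous_on_const continuous_on_fst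
            continuous_on_id pair continuous_on_snd_coordinate)
      then show ?thesis using 2 by (simp add: stab_map_def)
    qed (use pair in \<open>simp_all add: stab_map_def\<close>)
  qed
  note h = coord_homotopy[OF indep \<Omega> cont stab_map_Rn nz]
  obtain L where L: "\<forall>t\<in>{0..1}. degree_admissible (Suc n) (stab_map i y A n t) ?U L" using h(1) by blast
  have "approx_degree i y A \<Omega> (Suc n) = brouwer_degree (Suc n) (stab_map i y A n 1) ?U"
    unfolding approx_degree_eq[OF indep] stab_map_0[symmetric] by (rule h(2))
  also have "\<dots> = brouwer_degree n (stab_map i y A n 1) (?U \<inter> Rn n)"
    using L by (intro brouwer_degree_reduction[of _ _ _ L]) (auto simp: stab_map_def)
  also have "?U \<inter> Rn n = coord_dom y n \<Omega>"
    by (auto simp: coord_dom_def lincomb_Suc_Rn intro: subsetD[OF Rn_mono_Suc])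
  also have "brouwer_degree n (stab_map i y A n 1) (coord_dom y n \<Omega>) = brouwer_degree n (coord_map i y A n) (coord_dom y n \<Omega>)"
  proof -
    obtain M where "degree_admissible n (coord_map i y A n) (coord_dom y n \<Omega>) M"
      using coord_map_homotopy(1)[OF \<Omega> hom _ nz', of 0] by auto
    moreover have "coord_map i y A n c = stab_map i y A n 1 c" if "c \<in> coord_dom y n \<Omega>" for c
    proof -
      have "c \<in> Rn n" using that by (simp add: coord_dom_def)
      then have "c n = 0" "lincomb y (Suc n) c = lincomb y n c"
        using lincomb_Suc_Rn by (auto simp: topspace_Euclidean_space)
      then show ?thesis by (simp add: fun_eq_iff stab_map_def coord_map_def)
    qed
    ultimately show ?thesis by (rule brouwer_degree_cong[symmetric])
  qed
  finally show ?thesis by (simp add: approx_degree_eq[OF indep])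
qed

lemma eventually_approx_degree_eq_ind:
  assumes \<Omega>: "open \<Omega>" "bounded \<Omega>" and hom: "admissible_homotopy \<Omega> i (\<lambda>_. A)"
  shows "\<forall>\<^sub>F n in sequentially. approx_degree i y A \<Omega> n = ind i y A \<Omega>"
proof -
  have "\<forall>\<^sub>F n in sequentially. approx_degree i y A \<Omega> (Suc n) = approx_degree i y A \<Omega> n"
    using eventually_stab_map_nonzero[OF \<Omega>(2) hom] eventually_coord_map_nonzero[OF \<Omega>(2) hom]
  proof eventually_elim
    case (elim n)
    then show ?case by (intro approx_degree_Suc[OF \<Omega> hom]) (meson atLeastAtMost_iff order_refl zero_le_one)+
  qed
  then obtain N where N: "\<And>n. n \<ge> N \<Longrightarrow> approx_degree i y A \<Omega> (Suc n) = approx_degree i y A \<Omega> n"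
    unfolding eventually_sequentially by blast
  have const: "approx_degree i y A \<Omega> n = approx_degree i y A \<Omega> N" if "n \<ge> N" for n
    using that by (induction n rule: dec_induct) (auto simp: N)
  then have ev: "\<forall>\<^sub>F n in sequentially. approx_degree i y A \<Omega> n = approx_degree i y A \<Omega> N"
    unfolding eventually_sequentially by blast
  then have "ind i y A \<Omega> = approx_degree i y A \<Omega> N"
    unfolding ind_def by (intro limI tendsto_eventually)
  with ev show ?thesis by simp
qed

lemma ind_homotopy:
  assumes \<Omega>: "open \<Omega>" "bounded \<Omega>" and hom: "admissible_homotopy \<Omega> i H" and st: "s \<in> {0..1}" "t \<in> {0..1}"
  shows "ind i y (H s) \<Omega> = ind i y (H t) \<Omega>"
proof -
  have *: "ind i y (H 0) \<Omega> = ind i y (H t) \<Omega>" if t: "t \<in> {0..1}" for t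
  proof -
    have 0: "(0::real) \<in> {0..1}" by simp
    \<comment> \<open>The claim does not involve \<open>n\<close>; it is put under the quantifier so
      that a single large rank can be used at which all three facts hold.\<close>
    have "\<forall>\<^sub>F n in sequentially. ind i y (H 0) \<Omega> = ind i y (H t) \<Omega>"
      using eventually_coord_map_nonzero[OF \<Omega>(2) hom]
        eventually_approx_degree_eq_ind[OF \<Omega> admissible_homotopy_const[OF hom 0]]
        eventually_approx_degree_eq_ind[OF \<Omega> admissible_homotopy_const[OF hom t]]
    proof eventually_elim
      case (elim n)
      then show ?case using coord_map_homotopy(2)[OF \<Omega> hom t, of n] by simp
    qed
    then show ?thesis by simp
  qed
  show ?thesis using *[OF st(1)] *[OF st(2)] by simp
qed

text \<open>For large \<open>n\<close> the approximations have nonzero degree and hence zeros in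
  \<open>\<Omega>\<close>. At these the pairing of the value with the zero vanishes, so the
  compactness argument applies, and its limit cannot be on the frontier.\<close>

lemma ind_nonzero_imp_zero:
  assumes \<Omega>: "open \<Omega>" "bounded \<Omega>" and hom: "admissible_homotopy \<Omega> i (\<lambda>_. A)" and nz: "ind i y A \<Omega> \<noteq> 0"
  shows "\<exists>u\<in>\<Omega>. A u = 0"
proof -
  have "\<forall>\<^sub>F n in sequentially. \<exists>c\<in>coord_dom y n \<Omega>. coord_map i y A n c = (\<lambda>_. 0)"
    using eventually_approx_degree_eq_ind[OF \<Omega> hom] eventually_coord_map_nonzero[OF \<Omega>(2) hom]
  proof eventually_elim
    case (elim n)
    obtain L where L: "degree_admissible n (coord_map i y A n) (coord_dom y n \<Omega>) L"
      using coord_map_homotopy(1)[OF \<Omega> hom, of 0 n] elim(2) by auto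
    show ?case
    proof (rule ccontr)
      assume "\<not> ?case"
      then have "brouwer_degree n (coord_map i y A n) (coord_dom y n \<Omega>) = 0"
        using L by (intro brouwer_degree_no_zeros) (auto simp: degree_admissible_def)
      then show False using elim(1) nz by (simp add: approx_degree_eq[OF indep])
    qed
  qed
  then obtain N where "\<forall>n\<ge>N. \<exists>c\<in>coord_dom y n \<Omega>. coord_map i y A n c = (\<lambda>_. 0)"
    unfolding eventually_sequentially by blast
  then have "\<forall>n. \<exists>c. c \<in> coord_dom y (N + n) \<Omega> \<and> coord_map i y A (N + n) c = (\<lambda>_. 0)"
    by (metis le_add1)
  then obtain c where c: "\<And>n. c n \<in> coord_dom y (N + n) \<Omega>" "\<And>n. coord_map i y A (N + n) (c n) = (\<lambda>_. 0)"
    by metis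
  define u where "u n = lincomb y (N + n) (c n)" for n
  have ucl: "u n \<in> closure \<Omega>" for n using c(1)[of n] closure_subset by (auto simp: u_def coord_dom_def)
  have eq0: "blinfun_apply (A (u n)) (i (y k)) = 0" if "k < N + n" for n k
    using fun_cong[OF c(2)[of n], of k] that by (simp add: coord_map_def u_def)
  have "blinfun_apply (A (u n)) (i (u n)) = (\<Sum>k<N + n. c n k * blinfun_apply (A (u n)) (i (y k)))" for n
    unfolding u_def lincomb_def by (simp only: i.sum i.scaleR blinfun.sum_right blinfun.scaleR_right real_scaleR_def)
  then have nonpos: "blinfun_apply (A (u n)) (i (u n)) \<le> 0" for n using eq0 by simp
  have zero: "\<forall>\<^sub>F n in sequentially. blinfun_apply (A (u n)) (i (y k)) = 0" for k
    using eventually_gt_at_top[of k] by eventually_elim (use eq0 in auto)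
  obtain v where v: "v \<in> closure \<Omega>" "A v = 0"
    by (rule approximate_zeros_converge[OF refl sep lin dense \<Omega>(2) hom, of "\<lambda>_. 0" u, OF _ _ ucl nonpos zero]) auto
  then have "v \<notin> frontier \<Omega>" using hom by (force simp: admissible_homotopy_def)
  then have "v \<in> \<Omega>" using v(1) \<Omega>(1) by (simp add: frontier_def interior_open)
  with v(2) show ?thesis by blast
qed

lemma ind_additive:
  assumes op: "open \<Omega>1" "open \<Omega>2" and disj: "\<Omega>1 \<inter> \<Omega>2 = {}" and bdd: "bounded (\<Omega>1 \<union> \<Omega>2)"
    and hom: "admissible_homotopy (\<Omega>1 \<union> \<Omega>2) i (\<lambda>_. A)"
  shows "ind i y A (\<Omega>1 \<union> \<Omega>2) = ind i y A \<Omega>1 + ind i y A \<Omega>2"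
proof -
  have opU: "open (\<Omega>1 \<union> \<Omega>2)" using op by auto
  \<comment> \<open>Disjoint open sets do not meet each other's closures, so the frontier of each
    piece is part of the frontier of the union and both pieces inherit admissibility.\<close>
  have dj: "closure \<Omega>1 \<inter> \<Omega>2 = {}" "closure \<Omega>2 \<inter> \<Omega>1 = {}"
    using op disj by (metis open_Int_closure_eq_empty inf_commute)+
  have fr: "frontier \<Omega>1 = closure \<Omega>1 - \<Omega>1" "frontier \<Omega>2 = closure \<Omega>2 - \<Omega>2"
    "frontier (\<Omega>1 \<union> \<Omega>2) = closure \<Omega>1 \<union> closure \<Omega>2 - (\<Omega>1 \<union> \<Omega>2)"
    using op opU by (simp_all add: frontier_def interior_open closure_Un)
  have hom1: "admissible_homotopy \<Omega>1 i (\<lambda>_. A)"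
    by (rule admissible_homotopy_subset[OF hom])
      (use dj in \<open>auto simp: closure_Un fr\<close>)
  have hom2: "admissible_homotopy \<Omega>2 i (\<lambda>_. A)"
    by (rule admissible_homotopy_subset[OF hom])
      (use dj in \<open>auto simp: closure_Un fr\<close>)
  have bdd12: "bounded \<Omega>1" "bounded \<Omega>2" using bdd by auto
  have "\<forall>\<^sub>F n in sequentially. ind i y A (\<Omega>1 \<union> \<Omega>2) = ind i y A \<Omega>1 + ind i y A \<Omega>2"
    using eventually_approx_degree_eq_ind[OF opU bdd hom] eventually_approx_degree_eq_ind[OF op(1) bdd12(1) hom1]
      eventually_approx_degree_eq_ind[OF op(2) bdd12(2) hom2] eventually_coord_map_nonzero[OF bdd hom]
  proof eventually_elim
    case (elim n)
    have Un: "coord_dom y n (\<Omega>1 \<union> \<Omega>2) = coord_dom y n \<Omega>1 \<union> coord_dom y n \<Omega>2"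
      by (auto simp: coord_dom_def)
    obtain L where L: "degree_admissible n (coord_map i y A n) (coord_dom y n (\<Omega>1 \<union> \<Omega>2)) L"
      using coord_map_homotopy(1)[OF opU bdd hom, of 0 n] elim(4) by auto
    have "coord_dom y n \<Omega>1 \<inter> coord_dom y n \<Omega>2 = {}" using disj by (auto simp: coord_dom_def)
    then have "approx_degree i y A (\<Omega>1 \<union> \<Omega>2) n = approx_degree i y A \<Omega>1 n + approx_degree i y A \<Omega>2 n"
      unfolding approx_degree_eq[OF indep] Un
      by (rule brouwer_degree_additive[OF L[unfolded Un] openin_coord_dom[OF op(1)] openin_coord_dom[OF op(2)]])
    then show ?case using elim by simp
  qed
  then show ?thesis by simp
qed

text \<open>The frontier relative to the span is contained in \<open>frontier \<Omega>\<close>, and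
  a nonzero coordinate vector gives a nonzero combination by linear independence. This makes the
  degrees in the limit meaningful.\<close>

lemma eventually_finite_rank_approx_nonzero:
  assumes \<Omega>: "open \<Omega>" "bounded \<Omega>" and hom: "admissible_homotopy \<Omega> i (\<lambda>_. A)"
  shows "\<forall>\<^sub>F n in sequentially. \<forall>u \<in> top_of_set (fin_span y n) frontier_of (\<Omega> \<inter> fin_span y n).
    finite_rank_approx i y A n u \<noteq> 0"
  using eventually_coord_map_nonzero[OF \<Omega>(2) hom]
proof eventually_elim
  case (elim n)
  show ?case
  proof
    fix u assume u: "u \<in> top_of_set (fin_span y n) frontier_of (\<Omega> \<inter> fin_span y n)"
    have "top_of_set (fin_span y n) interior_of (\<Omega> \<inter> fin_span y n) = \<Omega> \<inter> fin_span y n"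
      using \<Omega>(1) by (intro interior_of_openin) (subst Int_commute, rule openin_open_Int)
    moreover have "top_of_set (fin_span y n) closure_of (\<Omega> \<inter> fin_span y n) \<subseteq> fin_span y n \<inter> closure \<Omega>"
      using closure_subset[of \<Omega>] by (intro closure_of_minimal closedin_closed_Int) auto
    ultimately have "u \<in> fin_span y n" "u \<in> closure \<Omega>" "u \<notin> \<Omega>"
      using u by (auto simp: frontier_of_def)
    then obtain c where c: "c \<in> Rn n" "u = lincomb y n c" "u \<in> frontier \<Omega>"
      using \<Omega>(1) unfolding lincomb_image_Rn[symmetric] by (auto simp: frontier_def interior_open)
    then have "coord_map i y A n c \<noteq> (\<lambda>_. 0)" using elim by (auto simp: coord_dom_def)
    then show "finite_rank_approx i y A n u \<noteq> 0"
      using indep coord_map_Rn unfolding c(2) finite_rank_approx_lincomb lin_indep_seq_def by blast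
  qed
qed

end

theorem theorem3p2:
  fixes i :: "'y::banach \<Rightarrow> 'x::banach"
    and j :: "'h::{real_inner,complete_space} \<Rightarrow> 'y"
    and h :: "nat \<Rightarrow> 'h"
    and y :: "nat \<Rightarrow> 'y"
    and \<Omega> :: "'y set"
    and A :: "'y \<Rightarrow> 'x \<Rightarrow>\<^sub>L real"
  assumes "separable_space (euclidean :: 'y topology)"
    and "reflexive_space TYPE('y)"
    and "embedding i"
    and "dense_compact_embedding j"
    and "schauder_basis h"
    and "\<And>k. y k = j (h k)"
    and "open \<Omega>" and "bounded \<Omega>"
    and "bounded (A ` closure \<Omega>)"
    and "demicontinuous_on (closure \<Omega>) i A"
    and "S_plus_on (closure \<Omega>) i A"
    and "condition_H_on (closure \<Omega>) i A"
    and "\<And>u. u \<in> frontier \<Omega> \<Longrightarrow> A u \<noteq> 0"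
  shows "(\<forall>\<^sub>F n in sequentially.
            (\<forall>u \<in> top_of_set (fin_span y n) frontier_of (\<Omega> \<inter> fin_span y n).
               finite_rank_approx i y A n u \<noteq> 0) \<and>
            approx_degree i y A \<Omega> n = ind i y A \<Omega>)
    \<and> (ind i y A \<Omega> \<noteq> 0 \<longrightarrow> (\<exists>u\<in>\<Omega>. A u = 0))
    \<and> (\<forall>\<Omega>1 \<Omega>2. open \<Omega>1 \<and> open \<Omega>2 \<and> \<Omega>1 \<inter> \<Omega>2 = {} \<and> \<Omega> = \<Omega>1 \<union> \<Omega>2 \<longrightarrow>
         ind i y A \<Omega> = ind i y A \<Omega>1 + ind i y A \<Omega>2)
    \<and> (\<forall>H. admissible_homotopy \<Omega> i H \<longrightarrow>
         (\<forall>s\<in>{0..1}. \<forall>t\<in>{0..1}. ind i y (H s) \<Omega> = ind i y (H t) \<Omega>))"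
proof -
  have y: "y = (\<lambda>k. j (h k))" using assms(6) by auto
  interpret galerkin i y
  proof (rule galerkin.intro)
    show "lin_indep_seq y"
      unfolding y using schauder_lin_indep assms(4,5) by (auto simp: dense_compact_embedding_def)
    show "\<exists>m c. dist (lincomb y m c) x < e" if "e > 0" for x e
      unfolding y by (rule schauder_span_dense[OF assms(5,4) that])
    show "bounded_linear i" using assms(3) by (simp add: embedding_def)
  qed (use assms in auto)
  note \<Omega> = \<open>open \<Omega>\<close> \<open>bounded \<Omega>\<close>
  have hom: "admissible_homotopy \<Omega> i (\<lambda>_. A)"
    by (rule admissible_homotopy_map) (use assms in auto)
  show ?thesis
  proof (intro conjI allI impI ballI)
    show "\<forall>\<^sub>F n in sequentially.
        (\<forall>u \<in> top_of_set (fin_span y n) frontier_of (\<Omega> \<inter> fin_span y n). finite_rank_approx i y A n u \<noteq> 0) \<and>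
        approx_degree i y A \<Omega> n = ind i y A \<Omega>"
      by (intro eventually_conj eventually_finite_rank_approx_nonzero eventually_approx_degree_eq_ind \<Omega> hom)
    show "\<exists>u\<in>\<Omega>. A u = 0" if "ind i y A \<Omega> \<noteq> 0"
      using ind_nonzero_imp_zero[OF \<Omega> hom that] .
    show "ind i y A \<Omega> = ind i y A \<Omega>1 + ind i y A \<Omega>2"
      if "open \<Omega>1 \<and> open \<Omega>2 \<and> \<Omega>1 \<inter> \<Omega>2 = {} \<and> \<Omega> = \<Omega>1 \<union> \<Omega>2" for \<Omega>1 \<Omega>2
      using ind_additive[of \<Omega>1 \<Omega>2] that \<Omega>(2) hom by simp
    show "ind i y (H s) \<Omega> = ind i y (H t) \<Omega>"
      if "admissible_homotopy \<Omega> i H" "s \<in> {0..1}" "t \<in> {0..1}" for H s t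
      by (rule ind_homotopy[OF \<Omega> that])
  qed
qed

end
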